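(* Let $R$ be a semi-local unital ring with a complete family of Morita equivalent orthogonal idempotents $e_1, \ldots, e_n$, and suppose that $n \geq 3$. Then there is a unique action of $\mathrm{GL}(R)$ on $\mathrm{St}(R)$ by automorphisms making $\mathrm{st} \colon \mathrm{St}(R) \to \mathrm{GL}(R)$ a crossed module. Moreover, this action is consistent with the action of $\mathrm{St}(R) \rtimes \mathrm{D}(R)$ on $\mathrm{St}(R)$, i.e. the latter action is the pullback of the former along the homomorphism $\mathrm{St}(R) \rtimes \mathrm{D}(R) \to \mathrm{GL}(R)$, $(g, h) \mapsto \mathrm{st}(g)\, h$.
   Context: Rings are associative. A unital ring $R$ is semi-local if $R / \mathrm{J}(R)$ is a finite product of matrix rings (of finite sizes) over division rings, where $\mathrm{J}(R)$ is the Jacobson radical. An idempotent $e \in R$ Morita dominates an idempotent $\widetilde e \in R$ if $\widetilde e \in ReR$; two idempotents are Morita equivalent if each Morita dominates the other. A complete family of orthogonal idempotents is a family with $e_i e_j = 0$ for $i \neq j$ and $\sum_i e_i = 1$. Write $R_{ij} = e_i R e_j$ and $\mathrm{GL}(R) = R^*$. Steinberg group: $\mathrm{St}(R)$ is the group (depending on the family $e_1, \ldots, e_n$) generated by symbols $x_{ij}(a)$ for distinct $i, j \in \{1, \ldots, n\}$ and $a \in R_{ij}$, with the relations (St1) $x_{ij}(a)\, x_{ij}(b) = x_{ij}(a + b)$; (St2) $[x_{ij}(a), x_{kl}(b)] = 1$ for $j \neq k$ and $i \neq l$; (St3) $[x_{ij}(a), x_{jk}(b)] = x_{ik}(ab)$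 for $i \neq k$. Here $[x, y] = x y x^{-1} y^{-1}$. The homomorphism $\mathrm{st} \colon \mathrm{St}(R) \to \mathrm{GL}(R)$ is given by $x_{ij}(a) \mapsto 1 + a$. Diagonal group: $\mathrm{D}(R) = \{h \in \mathrm{GL}(R) \mid e_i h e_j = 0 \text{ for } i \neq j\}$. It acts on $\mathrm{St}(R)$ by automorphisms via ${}^h x_{ij}(a) = x_{ij}(h a h^{-1})$. The semidirect product $\mathrm{St}(R) \rtimes \mathrm{D}(R)$ acts on $\mathrm{St}(R)$, where $\mathrm{St}(R)$ acts on itself by conjugation and $\mathrm{D}(R)$ acts as just described. A crossed module is a group homomorphism $d \colon H \to G$ together with an action of $G$ on $H$ by automorphisms, denoted ${}^g h$, such that $d({}^g h) = g\, d(h)\, g^{-1}$ and ${}^{d(h)} h' = h h' h^{-1}$ for all $g \in G$, $h, h' \in H$. *)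

theory Defs
  imports "HOL-Algebra.Algebra"
begin

section \<open>Semi-local rings\<close>

definition left_ideal :: "('a, 'm) ring_scheme \<Rightarrow> 'a set \<Rightarrow> bool" where
  "left_ideal R I \<longleftrightarrow>
     additive_subgroup I R \<and> (\<forall>x\<in>carrier R. \<forall>a\<in>I. x \<otimes>\<^bsub>R\<^esub> a \<in> I)"

definition maximal_left_ideal :: "('a, 'm) ring_scheme \<Rightarrow> 'a set \<Rightarrow> bool" where
  "maximal_left_ideal R I \<longleftrightarrow>
     left_ideal R I \<and> I \<noteq> carrier R \<and>
     (\<forall>J. left_ideal R J \<and> I \<subseteq> J \<longrightarrow> J = I \<or> J = carrier R)"

definition jacobson_radical :: "('a, 'm) ring_scheme \<Rightarrow> 'a set" where
  "jacobson_radical R = carrier R \<inter> \<Inter> {I. maximal_left_ideal R I}"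

definition division_ring :: "('a, 'm) ring_scheme \<Rightarrow> bool" where
  "division_ring D \<longleftrightarrow> ring D \<and> \<one>\<^bsub>D\<^esub> \<noteq> \<zero>\<^bsub>D\<^esub> \<and> Units D = carrier D - {\<zero>\<^bsub>D\<^esub>}"

definition matrix_ring :: "nat \<Rightarrow> ('a, 'm) ring_scheme \<Rightarrow> (nat \<times> nat \<Rightarrow> 'a) ring" where
  "matrix_ring m D =
     \<lparr>carrier = {..<m} \<times> {..<m} \<rightarrow>\<^sub>E carrier D,
      monoid.mult = (\<lambda>A B. \<lambda>(i, j)\<in>{..<m} \<times> {..<m}. \<Oplus>\<^bsub>D\<^esub>k\<in>{..<m}. A (i, k) \<otimes>\<^bsub>D\<^esub> B (k, j)),
      one = (\<lambda>(i, j)\<in>{..<m} \<times> {..<m}. if i = j then \<one>\<^bsub>D\<^esub> else \<zero>\<^bsub>D\<^esub>),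
      ring.zero = (\<lambda>(i, j)\<in>{..<m} \<times> {..<m}. \<zero>\<^bsub>D\<^esub>),
      ring.add = (\<lambda>A B. \<lambda>(i, j)\<in>{..<m} \<times> {..<m}. A (i, j) \<oplus>\<^bsub>D\<^esub> B (i, j))\<rparr>"

text \<open>The division rings may be different for the different factors, but have their carriers in one
  type \<^typ>\<open>'d\<close>. Since \<^typ>\<open>'d\<close> is arbitrary, this is no restriction: any finite list of rings
  can be transported to a common type, such as the sum of their types.\<close>

definition semilocal :: "'d itself \<Rightarrow> ('a, 'm) ring_scheme \<Rightarrow> bool" where
  "semilocal _ R \<longleftrightarrow>
     (\<exists>ds :: (nat \<times> 'd ring) list.
        (\<forall>(m, D)\<in>set ds. 0 < m \<and> division_ring D) \<and>
        R Quot (jacobson_radical R) \<simeq> RDirProd_list (map (\<lambda>(m, D). matrix_ring m D) ds))"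


section \<open>Families of idempotents\<close>

definition complete_orthogonal_idempotents ::
  "('a, 'm) ring_scheme \<Rightarrow> nat \<Rightarrow> (nat \<Rightarrow> 'a) \<Rightarrow> bool" where
  "complete_orthogonal_idempotents R n e \<longleftrightarrow>
     (\<forall>i\<in>{1..n}. e i \<in> carrier R \<and> e i \<otimes>\<^bsub>R\<^esub> e i = e i) \<and>
     (\<forall>i\<in>{1..n}. \<forall>j\<in>{1..n}. i \<noteq> j \<longrightarrow> e i \<otimes>\<^bsub>R\<^esub> e j = \<zero>\<^bsub>R\<^esub>) \<and>
     (\<Oplus>\<^bsub>R\<^esub>i\<in>{1..n}. e i) = \<one>\<^bsub>R\<^esub>"

text \<open>\<open>RpR\<close> is the additive subgroup spanned by the products \<open>a p b\<close>.\<close>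

definition morita_dominates :: "('a, 'm) ring_scheme \<Rightarrow> 'a \<Rightarrow> 'a \<Rightarrow> bool" where
  "morita_dominates R p q \<longleftrightarrow>
     q \<in> generate (add_monoid R) {a \<otimes>\<^bsub>R\<^esub> p \<otimes>\<^bsub>R\<^esub> b | a b. a \<in> carrier R \<and> b \<in> carrier R}"

definition morita_equivalent :: "('a, 'm) ring_scheme \<Rightarrow> 'a \<Rightarrow> 'a \<Rightarrow> bool" where
  "morita_equivalent R p q \<longleftrightarrow> morita_dominates R p q \<and> morita_dominates R q p"

definition peirce :: "('a, 'm) ring_scheme \<Rightarrow> (nat \<Rightarrow> 'a) \<Rightarrow> nat \<Rightarrow> nat \<Rightarrow> 'a set" where
  "peirce R e i j = {e i \<otimes>\<^bsub>R\<^esub> a \<otimes>\<^bsub>R\<^esub> e j | a. a \<in> carrier R}"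

abbreviation GL :: "('a, 'm) ring_scheme \<Rightarrow> 'a monoid" where
  "GL R \<equiv> units_of R"


section \<open>Groups given by generators and relations\<close>

text \<open>The letter \<open>(True, g)\<close> stands for the generator \<open>g\<close> and \<open>(False, g)\<close> for its inverse.
  A relation is a pair of words to be identified.\<close>

type_synonym 'g word = "(bool \<times> 'g) list"

definition words :: "'g set \<Rightarrow> 'g word set" where
  "words S = lists (UNIV \<times> S)"

definition inv_word :: "'g word \<Rightarrow> 'g word" where
  "inv_word w = rev (map (\<lambda>(b, g). (\<not> b, g)) w)"

definition comm_word :: "'g word \<Rightarrow> 'g word \<Rightarrow> 'g word" where
  "comm_word u v = u @ v @ inv_word u @ inv_word v"

inductive word_eq :: "'g set \<Rightarrow> ('g word \<times> 'g word) set \<Rightarrow> 'g word \<Rightarrow> 'g word \<Rightarrow> bool"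
  for S Q where
  refl: "w \<in> words S \<Longrightarrow> word_eq S Q w w"
| sym: "word_eq S Q u v \<Longrightarrow> word_eq S Q v u"
| trans: "word_eq S Q u v \<Longrightarrow> word_eq S Q v w \<Longrightarrow> word_eq S Q u w"
| append: "word_eq S Q u u' \<Longrightarrow> word_eq S Q v v' \<Longrightarrow> word_eq S Q (u @ v) (u' @ v')"
| cancel: "g \<in> S \<Longrightarrow> word_eq S Q [(b, g), (\<not> b, g)] []"
| relation: "(u, v) \<in> Q \<Longrightarrow> u \<in> words S \<Longrightarrow> v \<in> words S \<Longrightarrow> word_eq S Q u v"

definition word_rel :: "'g set \<Rightarrow> ('g word \<times> 'g word) set \<Rightarrow> ('g word \<times> 'g word) set" where
  "word_rel S Q = {(u, v). word_eq S Q u v}"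

definition presented_group :: "'g set \<Rightarrow> ('g word \<times> 'g word) set \<Rightarrow> 'g word set monoid" where
  "presented_group S Q =
     \<lparr>carrier = words S // word_rel S Q,
      monoid.mult = (\<lambda>U V. \<Union>u\<in>U. \<Union>v\<in>V. word_rel S Q `` {u @ v}),
      one = word_rel S Q `` {[]}\<rparr>"

definition presented_gen :: "'g set \<Rightarrow> ('g word \<times> 'g word) set \<Rightarrow> 'g \<Rightarrow> 'g word set" where
  "presented_gen S Q g = word_rel S Q `` {[(True, g)]}"

primrec word_eval :: "('b, 'm) monoid_scheme \<Rightarrow> ('g \<Rightarrow> 'b) \<Rightarrow> 'g word \<Rightarrow> 'b" where
  "word_eval G f [] = \<one>\<^bsub>G\<^esub>"
| "word_eval G f (l # w) =
     (if fst l then f (snd l) else inv\<^bsub>G\<^esub> f (snd l)) \<otimes>\<^bsub>G\<^esub> word_eval G f w"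

text \<open>The homomorphism to \<open>G\<close> that sends each generator \<open>g\<close> to \<open>f g\<close>. It is meaningful
  if \<open>f\<close> respects the relations, see \<open>presented_lift_hom\<close> and \<open>presented_lift_gen\<close>.\<close>

definition presented_lift ::
  "'g set \<Rightarrow> ('g word \<times> 'g word) set \<Rightarrow> ('b, 'm) monoid_scheme \<Rightarrow> ('g \<Rightarrow> 'b) \<Rightarrow> 'g word set \<Rightarrow> 'b"
  where
  "presented_lift S Q G f =
     (\<lambda>U\<in>carrier (presented_group S Q). the_elem (word_eval G f ` U))"

lemma words_simps [simp]:
  "[] \<in> words S"
  "(b, g) # w \<in> words S \<longleftrightarrow> g \<in> S \<and> w \<in> words S"
  "u @ v \<in> words S \<longleftrightarrow> u \<in> words S \<and> v \<in> words S"
  "inv_word u \<in> words S \<longleftrightarrow> u \<in> words S"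
  by (auto simp: words_def inv_word_def)

lemma word_eq_words: "word_eq S Q u v \<Longrightarrow> u \<in> words S \<and> v \<in> words S"
  by (induction rule: word_eq.induct) auto

lemma equiv_word_rel: "equiv (words S) (word_rel S Q)"
  unfolding word_rel_def
  by (rule equivI)
    (auto simp: refl_on_def sym_def trans_def dest: word_eq_words
      intro: word_eq.refl word_eq.sym word_eq.trans)

lemma word_class_eq_iff:
  assumes "u \<in> words S" "v \<in> words S"
  shows "word_rel S Q `` {u} = word_rel S Q `` {v} \<longleftrightarrow> word_eq S Q u v"
  using eq_equiv_class_iff[OF equiv_word_rel assms, of Q] by (simp add: word_rel_def)

lemma presented_group_carrierE:
  assumes "U \<in> carrier (presented_group S Q)"
  obtains u where "u \<in> words S" "U = word_rel S Q `` {u}"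
  using assms by (auto simp: presented_group_def elim: quotientE)

lemma word_class_closed [simp]:
  "u \<in> words S \<Longrightarrow> word_rel S Q `` {u} \<in> carrier (presented_group S Q)"
  by (auto simp: presented_group_def intro: quotientI)

lemma presented_group_mult:
  assumes "u \<in> words S" "v \<in> words S"
  shows "word_rel S Q `` {u} \<otimes>\<^bsub>presented_group S Q\<^esub> word_rel S Q `` {v} = word_rel S Q `` {u @ v}"
proof -
  have "word_rel S Q `` {u' @ v'} = word_rel S Q `` {u @ v}"
    if "u' \<in> word_rel S Q `` {u}" "v' \<in> word_rel S Q `` {v}" for u' v'
  proof -
    have "word_eq S Q u u'" "word_eq S Q v v'" using that by (auto simp: word_rel_def)
    then have "word_eq S Q (u' @ v') (u @ v)" by (metis word_eq.append word_eq.sym)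
    then show ?thesis by (meson word_class_eq_iff word_eq_words)
  qed
  then have "(\<Union>u'\<in>word_rel S Q `` {u}. \<Union>v'\<in>word_rel S Q `` {v}. word_rel S Q `` {u' @ v'}) =
      (\<Union>u'\<in>word_rel S Q `` {u}. \<Union>v'\<in>word_rel S Q `` {v}. word_rel S Q `` {u @ v})"
    by (intro SUP_cong HOL.refl)
  also have "\<dots> = word_rel S Q `` {u @ v}"
  proof -
    have "word_rel S Q `` {u} \<noteq> {}" "word_rel S Q `` {v} \<noteq> {}"
      using assms by (auto simp: word_rel_def intro: word_eq.refl)
    then show ?thesis by simp
  qed
  finally show ?thesis by (simp add: presented_group_def)
qed

lemma word_eq_inv: "w \<in> words S \<Longrightarrow> word_eq S Q (inv_word w @ w) []"
proof (induction w)
  case Nil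
  then show ?case by (simp add: inv_word_def word_eq.refl)
next
  case (Cons l w)
  obtain b g where l: "l = (b, g)" by force
  have g: "g \<in> S" and w: "w \<in> words S" using Cons.prems by (auto simp: l)
  have "word_eq S Q ([(\<not> b, g), (b, g)] @ w) ([] @ w)"
    using word_eq.cancel[OF g, of Q "\<not> b"] w by (intro word_eq.append word_eq.refl) auto
  then have "word_eq S Q (inv_word w @ ([(\<not> b, g), (b, g)] @ w)) (inv_word w @ w)"
    using w by (intro word_eq.append word_eq.refl) auto
  then have "word_eq S Q (inv_word (l # w) @ l # w) (inv_word w @ w)"
    by (simp add: l inv_word_def)
  then show ?case using Cons.IH[OF w] by (rule word_eq.trans)
qed

lemma presented_group_is_group: "group (presented_group S Q)"
proof (rule groupI)
  fix U V assume "U \<in> carrier (presented_group S Q)" "V \<in> carrier (presented_group S Q)"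
  then show "U \<otimes>\<^bsub>presented_group S Q\<^esub> V \<in> carrier (presented_group S Q)"
    by (auto elim!: presented_group_carrierE simp: presented_group_mult)
next
  show "\<one>\<^bsub>presented_group S Q\<^esub> \<in> carrier (presented_group S Q)"
    using word_class_closed[of "[]" S Q] by (simp add: presented_group_def)
next
  fix U V W assume "U \<in> carrier (presented_group S Q)" "V \<in> carrier (presented_group S Q)"
    "W \<in> carrier (presented_group S Q)"
  then show "U \<otimes>\<^bsub>presented_group S Q\<^esub> V \<otimes>\<^bsub>presented_group S Q\<^esub> W =
      U \<otimes>\<^bsub>presented_group S Q\<^esub> (V \<otimes>\<^bsub>presented_group S Q\<^esub> W)"
    by (auto elim!: presented_group_carrierE simp: presented_group_mult)
next
  fix U assume "U \<in> carrier (presented_group S Q)"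
  then obtain u where u: "u \<in> words S" "U = word_rel S Q `` {u}"
    by (rule presented_group_carrierE)
  have one: "\<one>\<^bsub>presented_group S Q\<^esub> = word_rel S Q `` {[]}" by (simp add: presented_group_def)
  show "\<one>\<^bsub>presented_group S Q\<^esub> \<otimes>\<^bsub>presented_group S Q\<^esub> U = U"
    using u presented_group_mult[of "[]" S u Q] by (simp add: one)
  have "word_rel S Q `` {inv_word u @ u} = word_rel S Q `` {[]}"
    using u word_eq_inv[of u S Q] by (subst word_class_eq_iff) auto
  then show "\<exists>V\<in>carrier (presented_group S Q).
      V \<otimes>\<^bsub>presented_group S Q\<^esub> U = \<one>\<^bsub>presented_group S Q\<^esub>"
    using u presented_group_mult[of "inv_word u" S u Q]
    by (intro bexI[of _ "word_rel S Q `` {inv_word u}"]) (auto simp: one)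
qed

context
  fixes S :: "'g set" and Q :: "('g word \<times> 'g word) set" and G :: "('b, 'm) monoid_scheme"
    and f :: "'g \<Rightarrow> 'b"
  assumes G: "group G" and f: "f \<in> S \<rightarrow> carrier G"
    and rels: "\<And>u v. (u, v) \<in> Q \<Longrightarrow> u \<in> words S \<Longrightarrow> v \<in> words S \<Longrightarrow> word_eval G f u = word_eval G f v"
begin

interpretation group G by (rule G)

lemma word_eval_closed: "w \<in> words S \<Longrightarrow> word_eval G f w \<in> carrier G"
proof (induction w)
  case (Cons l w)
  then show ?case using f by (cases l) auto
qed auto

lemma word_eval_append:
  "u \<in> words S \<Longrightarrow> v \<in> words S \<Longrightarrow> word_eval G f (u @ v) = word_eval G f u \<otimes>\<^bsub>G\<^esub> word_eval G f v"
proof (induction u)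
  case Nil
  then show ?case by (simp add: word_eval_closed)
next
  case (Cons l u)
  then show ?case using f by (cases l) (auto simp: word_eval_closed m_assoc Pi_iff)
qed

lemma word_eval_cong: "word_eq S Q u v \<Longrightarrow> word_eval G f u = word_eval G f v"
proof (induction rule: word_eq.induct)
  case (append u u' v v')
  then show ?case using word_eq_words by (metis word_eval_append)
next
  case (cancel g b)
  then have "f g \<in> carrier G" using f by auto
  then show ?case by simp
qed (auto intro: rels)

lemma presented_lift_class:
  assumes "w \<in> words S"
  shows "presented_lift S Q G f (word_rel S Q `` {w}) = word_eval G f w"
proof -
  have "word_eval G f ` (word_rel S Q `` {w}) = {word_eval G f w}"
    using assms by (auto simp: word_rel_def image_iff dest: word_eval_cong intro: word_eq.refl)
  then show ?thesis using assms by (simp add: presented_lift_def)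
qed

lemma presented_lift_hom: "presented_lift S Q G f \<in> hom (presented_group S Q) G"
  by (rule homI)
    (auto elim!: presented_group_carrierE
      simp: presented_lift_class presented_group_mult word_eval_closed word_eval_append)

lemma presented_lift_gen:
  assumes "g \<in> S"
  shows "presented_lift S Q G f (presented_gen S Q g) = f g"
  using assms f by (auto simp: presented_gen_def presented_lift_class Pi_iff)

end


section \<open>The Steinberg group\<close>

definition steinberg_gens ::
  "('a, 'm) ring_scheme \<Rightarrow> nat \<Rightarrow> (nat \<Rightarrow> 'a) \<Rightarrow> (nat \<times> nat \<times> 'a) set" where
  "steinberg_gens R n e =
     {(i, j, a). i \<in> {1..n} \<and> j \<in> {1..n} \<and> i \<noteq> j \<and> a \<in> peirce R e i j}"

definition steinberg_rels ::
  "('a, 'm) ring_scheme \<Rightarrow> nat \<Rightarrow> (nat \<Rightarrow> 'a) \<Rightarrow>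
     ((nat \<times> nat \<times> 'a) word \<times> (nat \<times> nat \<times> 'a) word) set" where
  "steinberg_rels R n e =
     (let S = steinberg_gens R n e; x = (\<lambda>i j a. [(True, (i, j, a))]) in
       {(x i j a @ x i j b, x i j (a \<oplus>\<^bsub>R\<^esub> b)) | i j a b. (i, j, a) \<in> S \<and> (i, j, b) \<in> S} \<union>
       {(comm_word (x i j a) (x k l b), []) | i j k l a b.
          (i, j, a) \<in> S \<and> (k, l, b) \<in> S \<and> j \<noteq> k \<and> i \<noteq> l} \<union>
       {(comm_word (x i j a) (x j k b), x i k (a \<otimes>\<^bsub>R\<^esub> b)) | i j k a b.
          (i, j, a) \<in> S \<and> (j, k, b) \<in> S \<and> i \<noteq> k})"

definition St ::
  "('a, 'm) ring_scheme \<Rightarrow> nat \<Rightarrow> (nat \<Rightarrow> 'a) \<Rightarrow> (nat \<times> nat \<times> 'a) word set monoid" where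
  "St R n e = presented_group (steinberg_gens R n e) (steinberg_rels R n e)"

definition st_x ::
  "('a, 'm) ring_scheme \<Rightarrow> nat \<Rightarrow> (nat \<Rightarrow> 'a) \<Rightarrow> nat \<Rightarrow> nat \<Rightarrow> 'a \<Rightarrow> (nat \<times> nat \<times> 'a) word set" where
  "st_x R n e i j a = presented_gen (steinberg_gens R n e) (steinberg_rels R n e) (i, j, a)"

definition st ::
  "('a, 'm) ring_scheme \<Rightarrow> nat \<Rightarrow> (nat \<Rightarrow> 'a) \<Rightarrow> (nat \<times> nat \<times> 'a) word set \<Rightarrow> 'a" where
  "st R n e =
     presented_lift (steinberg_gens R n e) (steinberg_rels R n e) (GL R)
       (\<lambda>(i, j, a). \<one>\<^bsub>R\<^esub> \<oplus>\<^bsub>R\<^esub> a)"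

definition diagonal_group ::
  "('a, 'm) ring_scheme \<Rightarrow> nat \<Rightarrow> (nat \<Rightarrow> 'a) \<Rightarrow> 'a monoid" where
  "diagonal_group R n e =
     (GL R)\<lparr>carrier := {h \<in> carrier (GL R).
       \<forall>i\<in>{1..n}. \<forall>j\<in>{1..n}. i \<noteq> j \<longrightarrow> e i \<otimes>\<^bsub>R\<^esub> h \<otimes>\<^bsub>R\<^esub> e j = \<zero>\<^bsub>R\<^esub>}\<rparr>"

definition diagonal_action ::
  "('a, 'm) ring_scheme \<Rightarrow> nat \<Rightarrow> (nat \<Rightarrow> 'a) \<Rightarrow>
     'a \<Rightarrow> (nat \<times> nat \<times> 'a) word set \<Rightarrow> (nat \<times> nat \<times> 'a) word set" where
  "diagonal_action R n e h =
     presented_lift (steinberg_gens R n e) (steinberg_rels R n e) (St R n e)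
       (\<lambda>(i, j, a). st_x R n e i j (h \<otimes>\<^bsub>R\<^esub> a \<otimes>\<^bsub>R\<^esub> inv\<^bsub>R\<^esub> h))"

lemma word_eval_comm_word:
  assumes "group G" "g \<in> carrier G" "h \<in> carrier G" "f p = g" "f q = h"
  shows "word_eval G f (comm_word [(True, p)] [(True, q)]) =
    g \<otimes>\<^bsub>G\<^esub> (h \<otimes>\<^bsub>G\<^esub> (inv\<^bsub>G\<^esub> g \<otimes>\<^bsub>G\<^esub> inv\<^bsub>G\<^esub> h))"
proof -
  interpret group G by fact
  show ?thesis using assms by (simp add: comm_word_def inv_word_def)
qed

lemma (in group) comm_eqI:
  assumes "g \<in> carrier G" "h \<in> carrier G" "z \<in> carrier G" "g \<otimes> h = z \<otimes> (h \<otimes> g)"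
  shows "g \<otimes> (h \<otimes> (inv g \<otimes> inv h)) = z"
proof -
  have "g \<otimes> (h \<otimes> (inv g \<otimes> inv h)) = (g \<otimes> h) \<otimes> inv (h \<otimes> g)"
    using assms(1-3) by (simp add: m_assoc inv_mult_group)
  also have "\<dots> = z" unfolding assms(4) using assms(1-3) by (simp add: m_assoc)
  finally show ?thesis .
qed

context
  fixes R :: "('a, 'm) ring_scheme" (structure) and n :: nat and e :: "nat \<Rightarrow> 'a"
  assumes R: "ring R" and e: "complete_orthogonal_idempotents R n e"
begin

interpretation ring R by (rule R)

interpretation GL: group "GL R" by (rule units_group)

lemma e_closed [simp]: "i \<in> {1..n} \<Longrightarrow> e i \<in> carrier R"
  using e by (auto simp: complete_orthogonal_idempotents_def)

lemma peirce_closed: "i \<in> {1..n} \<Longrightarrow> j \<in> {1..n} \<Longrightarrow> a \<in> peirce R e i j \<Longrightarrow> a \<in> carrier R"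
  by (auto simp: peirce_def)

lemma peirce_iff:
  assumes "i \<in> {1..n}" "j \<in> {1..n}"
  shows "a \<in> peirce R e i j \<longleftrightarrow> a \<in> carrier R \<and> e i \<otimes> a = a \<and> a \<otimes> e j = a"
proof
  assume "a \<in> peirce R e i j"
  then obtain b where "b \<in> carrier R" "a = e i \<otimes> b \<otimes> e j" by (auto simp: peirce_def)
  moreover have "e i \<otimes> e i = e i" "e j \<otimes> e j = e j"
    using e assms by (auto simp: complete_orthogonal_idempotents_def)
  ultimately show "a \<in> carrier R \<and> e i \<otimes> a = a \<and> a \<otimes> e j = a"
    using assms by (metis e_closed m_assoc m_closed)
next
  assume "a \<in> carrier R \<and> e i \<otimes> a = a \<and> a \<otimes> e j = a"
  then show "a \<in> peirce R e i j" by (auto simp: peirce_def intro!: exI[of _ a])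
qed

lemma peirce_mult_zero:
  assumes "i \<in> {1..n}" "j \<in> {1..n}" "k \<in> {1..n}" "l \<in> {1..n}"
    "a \<in> peirce R e i j" "b \<in> peirce R e k l" "j \<noteq> k"
  shows "a \<otimes> b = \<zero>"
proof -
  have *: "a \<in> carrier R" "a \<otimes> e j = a" "b \<in> carrier R" "e k \<otimes> b = b"
    using assms by (auto simp: peirce_iff)
  have "e j \<otimes> e k = \<zero>" using e assms by (auto simp: complete_orthogonal_idempotents_def)
  then have "a \<otimes> e j \<otimes> (e k \<otimes> b) = \<zero>"
    using * assms by (metis e_closed l_null m_assoc m_closed r_null)
  then show ?thesis using * by simp
qed

lemma peirce_mult:
  assumes "i \<in> {1..n}" "j \<in> {1..n}" "k \<in> {1..n}" "a \<in> peirce R e i j" "b \<in> peirce R e j k"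
  shows "a \<otimes> b \<in> peirce R e i k"
  using assms by (auto simp: peirce_iff m_assoc) (simp add: m_assoc[symmetric])

lemma peirce_add:
  assumes "i \<in> {1..n}" "j \<in> {1..n}" "a \<in> peirce R e i j" "b \<in> peirce R e i j"
  shows "a \<oplus> b \<in> peirce R e i j"
  using assms by (auto simp: peirce_iff l_distr r_distr)

lemma one_plus_peirce:
  assumes "i \<in> {1..n}" "j \<in> {1..n}" "i \<noteq> j" "a \<in> peirce R e i j"
  shows "\<one> \<oplus> a \<in> Units R"
proof -
  have a: "a \<in> carrier R" using assms peirce_closed by blast
  have aa: "a \<otimes> a = \<zero>" using assms peirce_mult_zero by blast
  have "(\<one> \<oplus> a) \<otimes> (\<one> \<ominus> a) = \<one>" "(\<one> \<ominus> a) \<otimes> (\<one> \<oplus> a) = \<one>"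
    using a aa by (simp_all add: minus_eq l_distr r_distr l_minus r_minus a_assoc l_neg r_neg)
  then show ?thesis using a by (auto simp: Units_def intro!: bexI[of _ "\<one> \<ominus> a"])
qed

lemma steinberg_gensD:
  assumes "(i, j, a) \<in> steinberg_gens R n e"
  shows "i \<in> {1..n}" "j \<in> {1..n}" "i \<noteq> j" "a \<in> peirce R e i j" "a \<in> carrier R"
  using assms peirce_closed by (auto simp: steinberg_gens_def)

lemma steinberg_rels_cases:
  assumes "(u, v) \<in> steinberg_rels R n e"
  obtains
    (St1) i j a b where "(i, j, a) \<in> steinberg_gens R n e" "(i, j, b) \<in> steinberg_gens R n e"
      "u = [(True, (i, j, a)), (True, (i, j, b))]" "v = [(True, (i, j, a \<oplus> b))]"
  | (St2) i j k l a b where "(i, j, a) \<in> steinberg_gens R n e" "(k, l, b) \<in> steinberg_gens R n e"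
      "j \<noteq> k" "i \<noteq> l" "u = comm_word [(True, (i, j, a))] [(True, (k, l, b))]" "v = []"
  | (St3) i j k a b where "(i, j, a) \<in> steinberg_gens R n e" "(j, k, b) \<in> steinberg_gens R n e"
      "i \<noteq> k" "u = comm_word [(True, (i, j, a))] [(True, (j, k, b))]" "v = [(True, (i, k, a \<otimes> b))]"
  using assms unfolding steinberg_rels_def Let_def by auto

lemma st_respects_rels:
  assumes "(u, v) \<in> steinberg_rels R n e"
  shows "word_eval (GL R) (\<lambda>(i, j, a). \<one> \<oplus> a) u = word_eval (GL R) (\<lambda>(i, j, a). \<one> \<oplus> a) v"
  using assms
proof (cases rule: steinberg_rels_cases)
  case (St1 i j a b)
  note * = steinberg_gensD[OF St1(1)] steinberg_gensD[OF St1(2)]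
  have "a \<otimes> b = \<zero>" using * peirce_mult_zero by blast
  moreover have "a \<oplus> b \<in> carrier R" using * by simp
  ultimately show ?thesis using * unfolding St1
    by (simp add: units_of_mult units_of_one l_distr r_distr a_ac)
next
  case (St2 i j k l a b)
  note * = steinberg_gensD[OF St2(1)] steinberg_gensD[OF St2(2)]
  have "a \<otimes> b = \<zero>" "b \<otimes> a = \<zero>" using * St2(3,4) peirce_mult_zero by metis+
  then have "(\<one> \<oplus> a) \<otimes> (\<one> \<oplus> b) = \<one> \<otimes> ((\<one> \<oplus> b) \<otimes> (\<one> \<oplus> a))"
    using * by (simp add: l_distr r_distr a_ac)
  moreover have "\<one> \<oplus> a \<in> Units R" "\<one> \<oplus> b \<in> Units R" using * one_plus_peirce by blast+
  ultimately show ?thesis unfolding St2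
    by (subst word_eval_comm_word[OF GL.group_axioms])
      (auto simp: units_of_carrier units_of_mult units_of_one Units_closed
        intro!: GL.comm_eqI[of "\<one> \<oplus> a" "\<one> \<oplus> b" \<one>, unfolded units_of_carrier units_of_mult])
next
  case (St3 i j k a b)
  note * = steinberg_gensD[OF St3(1)] steinberg_gensD[OF St3(2)]
  have ab: "a \<otimes> b \<in> peirce R e i k" using * peirce_mult by blast
  have z: "b \<otimes> a = \<zero>" "a \<otimes> b \<otimes> b = \<zero>" "a \<otimes> b \<otimes> a = \<zero>"
    using * St3(3) ab peirce_mult_zero by metis+
  then have "(\<one> \<oplus> a) \<otimes> (\<one> \<oplus> b) = (\<one> \<oplus> a \<otimes> b) \<otimes> ((\<one> \<oplus> b) \<otimes> (\<one> \<oplus> a))"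
    using * by (simp add: l_distr r_distr a_ac m_assoc[symmetric])
  moreover have "\<one> \<oplus> a \<in> Units R" "\<one> \<oplus> b \<in> Units R" "\<one> \<oplus> a \<otimes> b \<in> Units R"
    using * ab St3(3) one_plus_peirce by blast+
  ultimately show ?thesis unfolding St3
    by (subst word_eval_comm_word[OF GL.group_axioms])
      (auto simp: units_of_carrier units_of_mult units_of_one Units_closed
        intro!: GL.comm_eqI[of "\<one> \<oplus> a" "\<one> \<oplus> b" "\<one> \<oplus> a \<otimes> b", unfolded units_of_carrier units_of_mult])
qed

lemma st_gens_in_GL: "(\<lambda>(i, j, a). \<one> \<oplus> a) \<in> steinberg_gens R n e \<rightarrow> carrier (GL R)"
proof clarify
  fix i j a assume "(i, j, a) \<in> steinberg_gens R n e"
  from one_plus_peirce[OF steinberg_gensD(1-4)[OF this]]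
  show "\<one> \<oplus> a \<in> carrier (GL R)" by (simp add: units_of_carrier)
qed

lemma st_hom: "st R n e \<in> hom (St R n e) (GL R)"
  unfolding st_def St_def
  by (rule presented_lift_hom[OF GL.group_axioms st_gens_in_GL st_respects_rels])

lemma st_st_x:
  assumes "i \<in> {1..n}" "j \<in> {1..n}" "i \<noteq> j" "a \<in> peirce R e i j"
  shows "st R n e (st_x R n e i j a) = \<one> \<oplus> a"
  unfolding st_def st_x_def
  using presented_lift_gen[OF GL.group_axioms st_gens_in_GL st_respects_rels, where g = "(i, j, a)"] assms
  by (auto simp: steinberg_gens_def)

lemma diagonal_group_commute:
  assumes h: "h \<in> carrier (diagonal_group R n e)" and i: "i \<in> {1..n}"
  shows "e i \<otimes> h = h \<otimes> e i"
proof -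
  have h': "h \<in> carrier R" and
    off: "\<And>k l. k \<in> {1..n} \<Longrightarrow> l \<in> {1..n} \<Longrightarrow> k \<noteq> l \<Longrightarrow> e k \<otimes> h \<otimes> e l = \<zero>"
    using h by (auto simp: diagonal_group_def units_of_carrier)
  have sum: "(\<Oplus>k\<in>{1..n}. e k) = \<one>" using e by (simp add: complete_orthogonal_idempotents_def)
  have ec: "e \<in> {1..n} \<rightarrow> carrier R" by auto
  have "e i \<otimes> h = (\<Oplus>k\<in>{1..n}. e i \<otimes> h \<otimes> e k)"
    using finsum_rdistr[of "{1..n}" "e i \<otimes> h" e] ec h' i by (simp add: sum[simplified])
  also have "\<dots> = (\<Oplus>k\<in>{1..n}. if i = k then e k \<otimes> h \<otimes> e k else \<zero>)"
    using off i h' by (intro add.finprod_cong') auto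
  also have "\<dots> = e i \<otimes> h \<otimes> e i"
    using i h' by (intro add.finprod_singleton) auto
  also have "\<dots> = (\<Oplus>k\<in>{1..n}. if i = k then e k \<otimes> h \<otimes> e k else \<zero>)"
    using i h' by (intro add.finprod_singleton[symmetric]) auto
  also have "\<dots> = (\<Oplus>k\<in>{1..n}. e k \<otimes> (h \<otimes> e i))"
    using off i h' by (intro add.finprod_cong') (auto simp: m_assoc)
  also have "\<dots> = h \<otimes> e i"
    using finsum_ldistr[of "{1..n}" "h \<otimes> e i" e] ec h' i by (simp add: sum[simplified])
  finally show ?thesis .
qed

lemma diagonal_conj:
  assumes h: "h \<in> carrier (diagonal_group R n e)"
    and ij: "i \<in> {1..n}" "j \<in> {1..n}" and a: "a \<in> peirce R e i j"
  shows "h \<otimes> a \<otimes> inv h \<in> peirce R e i j"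
proof -
  have hU: "h \<in> Units R" using h by (auto simp: diagonal_group_def units_of_carrier)
  then have c: "h \<in> carrier R" "inv h \<in> carrier R" by auto
  have "inv h \<otimes> e j = inv h \<otimes> (e j \<otimes> h) \<otimes> inv h"
    using hU c ij by (simp add: m_assoc)
  also have "\<dots> = inv h \<otimes> h \<otimes> (e j \<otimes> inv h)"
    using c ij by (simp add: m_assoc diagonal_group_commute[OF h])
  also have "\<dots> = e j \<otimes> inv h" using hU c ij by simp
  finally have 1: "inv h \<otimes> e j = e j \<otimes> inv h" .
  have 2: "a \<in> carrier R" "e i \<otimes> a = a" "a \<otimes> e j = a" using a ij by (auto simp: peirce_iff)
  have "e i \<otimes> (h \<otimes> a \<otimes> inv h) = (e i \<otimes> h) \<otimes> a \<otimes> inv h"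
    using c 2(1) ij by (simp add: m_assoc)
  also have "\<dots> = h \<otimes> (e i \<otimes> a) \<otimes> inv h"
    using c 2(1) ij by (simp add: m_assoc diagonal_group_commute[OF h])
  finally have 3: "e i \<otimes> (h \<otimes> a \<otimes> inv h) = h \<otimes> a \<otimes> inv h" using 2 by simp
  have "h \<otimes> a \<otimes> inv h \<otimes> e j = h \<otimes> (a \<otimes> e j) \<otimes> inv h"
    using c 2(1) ij by (simp add: m_assoc 1)
  then show ?thesis using 3 c 2 ij by (simp add: peirce_iff)
qed

lemma St_group: "group (St R n e)"
  by (simp add: St_def presented_group_is_group)

interpretation St: group "St R n e" by (rule St_group)

lemma st_x_closed:
  "(i, j, a) \<in> steinberg_gens R n e \<Longrightarrow> st_x R n e i j a \<in> carrier (St R n e)"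
  by (simp add: St_def st_x_def presented_gen_def)

lemma word_eval_st_x:
  assumes "w \<in> words (steinberg_gens R n e)"
  shows "word_eval (St R n e) (\<lambda>(i, j, a). st_x R n e i j a) w =
    word_rel (steinberg_gens R n e) (steinberg_rels R n e) `` {w}"
  using assms
proof (induction w)
  case Nil
  then show ?case by (simp add: St_def presented_group_def)
next
  case (Cons l w)
  let ?S = "steinberg_gens R n e" and ?Q = "steinberg_rels R n e"
  obtain b i j a where l: "l = (b, i, j, a)" by (metis surj_pair)
  have g: "(i, j, a) \<in> ?S" and w: "w \<in> words ?S" using Cons.prems by (auto simp: l)
  have "inv\<^bsub>St R n e\<^esub> st_x R n e i j a = word_rel ?S ?Q `` {[(False, i, j, a)]}"
  proof (rule St.inv_equality)
    have "word_eq ?S ?Q [(False, i, j, a), (True, i, j, a)] []"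
      using word_eq.cancel[OF g, of ?Q False] by simp
    then have "word_rel ?S ?Q `` {[(False, i, j, a), (True, i, j, a)]} = word_rel ?S ?Q `` {[]}"
      using g by (subst word_class_eq_iff) auto
    then show "word_rel ?S ?Q `` {[(False, i, j, a)]} \<otimes>\<^bsub>St R n e\<^esub> st_x R n e i j a = \<one>\<^bsub>St R n e\<^esub>"
      using g presented_group_mult[of "[(False, i, j, a)]" ?S "[(True, i, j, a)]" ?Q]
      by (simp add: St_def st_x_def presented_gen_def presented_group_def)
  qed (use g st_x_closed[OF g] in \<open>auto simp: St_def\<close>)
  then show ?case
    using g w Cons.IH[OF w] presented_group_mult[of "[(b, i, j, a)]" ?S w ?Q]
    by (cases b) (simp_all add: l St_def st_x_def presented_gen_def)
qed

lemma diagonal_action_respects_rels: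
  assumes h: "h \<in> carrier (diagonal_group R n e)" and uv: "(u, v) \<in> steinberg_rels R n e"
  shows "word_eval (St R n e) (\<lambda>(i, j, a). st_x R n e i j (h \<otimes> a \<otimes> inv h)) u =
    word_eval (St R n e) (\<lambda>(i, j, a). st_x R n e i j (h \<otimes> a \<otimes> inv h)) v"
proof -
  let ?S = "steinberg_gens R n e" and ?Q = "steinberg_rels R n e"
  define c where "c = (\<lambda>(b :: bool, i :: nat, j :: nat, a). (b, i, j, h \<otimes> a \<otimes> inv h))"
  have ev: "word_eval (St R n e) (\<lambda>(i, j, a). st_x R n e i j (h \<otimes> a \<otimes> inv h)) w =
      word_eval (St R n e) (\<lambda>(i, j, a). st_x R n e i j a) (map c w)" for w
    by (induction w) (auto simp: c_def split: prod.splits)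
  have hU: "h \<in> Units R" using h by (auto simp: diagonal_group_def units_of_carrier)
  then have hc: "h \<in> carrier R" "inv h \<in> carrier R" by auto
  have gens: "(i, j, h \<otimes> a \<otimes> inv h) \<in> ?S" if "(i, j, a) \<in> ?S" for i j a
    using that diagonal_conj[OF h] by (auto simp: steinberg_gens_def)
  have comm: "map c (comm_word [(True, i, j, a)] [(True, k, l, b)]) =
      comm_word [(True, i, j, h \<otimes> a \<otimes> inv h)] [(True, k, l, h \<otimes> b \<otimes> inv h)]" for i j k l a b
    by (simp add: comm_word_def inv_word_def c_def)
  have "(map c u, map c v) \<in> ?Q \<and> map c u \<in> words ?S \<and> map c v \<in> words ?S"
    using uv
  proof (cases rule: steinberg_rels_cases)
    case (St1 i j a b)
    have S: "(i, j, a \<oplus> b) \<in> ?S"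
      using steinberg_gensD[OF St1(1)] steinberg_gensD[OF St1(2)] peirce_add
      by (simp add: steinberg_gens_def)
    have eq: "h \<otimes> (a \<oplus> b) \<otimes> inv h = (h \<otimes> a \<otimes> inv h) \<oplus> (h \<otimes> b \<otimes> inv h)"
      using steinberg_gensD[OF St1(1)] steinberg_gensD[OF St1(2)] hc by (simp add: l_distr r_distr)
    have "(map c u, map c v) \<in> ?Q"
      unfolding St1(3,4) steinberg_rels_def Let_def using gens[OF St1(1)] gens[OF St1(2)]
      by (simp add: c_def eq)
    then show ?thesis
      using gens[OF St1(1)] gens[OF St1(2)] gens[OF S] by (simp add: St1(3,4) c_def)
  next
    case (St2 i j k l a b)
    have "(map c u, map c v) \<in> ?Q"
      unfolding St2(5,6) steinberg_rels_def Let_def comm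
      using gens[OF St2(1)] gens[OF St2(2)] St2(3,4) by (simp only: comm list.map) blast
    then show ?thesis
      using gens[OF St2(1)] gens[OF St2(2)] by (simp add: St2(5,6) comm) (simp add: comm_word_def)
  next
    case (St3 i j k a b)
    have S: "(i, k, a \<otimes> b) \<in> ?S"
      using steinberg_gensD[OF St3(1)] steinberg_gensD[OF St3(2)] peirce_mult[of i j k] St3(3)
      by (simp add: steinberg_gens_def)
    have "(h \<otimes> a \<otimes> inv h) \<otimes> (h \<otimes> b \<otimes> inv h) = h \<otimes> a \<otimes> (inv h \<otimes> h) \<otimes> b \<otimes> inv h"
      using steinberg_gensD(5)[OF St3(1)] steinberg_gensD(5)[OF St3(2)] hc
      by (simp add: m_assoc del: Units_l_inv)
    then have eq: "h \<otimes> (a \<otimes> b) \<otimes> inv h = (h \<otimes> a \<otimes> inv h) \<otimes> (h \<otimes> b \<otimes> inv h)"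
      using steinberg_gensD(5)[OF St3(1)] steinberg_gensD(5)[OF St3(2)] hc hU
      by (simp add: m_assoc)
    have cv: "map c v = [(True, i, k, (h \<otimes> a \<otimes> inv h) \<otimes> (h \<otimes> b \<otimes> inv h))]"
      by (simp add: St3(5) c_def eq)
    have "(map c u, map c v) \<in> ?Q"
      unfolding cv St3(4) steinberg_rels_def Let_def comm
      using gens[OF St3(1)] gens[OF St3(2)] St3(3) by blast
    then show ?thesis
      using gens[OF St3(1)] gens[OF St3(2)] gens[OF S]
      by (simp add: St3(4) cv comm eq) (simp add: comm_word_def)
  qed
  then have "word_rel ?S ?Q `` {map c u} = word_rel ?S ?Q `` {map c v}"
    and "map c u \<in> words ?S" "map c v \<in> words ?S"
    by (auto simp: word_class_eq_iff intro: word_eq.relation)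
  then show ?thesis by (simp add: ev word_eval_st_x)
qed

lemma diagonal_action_gens:
  assumes "h \<in> carrier (diagonal_group R n e)"
  shows "(\<lambda>(i, j, a). st_x R n e i j (h \<otimes> a \<otimes> inv h)) \<in> steinberg_gens R n e \<rightarrow> carrier (St R n e)"
  using diagonal_conj[OF assms] by (auto simp: steinberg_gens_def intro!: st_x_closed)

lemma diagonal_action_hom:
  assumes "h \<in> carrier (diagonal_group R n e)"
  shows "diagonal_action R n e h \<in> hom (St R n e) (St R n e)"
proof -
  let ?S = "steinberg_gens R n e" and ?Q = "steinberg_rels R n e"
  have "presented_lift ?S ?Q (St R n e) (\<lambda>(i, j, a). st_x R n e i j (h \<otimes> a \<otimes> inv h))
      \<in> hom (presented_group ?S ?Q) (St R n e)"
    by (rule presented_lift_hom[OF St_group diagonal_action_gens[OF assms]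
          diagonal_action_respects_rels[OF assms]])
  then show ?thesis unfolding diagonal_action_def St_def .
qed

lemma diagonal_action_st_x:
  assumes "h \<in> carrier (diagonal_group R n e)"
    and "i \<in> {1..n}" "j \<in> {1..n}" "i \<noteq> j" "a \<in> peirce R e i j"
  shows "diagonal_action R n e h (st_x R n e i j a) = st_x R n e i j (h \<otimes> a \<otimes> inv h)"
proof -
  have g: "(i, j, a) \<in> steinberg_gens R n e" using assms(2-) by (simp add: steinberg_gens_def)
  have "presented_lift (steinberg_gens R n e) (steinberg_rels R n e) (St R n e)
      (\<lambda>(i, j, a). st_x R n e i j (h \<otimes> a \<otimes> inv h))
      (presented_gen (steinberg_gens R n e) (steinberg_rels R n e) (i, j, a)) =
      (\<lambda>(i, j, a). st_x R n e i j (h \<otimes> a \<otimes> inv h)) (i, j, a)"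
    by (rule presented_lift_gen[OF St_group diagonal_action_gens[OF assms(1)]
          diagonal_action_respects_rels[OF assms(1)] g])
  then show ?thesis unfolding diagonal_action_def st_x_def[of R n e i j a] by simp
qed

end

declare e_closed [simp del]


section \<open>Semidirect products and crossed modules\<close>

definition semidirect_product ::
  "('b, 'm) monoid_scheme \<Rightarrow> ('c, 'k) monoid_scheme \<Rightarrow> ('c \<Rightarrow> 'b \<Rightarrow> 'b) \<Rightarrow> ('b \<times> 'c) monoid" where
  "semidirect_product N H act =
     \<lparr>carrier = carrier N \<times> carrier H,
      monoid.mult = (\<lambda>(g, h) (g', h'). (g \<otimes>\<^bsub>N\<^esub> act h g', h \<otimes>\<^bsub>H\<^esub> h')),
      one = (\<one>\<^bsub>N\<^esub>, \<one>\<^bsub>H\<^esub>)\<rparr>"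

definition semidirect_action ::
  "('b, 'm) monoid_scheme \<Rightarrow> ('c \<Rightarrow> 'b \<Rightarrow> 'b) \<Rightarrow> 'b \<times> 'c \<Rightarrow> 'b \<Rightarrow> 'b" where
  "semidirect_action N act = (\<lambda>(g, h). \<lambda>x\<in>carrier N. g \<otimes>\<^bsub>N\<^esub> act h x \<otimes>\<^bsub>N\<^esub> inv\<^bsub>N\<^esub> g)"

text \<open>An action of \<open>G\<close> on \<open>H\<close> by automorphisms is a homomorphism from \<open>G\<close> to the automorphism group
  of \<open>H\<close>, whose elements are functions in \<open>extensional (carrier H)\<close>.\<close>

locale crossed_module = H: group H + G: group G
  for H :: "('b, 'm) monoid_scheme" and G :: "('c, 'k) monoid_scheme"
    and d :: "'b \<Rightarrow> 'c" and act :: "'c \<Rightarrow> 'b \<Rightarrow> 'b" +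
  assumes d_hom: "d \<in> hom H G"
    and act_hom: "act \<in> hom G (AutoGroup H)"
    and equivariant: "\<lbrakk>g \<in> carrier G; x \<in> carrier H\<rbrakk> \<Longrightarrow> d (act g x) = g \<otimes>\<^bsub>G\<^esub> d x \<otimes>\<^bsub>G\<^esub> inv\<^bsub>G\<^esub> g"
    and peiffer: "\<lbrakk>x \<in> carrier H; y \<in> carrier H\<rbrakk> \<Longrightarrow> act (d x) y = x \<otimes>\<^bsub>H\<^esub> y \<otimes>\<^bsub>H\<^esub> inv\<^bsub>H\<^esub> x"

end

(* A semi-local ring has stable range one, hence so has every corner e_i R e_i, and Gauss elimination
   gives GL(R) = E(R) D(R). The homomorphisms of St(R) and D(R) to Aut(St(R)) x GL(R) generate a
   subgroup, which is the graph of the required action once its projection to GL(R) is injective.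

   Let an element w of rank one (generated by D(R) and the root subgroups of (i, j) and (j, i)) have
   trivial image in GL(R). For k different from i and j, it normalizes the subgroup generated by the
   root subgroups of (i, k) and (j, k), and the one for (k, i) and (k, j). Both embed in GL(R), so
   that w centralizes them. As w also commutes with the remaining root subgroups, it is trivial by
   perfectness of St(R). Hence the matrix identities expressing X_ki X_ik X_ki by X_ik X_ki X_ik D(R),
   which stable range one provides, lift to the subgroup. With N+ and N- the groups generated by the
   positive and by the negative root subgroups, they show that the subgroup is N+ N- N+ D(R), and on
   such products the projection to GL(R) has trivial kernel since N+ and N- embed in GL(R).

   For uniqueness, two actions differ at each m in GL(R) by a map from St(R) to the kernel of st. The
   kernel is central in a crossed module, so both actions agree on commutators. *)

theory Submission
  imports Defs
begin

section \<open>Stable range one\<close>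

text \<open>The obstacle is that a general element of GL(R) acts by no formula on generators:
  conjugation by it takes root elements out of the set of root elements, and a factorization into
  root and diagonal elements is far from unique. Inside Aut(St(R)) x GL(R), well-definedness becomes
  a statement about a kernel. The first factor also explains why identities lift: in St(R) an
  identity of GL(R) lifts only up to the kernel of \<open>st\<close>, and central elements of St(R)
  become invisible as inner automorphisms. It is replaced by a criterion on pairs: (\<phi>, 1)
  commutes with the image of an element x exactly when \<phi>(x) x^-1 is central. Morita equivalence
  enters as additive generation of R_ij by the products R_ik R_kj, which makes root elements
  products of commutators through a third index. So the assumption on \<open>n\<close> provides both
  perfectness and the index outside a rank-one pair.\<close>

definition corner :: "('a, 'm) ring_scheme \<Rightarrow> 'a \<Rightarrow> ('a, 'm) ring_scheme" where
  "corner R e = R\<lparr>carrier := {a \<in> carrier R. e \<otimes>\<^bsub>R\<^esub> a = a \<and> a \<otimes>\<^bsub>R\<^esub> e = a}, one := e\<rparr>"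

text \<open>The second entry stands for a multiple that has already been formed: from
  \<open>a x + b y = 1\<close> one passes to the pair \<open>(a, b y)\<close>, so this contains
  Bass's condition on unimodular rows of length two.\<close>

definition stable_range_one :: "('a, 'm) ring_scheme \<Rightarrow> bool" where
  "stable_range_one R \<longleftrightarrow>
     (\<forall>a\<in>carrier R. \<forall>x\<in>carrier R. \<forall>b\<in>carrier R. a \<otimes>\<^bsub>R\<^esub> x \<oplus>\<^bsub>R\<^esub> b = \<one>\<^bsub>R\<^esub> \<longrightarrow>
       (\<exists>t\<in>carrier R. a \<oplus>\<^bsub>R\<^esub> b \<otimes>\<^bsub>R\<^esub> t \<in> Units R))"

lemma stable_range_oneD:
  assumes "stable_range_one R" "a \<in> carrier R" "x \<in> carrier R" "b \<in> carrier R"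
    "a \<otimes>\<^bsub>R\<^esub> x \<oplus>\<^bsub>R\<^esub> b = \<one>\<^bsub>R\<^esub>"
  obtains t where "t \<in> carrier R" "a \<oplus>\<^bsub>R\<^esub> b \<otimes>\<^bsub>R\<^esub> t \<in> Units R"
  using assms unfolding stable_range_one_def by blast

lemma corner_simps [simp]:
  "carrier (corner R e) = {a \<in> carrier R. e \<otimes>\<^bsub>R\<^esub> a = a \<and> a \<otimes>\<^bsub>R\<^esub> e = a}"
  "monoid.mult (corner R e) = monoid.mult R" "ring.add (corner R e) = ring.add R"
  "one (corner R e) = e" "ring.zero (corner R e) = ring.zero R"
  by (simp_all add: corner_def)

lemma Units_corner:
  "u \<in> Units (corner R e) \<longleftrightarrow> u \<in> carrier (corner R e) \<and>
     (\<exists>v\<in>carrier (corner R e). v \<otimes>\<^bsub>R\<^esub> u = e \<and> u \<otimes>\<^bsub>R\<^esub> v = e)"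
  by (simp add: Units_def)

context ring
begin

lemma corner_ring:
  assumes e: "e \<in> carrier R" "e \<otimes> e = e"
  shows "ring (corner R e)"
proof (rule ringI)
  show "abelian_group (corner R e)"
  proof (rule abelian_groupI)
    fix x assume x: "x \<in> carrier (corner R e)"
    show "\<exists>y\<in>carrier (corner R e). y \<oplus>\<^bsub>corner R e\<^esub> x = \<zero>\<^bsub>corner R e\<^esub>"
      by (rule bexI[of _ "\<ominus> x"]) (use x e in \<open>auto simp: l_neg l_minus r_minus\<close>)
  qed (use e in \<open>auto simp: a_ac l_distr r_distr\<close>)
  show "Group.monoid (corner R e)"
    by (rule monoidI) (use e in \<open>auto simp: m_assoc, simp add: m_assoc[symmetric]\<close>)
qed (use e in \<open>auto simp: l_distr r_distr\<close>)

lemma corner_one: "carrier (corner R \<one>) = carrier R"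
  by auto

lemma stable_range_one_corner_one: "stable_range_one (corner R \<one>) \<longleftrightarrow> stable_range_one R"
proof -
  have "Units (corner R \<one>) = Units R" by (auto simp: Units_def)
  then show ?thesis unfolding stable_range_one_def corner_one by simp
qed

lemma Units_left_right:
  assumes "x \<in> carrier R" "y \<in> carrier R" "z \<in> carrier R" "y \<otimes> x = \<one>" "x \<otimes> z = \<one>"
  shows "x \<in> Units R"
proof -
  have "y = z" using assms inv_unique by blast
  then show ?thesis using assms by (auto simp: Units_def)
qed

lemma square_zero_inverse:
  assumes "v \<in> carrier R" "v \<otimes> v = \<zero>"
  shows "(\<one> \<oplus> v) \<otimes> (\<one> \<ominus> v) = \<one>" "(\<one> \<ominus> v) \<otimes> (\<one> \<oplus> v) = \<one>"
  using assms by (simp_all add: minus_eq l_distr r_distr l_minus r_minus a_assoc l_neg r_neg)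

lemma square_zero_units:
  assumes "v \<in> carrier R" "v \<otimes> v = \<zero>"
  shows "\<one> \<oplus> v \<in> Units R" "\<one> \<ominus> v \<in> Units R"
  using assms square_zero_inverse[OF assms] by (auto simp: Units_def)

lemma add_neg_swap:
  assumes "x \<in> carrier R" "y \<in> carrier R"
  shows "x \<oplus> (y \<oplus> \<ominus> x) = y" "\<ominus> x \<oplus> (y \<oplus> x) = y" "x \<oplus> (\<ominus> x \<oplus> y) = y" "\<ominus> x \<oplus> (x \<oplus> y) = y"
  using assms by (simp_all add: a_lcomm[of x y] a_lcomm[of "\<ominus> x" y] r_neg l_neg r_neg1 r_neg2)

text \<open>Two different units are allowed because the lemma serves twice: with
  \<open>g = h\<close> for units commuting with an idempotent, and for the two values of
  \<open>st\<close> that a diagonal element intertwines.\<close>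

lemma intertwine_inv:
  assumes "g \<in> Units R" "h \<in> Units R" "e \<in> carrier R" "g \<otimes> e = e \<otimes> h"
  shows "inv g \<otimes> e = e \<otimes> inv h"
proof -
  have c: "g \<in> carrier R" "inv g \<in> carrier R" "h \<in> carrier R" "inv h \<in> carrier R" using assms by auto
  have "e \<otimes> inv h = (inv g \<otimes> g) \<otimes> e \<otimes> inv h" using assms(1,3) c by simp
  also have "\<dots> = inv g \<otimes> (g \<otimes> e) \<otimes> inv h" using assms(3) c by (simp add: m_assoc del: Units_l_inv)
  also have "\<dots> = inv g \<otimes> e \<otimes> (h \<otimes> inv h)" unfolding assms(4) using assms(3) c by (simp add: m_assoc del: Units_r_inv)
  finally show ?thesis using assms(2,3) c by simp
qed

lemma commute_inv:
  assumes "g \<in> Units R" "e \<in> carrier R" "e \<otimes> g = g \<otimes> e"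
  shows "e \<otimes> inv g = inv g \<otimes> e"
  using intertwine_inv[of g g e] assms by simp

lemma inv_mult_Units:
  assumes "g \<in> Units R" "h \<in> Units R"
  shows "inv (g \<otimes> h) = inv h \<otimes> inv g"
proof (rule inv_unique[of _ "g \<otimes> h"])
  have "(g \<otimes> h) \<otimes> (inv h \<otimes> inv g) = g \<otimes> (h \<otimes> inv h) \<otimes> inv g"
    using assms by (simp add: m_assoc Units_closed del: Units_r_inv)
  then show "(g \<otimes> h) \<otimes> (inv h \<otimes> inv g) = \<one>" using assms by (simp add: Units_closed)
qed (use assms Units_l_inv[OF Units_m_closed[OF assms]] in auto)

end

section \<open>Block matrices with respect to two complementary idempotents\<close>

locale complementary_idempotents = ring R for R (structure) +
  fixes e f
  assumes e [simp]: "e \<in> carrier R" and f [simp]: "f \<in> carrier R"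
    and ee [simp]: "e \<otimes> e = e" and ff [simp]: "f \<otimes> f = f"
    and ef [simp]: "e \<otimes> f = \<zero>" and fe [simp]: "f \<otimes> e = \<zero>" and sum [simp]: "e \<oplus> f = \<one>"
begin

lemma absorb [simp]:
  assumes "x \<in> carrier R"
  shows "e \<otimes> (e \<otimes> x) = e \<otimes> x" "f \<otimes> (f \<otimes> x) = f \<otimes> x"
    "e \<otimes> (f \<otimes> x) = \<zero>" "f \<otimes> (e \<otimes> x) = \<zero>"
  using assms by (simp_all add: m_assoc[symmetric])

lemma f_eq: "f = \<one> \<ominus> e"
  using sum e f by (metis a_comm add.inv_solve_right' minus_eq one_closed)

lemma decompose_left: "x \<in> carrier R \<Longrightarrow> e \<otimes> x \<oplus> f \<otimes> x = x"
  by (simp add: l_distr[symmetric])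

lemma decompose_right: "x \<in> carrier R \<Longrightarrow> x \<otimes> e \<oplus> x \<otimes> f = x"
  by (simp add: r_distr[symmetric])

lemma commute_if:
  assumes x: "x \<in> carrier R" and "e \<otimes> x \<otimes> f = \<zero>" "f \<otimes> x \<otimes> e = \<zero>"
  shows "e \<otimes> x = x \<otimes> e"
proof -
  have "e \<otimes> x = e \<otimes> x \<otimes> e" using decompose_right[of "e \<otimes> x"] assms by simp
  moreover have "x \<otimes> e = e \<otimes> x \<otimes> e" using decompose_left[of "x \<otimes> e"] assms by (simp add: m_assoc[symmetric])
  ultimately show ?thesis by simp
qed

lemma commute_f:
  assumes "x \<in> carrier R" "e \<otimes> x = x \<otimes> e"
  shows "f \<otimes> x = x \<otimes> f"
  using assms by (simp add: f_eq minus_eq l_distr r_distr l_minus r_minus)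

text \<open>On elements commuting with \<open>e\<close>, compression to the corner is
  multiplicative, so the block of \<open>inv g\<close> inverts the block of
  \<open>g\<close>.\<close>

lemma Units_corner_compress:
  assumes g: "g \<in> Units R" and eg: "e \<otimes> g = g \<otimes> e"
  shows "e \<otimes> g \<otimes> e \<in> Units (corner R e)"
proof -
  have c: "g \<in> carrier R" "inv g \<in> carrier R" using g by auto
  have ei: "e \<otimes> inv g = inv g \<otimes> e" using commute_inv[OF g e eg] .
  have "e \<otimes> inv g \<otimes> e \<otimes> (e \<otimes> g \<otimes> e) = e \<otimes> inv g \<otimes> (e \<otimes> g) \<otimes> e" using c by (simp add: m_assoc)
  also have "\<dots> = e \<otimes> (inv g \<otimes> g) \<otimes> e" unfolding eg using c by (simp add: m_assoc eg[symmetric])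
  finally have 1: "e \<otimes> inv g \<otimes> e \<otimes> (e \<otimes> g \<otimes> e) = e" using g by simp
  have "e \<otimes> g \<otimes> e \<otimes> (e \<otimes> inv g \<otimes> e) = e \<otimes> g \<otimes> (e \<otimes> inv g) \<otimes> e" using c by (simp add: m_assoc)
  also have "\<dots> = e \<otimes> (g \<otimes> inv g) \<otimes> e" unfolding ei using c by (simp add: m_assoc ei[symmetric])
  finally have 2: "e \<otimes> g \<otimes> e \<otimes> (e \<otimes> inv g \<otimes> e) = e" using g by simp
  show ?thesis unfolding Units_corner
    using c 1 2 by (intro conjI bexI[of _ "e \<otimes> inv g \<otimes> e"]) (simp_all add: m_assoc)
qed

text \<open>The two equations place \<open>x\<close> in \<open>eRf\<close>; inserting
  \<open>e \<oplus> f\<close> between the factors leaves only terms containing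
  \<open>x \<otimes> e\<close> or \<open>f \<otimes> x\<close>.\<close>

lemma off_diagonal_square:
  assumes "x \<in> carrier R" "f \<otimes> x = \<zero>" "x \<otimes> e = \<zero>"
  shows "x \<otimes> x = \<zero>"
proof -
  have "x \<otimes> x = x \<otimes> (e \<oplus> f) \<otimes> x" using assms(1) by simp
  also have "\<dots> = (x \<otimes> e) \<otimes> x \<oplus> x \<otimes> (f \<otimes> x)" using assms(1) e f
    by (simp only: r_distr l_distr m_assoc m_closed)
  finally show ?thesis using assms by simp
qed

text \<open>Multiplication by the sum of the block inverses turns \<open>x\<close> into
  \<open>\<one> \<oplus> n\<close> from the left and into \<open>\<one> \<oplus> k\<close> from the
  right, where \<open>n\<close> and \<open>k\<close> are off-diagonal and square to zero. The two
  one-sided inverses obtained in this way combine to a two-sided one.\<close>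

lemma triangular_unit:
  assumes x: "x \<in> carrier R" and u: "e \<otimes> x \<otimes> e \<in> Units (corner R e)"
    and v: "f \<otimes> x \<otimes> f \<in> Units (corner R f)" and z: "f \<otimes> x \<otimes> e = \<zero>"
  shows "x \<in> Units R"
proof -
  obtain u' where u': "u' \<in> carrier R" "e \<otimes> u' = u'" "u' \<otimes> e = u'"
      "u' \<otimes> (e \<otimes> x \<otimes> e) = e" "e \<otimes> x \<otimes> e \<otimes> u' = e"
    using u by (auto simp: Units_corner)
  obtain v' where v': "v' \<in> carrier R" "f \<otimes> v' = v'" "v' \<otimes> f = v'"
      "v' \<otimes> (f \<otimes> x \<otimes> f) = f" "f \<otimes> x \<otimes> f \<otimes> v' = f"
    using v by (auto simp: Units_corner)
  have ux: "u' \<otimes> (x \<otimes> e) = e" using u' x by (metis e m_assoc m_closed)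
  have xu: "e \<otimes> x \<otimes> u' = e" using u' x by (metis e m_assoc m_closed)
  have vx: "v' \<otimes> (x \<otimes> f) = f" using v' x by (metis f m_assoc m_closed)
  have xv: "f \<otimes> x \<otimes> v' = f" using v' x by (metis f m_assoc m_closed)
  have vz: "v' \<otimes> (x \<otimes> e) = \<zero>" using v' x z by (metis e f m_assoc m_closed r_null)
  have zu: "f \<otimes> x \<otimes> u' = \<zero>" using u' x z by (metis e f m_assoc m_closed l_null)
  have x_right: "x \<otimes> e \<oplus> x \<otimes> f = x" using decompose_right[OF x] .
  define n where "n = u' \<otimes> x \<otimes> f"
  have n: "n \<in> carrier R" "n \<otimes> e = \<zero>" "n \<otimes> f = n" "e \<otimes> n = n" "f \<otimes> n = \<zero>"
    using u' x by (simp_all add: n_def m_assoc) (metis absorb(4) e f m_assoc m_closed r_null u' x)+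
  have l: "(u' \<oplus> v') \<otimes> x = \<one> \<oplus> n"
  proof -
    have "(u' \<oplus> v') \<otimes> x = (u' \<oplus> v') \<otimes> (x \<otimes> e \<oplus> x \<otimes> f)" using x_right by simp
    also have "\<dots> = (u' \<otimes> (x \<otimes> e) \<oplus> v' \<otimes> (x \<otimes> e)) \<oplus> (u' \<otimes> (x \<otimes> f) \<oplus> v' \<otimes> (x \<otimes> f))"
      using u'(1) v'(1) x by (simp only: l_distr r_distr e f m_closed a_closed)
    also have "\<dots> = (e \<oplus> f) \<oplus> n" using u'(1) v'(1) x n(1)
      by (simp only: ux vx vz) (simp add: n_def m_assoc a_ac del: sum)
    finally show ?thesis by simp
  qed
  have "n \<otimes> n = \<zero>" using off_diagonal_square n by blast
  then have "(\<one> \<ominus> n) \<otimes> ((u' \<oplus> v') \<otimes> x) = \<one>" unfolding l using square_zero_inverse n by simp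
  then have L: "((\<one> \<ominus> n) \<otimes> (u' \<oplus> v')) \<otimes> x = \<one>" using n(1) u'(1) v'(1) x by (simp add: m_assoc)
  define k where "k = e \<otimes> x \<otimes> v'"
  have k: "k \<in> carrier R" "k \<otimes> e = \<zero>" "f \<otimes> k = \<zero>"
    using v' x by (simp_all add: k_def m_assoc) (metis absorb(3) e f m_assoc m_closed r_null v' x fe)+
  have r: "x \<otimes> (u' \<oplus> v') = \<one> \<oplus> k"
  proof -
    have "x \<otimes> (u' \<oplus> v') = (e \<otimes> x \<oplus> f \<otimes> x) \<otimes> (u' \<oplus> v')" using decompose_left[OF x] by simp
    also have "\<dots> = (e \<otimes> x \<otimes> u' \<oplus> e \<otimes> x \<otimes> v') \<oplus> (f \<otimes> x \<otimes> u' \<oplus> f \<otimes> x \<otimes> v')"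
      using u'(1) v'(1) x by (simp add: l_distr r_distr a_ac)
    also have "\<dots> = (e \<oplus> f) \<oplus> k" using u'(1) v'(1) x k(1)
      by (simp only: xu xv zu) (simp add: k_def a_ac del: sum)
    finally show ?thesis by simp
  qed
  have "k \<otimes> k = \<zero>" using off_diagonal_square k by blast
  then have "(x \<otimes> (u' \<oplus> v')) \<otimes> (\<one> \<ominus> k) = \<one>" unfolding r using square_zero_inverse k by simp
  then have "x \<otimes> ((u' \<oplus> v') \<otimes> (\<one> \<ominus> k)) = \<one>" using k(1) u'(1) v'(1) x by (simp add: m_assoc)
  with L show ?thesis
    by (rule Units_left_right[rotated 3]) (use x n(1) k(1) u'(1) v'(1) in simp_all)
qed

text \<open>The factors \<open>\<one> \<ominus> p\<close> and \<open>\<one> \<ominus> q\<close> clear the column and the row of the invertible block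
  \<open>e \<otimes> a \<otimes> e\<close>.\<close>

lemma clear:
  assumes a: "a \<in> carrier R"
    and u: "u' \<in> carrier R" "e \<otimes> u' = u'" "u' \<otimes> e = u'"
      "u' \<otimes> (e \<otimes> a \<otimes> e) = e" "e \<otimes> a \<otimes> e \<otimes> u' = e"
    and p: "p = f \<otimes> a \<otimes> u'" and q: "q = u' \<otimes> a \<otimes> f"
  shows "e \<otimes> ((\<one> \<ominus> p) \<otimes> a \<otimes> (\<one> \<ominus> q)) = (\<one> \<ominus> p) \<otimes> a \<otimes> (\<one> \<ominus> q) \<otimes> e" (is ?A)
    and "e \<otimes> ((\<one> \<ominus> p) \<otimes> a \<otimes> (\<one> \<ominus> q)) \<otimes> e = e \<otimes> a \<otimes> e" (is ?B)
proof -
  have c: "p \<in> carrier R" "q \<in> carrier R" using a u by (simp_all add: p q)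
  have ua: "u' \<otimes> (a \<otimes> e) = e" using u a by (metis e m_assoc m_closed)
  have au: "e \<otimes> (a \<otimes> u') = e" using u a by (metis e m_assoc m_closed)
  have ep: "e \<otimes> p = \<zero>" using a u by (simp add: p m_assoc)
  have qe: "q \<otimes> e = \<zero>" using a u by (simp add: q m_assoc)
  have 1: "e \<otimes> (\<one> \<ominus> p) = e" "(\<one> \<ominus> q) \<otimes> e = e"
    using c ep qe by (simp_all add: minus_eq l_distr r_distr l_minus r_minus)
  have 2: "(\<one> \<ominus> q) \<otimes> f = f \<ominus> q" "f \<otimes> (\<one> \<ominus> p) = f \<ominus> p"
    using c a u by (simp_all add: minus_eq l_distr r_distr l_minus r_minus p q m_assoc)
  let ?x = "(\<one> \<ominus> p) \<otimes> a \<otimes> (\<one> \<ominus> q)"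
  have L: "e \<otimes> ?x = e \<otimes> a \<otimes> (\<one> \<ominus> q)" using c a 1 by (simp add: m_assoc[symmetric])
  have Rr: "?x \<otimes> e = (\<one> \<ominus> p) \<otimes> a \<otimes> e" using c a 1 by (simp add: m_assoc)
  show ?B using L c a 1 by (simp add: m_assoc)
  have "e \<otimes> ?x \<otimes> f = e \<otimes> a \<otimes> (f \<ominus> q)" using L c a 2 by (simp add: m_assoc)
  also have "\<dots> = e \<otimes> a \<otimes> f \<ominus> e \<otimes> (a \<otimes> u') \<otimes> (a \<otimes> f)"
    using a u(1) by (simp add: q minus_eq r_distr r_minus m_assoc)
  also have "\<dots> = \<zero>" unfolding au using a by (simp add: m_assoc minus_eq r_neg)
  finally have 3: "e \<otimes> ?x \<otimes> f = \<zero>" .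
  have "f \<otimes> ?x \<otimes> e = (f \<ominus> p) \<otimes> a \<otimes> e" using c a 1 2 by (simp add: m_assoc) (simp add: m_assoc[symmetric])
  also have "\<dots> = f \<otimes> a \<otimes> e \<ominus> f \<otimes> a \<otimes> (u' \<otimes> (a \<otimes> e))"
    using a u(1) by (simp add: p minus_eq l_distr l_minus m_assoc)
  also have "\<dots> = \<zero>" unfolding ua using a by (simp add: m_assoc minus_eq r_neg)
  finally have 4: "f \<otimes> ?x \<otimes> e = \<zero>" .
  show ?A using commute_if[OF _ 3 4] c a by simp
qed

text \<open>Compressing \<open>a x + b = 1\<close> to \<open>eRe\<close> leaves the stray term
  \<open>(eaf)(fxe)\<close>, which is counted as part of the second entry. The element
  \<open>s\<close> from stable range one then multiplies \<open>fx\<close> as well as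
  \<open>b\<close>, so the unit of \<open>eRe\<close> is the corner block of
  \<open>a (1 + fxs) + bs\<close>: a column operation on \<open>a\<close> plus a multiple of
  \<open>b\<close>.\<close>

lemma pivot:
  assumes sr: "stable_range_one (corner R e)"
    and c: "a \<in> carrier R" "x \<in> carrier R" "b \<in> carrier R" and eq: "a \<otimes> x \<oplus> b = \<one>"
  obtains s u' where "s \<in> carrier (corner R e)" "u' \<in> carrier (corner R e)"
    "u' \<otimes> (e \<otimes> (a \<otimes> (\<one> \<oplus> f \<otimes> x \<otimes> s) \<oplus> b \<otimes> s) \<otimes> e) = e"
    "e \<otimes> (a \<otimes> (\<one> \<oplus> f \<otimes> x \<otimes> s) \<oplus> b \<otimes> s) \<otimes> e \<otimes> u' = e"
proof -
  let ?b = "e \<otimes> a \<otimes> f \<otimes> x \<otimes> e \<oplus> e \<otimes> b \<otimes> e"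
  have "(e \<otimes> a \<otimes> e) \<otimes> (e \<otimes> x \<otimes> e) \<oplus> ?b = e \<otimes> (a \<otimes> (e \<otimes> x \<oplus> f \<otimes> x) \<oplus> b) \<otimes> e"
    using c by (simp add: l_distr r_distr m_assoc a_ac)
  also have "\<dots> = e" using c eq decompose_left by simp
  finally obtain s where s: "s \<in> carrier (corner R e)"
      "e \<otimes> a \<otimes> e \<oplus> ?b \<otimes> s \<in> Units (corner R e)"
    using c stable_range_oneD[OF sr, of "e \<otimes> a \<otimes> e" "e \<otimes> x \<otimes> e" ?b]
    by (auto simp: m_assoc l_distr r_distr)
  have s': "s \<in> carrier R" "e \<otimes> s = s" "s \<otimes> e = s" using s by auto
  have "e \<otimes> (a \<otimes> (\<one> \<oplus> f \<otimes> x \<otimes> s) \<oplus> b \<otimes> s) \<otimes> e = e \<otimes> a \<otimes> e \<oplus> ?b \<otimes> s"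
    using c s' by (simp add: l_distr r_distr m_assoc a_ac)
  then show ?thesis using s that by (auto simp: Units_corner)
qed

end

context ring
begin

lemma complementary:
  assumes "e \<in> carrier R" "e \<otimes> e = e"
  shows "complementary_idempotents R e (\<one> \<ominus> e)"
  by unfold_locales
    (use assms in \<open>simp_all add: minus_eq l_distr r_distr l_minus r_minus r_neg l_neg a_ac add_neg_swap\<close>)

text \<open>Comparing the two block rows of \<open>a \<oplus> b \<otimes> t\<close> in the Peirce decomposition with respect to \<open>e\<close>
  and \<open>f\<close>, where the second one is \<open>(0, f)\<close>.\<close>

lemma stable_range_one_corner:
  assumes sr: "stable_range_one R" and e: "e \<in> carrier R" "e \<otimes> e = e"
  shows "stable_range_one (corner R e)"
  unfolding stable_range_one_def
proof (intro ballI impI)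
  fix a x b
  assume a: "a \<in> carrier (corner R e)" and x: "x \<in> carrier (corner R e)"
    and b: "b \<in> carrier (corner R e)"
    and eq: "a \<otimes>\<^bsub>corner R e\<^esub> x \<oplus>\<^bsub>corner R e\<^esub> b = \<one>\<^bsub>corner R e\<^esub>"
  define f where "f = \<one> \<ominus> e"
  interpret complementary_idempotents R e f unfolding f_def by (rule complementary[OF assms(2,3)])
  have c: "a \<in> carrier R" "x \<in> carrier R" "b \<in> carrier R" "e \<otimes> a = a" "a \<otimes> e = a"
    "e \<otimes> x = x" "x \<otimes> e = x" "e \<otimes> b = b" "b \<otimes> e = b" and eq': "a \<otimes> x \<oplus> b = e"
    using a x b eq by auto
  have z: "a \<otimes> f = \<zero>" "f \<otimes> x = \<zero>" "f \<otimes> a = \<zero>" "f \<otimes> b = \<zero>" "b \<otimes> f = \<zero>"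
    by (metis c e f ef fe m_assoc l_null r_null)+
  \<comment> \<open>Padding \<open>a\<close> and \<open>x\<close> by \<open>f\<close> extends the
    equation from the corner to the whole ring, while \<open>b\<close> stays in the corner.\<close>
  have "(a \<oplus> f) \<otimes> (x \<oplus> f) \<oplus> b = (a \<otimes> x \<oplus> b) \<oplus> f"
    using c f z by (simp add: l_distr r_distr a_ac)
  then have "(a \<oplus> f) \<otimes> (x \<oplus> f) \<oplus> b = \<one>"
    using eq' f by simp
  then obtain t where t: "t \<in> carrier R" "(a \<oplus> f) \<oplus> b \<otimes> t \<in> Units R"
    using c f by (elim stable_range_oneD[OF sr, rotated 3]) auto
  define u where "u = (a \<oplus> f) \<oplus> b \<otimes> t"
  define w where "w = a \<oplus> b \<otimes> (e \<otimes> t \<otimes> e)"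
  define v where "v = b \<otimes> t \<otimes> f"
  have v: "v \<in> carrier R" "v \<otimes> f = v" "f \<otimes> v = \<zero>" "v \<otimes> e = \<zero>"
    using c t z by (simp_all add: v_def m_assoc) (simp add: m_assoc[symmetric] c z)
  have vv: "v \<otimes> v = \<zero>" using off_diagonal_square v by simp
  have w: "w \<in> carrier R" "e \<otimes> w = w" "w \<otimes> e = w"
    using c t e z by (simp_all add: w_def m_assoc l_distr r_distr) (simp add: m_assoc[symmetric] c z)
  have vw: "v \<otimes> w = \<zero>" using v w by (metis e m_assoc l_null)
  have "u = (w \<oplus> f) \<oplus> v"
  proof -
    have "b \<otimes> t = b \<otimes> t \<otimes> (e \<oplus> f)" using c t by simp
    also have "\<dots> = b \<otimes> (e \<otimes> t \<otimes> e) \<oplus> v"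
      using c t by (simp add: v_def r_distr m_assoc[symmetric] del: sum)
    finally show ?thesis using c t e f v by (simp add: u_def w_def a_ac)
  qed
  \<comment> \<open>The factor \<open>\<one> \<ominus> v\<close> removes the off-diagonal block of
    \<open>u\<close>; what remains is block diagonal, with \<open>w\<close> in the corner.\<close>
  then have "(\<one> \<ominus> v) \<otimes> u = w \<oplus> f"
    using v w vv vw by (simp add: minus_eq l_distr r_distr l_minus r_minus a_ac r_neg add_neg_swap)
  moreover have "\<one> \<ominus> v \<in> Units R" "u \<in> Units R" using square_zero_units v vv t u_def by auto
  ultimately have wf: "w \<oplus> f \<in> Units R" by (metis Units_m_closed)
  have fw: "f \<otimes> w = \<zero>" "w \<otimes> f = \<zero>" by (metis w e f ef fe m_assoc l_null r_null)+
  have "e \<otimes> (w \<oplus> f) \<otimes> e \<in> Units (corner R e)"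
    by (rule Units_corner_compress[OF wf]) (use w in \<open>simp add: l_distr r_distr\<close>)
  then have "w \<in> Units (corner R e)" using w by (simp add: l_distr r_distr)
  then show "\<exists>t\<in>carrier (corner R e). a \<oplus>\<^bsub>corner R e\<^esub> b \<otimes>\<^bsub>corner R e\<^esub> t \<in> Units (corner R e)"
    using t c by (intro bexI[of _ "e \<otimes> t \<otimes> e"]) (auto simp: w_def m_assoc)
qed

text \<open>Pairs \<open>(a, b)\<close> may be replaced by \<open>(p (a q + b s), p b)\<close> with units \<open>p\<close> and \<open>q\<close>.\<close>

lemma stable_range_one_if_reduced:
  assumes "\<And>a x b. \<lbrakk>a \<in> carrier R; x \<in> carrier R; b \<in> carrier R; a \<otimes> x \<oplus> b = \<one>\<rbrakk> \<Longrightarrow>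
    \<exists>p\<in>Units R. \<exists>q\<in>Units R. \<exists>s\<in>carrier R. \<forall>x\<in>carrier R. \<forall>y\<in>carrier R.
      p \<otimes> (a \<otimes> q \<oplus> b \<otimes> s) \<otimes> x \<oplus> p \<otimes> b \<otimes> y = \<one> \<longrightarrow>
      (\<exists>t\<in>carrier R. p \<otimes> (a \<otimes> q \<oplus> b \<otimes> s) \<oplus> p \<otimes> b \<otimes> t \<in> Units R)"
  shows "stable_range_one R"
  unfolding stable_range_one_def
proof (intro ballI impI)
  fix a x b assume c: "a \<in> carrier R" "x \<in> carrier R" "b \<in> carrier R" and eq: "a \<otimes> x \<oplus> b = \<one>"
  from assms[OF c eq] obtain p q s where p: "p \<in> Units R" and q: "q \<in> Units R" and s: "s \<in> carrier R"
    and red: "\<And>x y. \<lbrakk>x \<in> carrier R; y \<in> carrier R; p \<otimes> (a \<otimes> q \<oplus> b \<otimes> s) \<otimes> x \<oplus> p \<otimes> b \<otimes> y = \<one>\<rbrakk> \<Longrightarrow>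
      \<exists>t\<in>carrier R. p \<otimes> (a \<otimes> q \<oplus> b \<otimes> s) \<oplus> p \<otimes> b \<otimes> t \<in> Units R" by blast
  have pq: "p \<in> carrier R" "inv p \<in> carrier R" "q \<in> carrier R" "inv q \<in> carrier R" using p q by auto
  \<comment> \<open>A solution for the transformed pair: \<open>?x\<close> undoes \<open>q\<close>
    and \<open>p\<close>, and \<open>?y\<close> in addition cancels what
    \<open>b \<otimes> s\<close> contributes to the first term.\<close>
  let ?x = "inv q \<otimes> x \<otimes> inv p" and ?y = "(\<one> \<ominus> s \<otimes> inv q \<otimes> x) \<otimes> inv p"
  have "q \<otimes> ?x = x \<otimes> inv p" using q c pq by (simp add: m_assoc[symmetric])
  then have "a \<otimes> (q \<otimes> ?x) = a \<otimes> (x \<otimes> inv p)" by simp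
  then have 1: "a \<otimes> q \<otimes> ?x = a \<otimes> x \<otimes> inv p" using c pq by (simp add: m_assoc)
  have 2: "b \<otimes> s \<otimes> ?x \<oplus> b \<otimes> ?y = b \<otimes> inv p" using c s pq
    by (simp add: minus_eq l_distr r_distr l_minus r_minus m_assoc add_neg_swap r_neg a_ac)
  have "p \<otimes> (a \<otimes> q \<oplus> b \<otimes> s) \<otimes> ?x \<oplus> p \<otimes> b \<otimes> ?y = p \<otimes> (a \<otimes> q \<otimes> ?x \<oplus> (b \<otimes> s \<otimes> ?x \<oplus> b \<otimes> ?y))"
    using c s pq by (simp add: l_distr r_distr m_assoc a_ac)
  also have "\<dots> = p \<otimes> ((a \<otimes> x \<oplus> b) \<otimes> inv p)" unfolding 1 2 using c pq by (simp add: l_distr)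
  also have "\<dots> = \<one>" using p pq by (simp add: eq)
  finally obtain t where t: "t \<in> carrier R" "p \<otimes> (a \<otimes> q \<oplus> b \<otimes> s) \<oplus> p \<otimes> b \<otimes> t \<in> Units R"
    using red[of ?x ?y] c s pq by auto
  \<comment> \<open>Undoing \<open>p\<close> and \<open>q\<close> turns the unit found for the
    transformed pair into \<open>a + b t'\<close> with \<open>t' = (s + t) inv q\<close>.\<close>
  then have "inv p \<otimes> (p \<otimes> (a \<otimes> q \<oplus> b \<otimes> s) \<oplus> p \<otimes> b \<otimes> t) \<otimes> inv q \<in> Units R"
    using p q by auto
  also have "inv p \<otimes> (p \<otimes> (a \<otimes> q \<oplus> b \<otimes> s) \<oplus> p \<otimes> b \<otimes> t) = inv p \<otimes> (p \<otimes> (a \<otimes> q \<oplus> b \<otimes> (s \<oplus> t)))"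
    using c s t pq by (simp add: l_distr r_distr m_assoc a_ac)
  also have "\<dots> = a \<otimes> q \<oplus> b \<otimes> (s \<oplus> t)" using p c s t pq by (simp add: m_assoc[symmetric])
  also have "(a \<otimes> q \<oplus> b \<otimes> (s \<oplus> t)) \<otimes> inv q = a \<oplus> b \<otimes> ((s \<oplus> t) \<otimes> inv q)"
    using q c s t(1) pq by (simp add: l_distr m_assoc)
  finally show "\<exists>t\<in>carrier R. a \<oplus> b \<otimes> t \<in> Units R" using c s t(1) pq by auto
qed

end

context complementary_idempotents
begin

lemma off_diagonal_square':
  assumes "x \<in> carrier R" "e \<otimes> x = \<zero>" "x \<otimes> f = \<zero>"
  shows "x \<otimes> x = \<zero>"
proof -
  interpret fe: complementary_idempotents R f e
    by unfold_locales (simp_all add: a_comm[of f e])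
  show ?thesis using fe.off_diagonal_square assms by blast
qed

text \<open>As \<open>a\<close> is block diagonal, compressing to \<open>f\<close> gives an equation
  inside \<open>fRf\<close>. The correction \<open>t = y s\<close> has \<open>s\<close> in
  \<open>fRf\<close>, so it leaves the columns of \<open>e\<close> alone, and the result is block
  triangular with unit diagonal blocks.\<close>

lemma reducible_if_diagonal:
  assumes sr: "stable_range_one (corner R f)"
    and c: "a \<in> carrier R" "b \<in> carrier R" "x \<in> carrier R" "y \<in> carrier R"
    and eq: "a \<otimes> x \<oplus> b \<otimes> y = \<one>"
    and ea: "e \<otimes> a = a \<otimes> e" and u: "e \<otimes> a \<otimes> e \<in> Units (corner R e)"
  shows "\<exists>t\<in>carrier R. a \<oplus> b \<otimes> t \<in> Units R"
proof -
  have fa: "f \<otimes> a = a \<otimes> f" using commute_f[OF c(1) ea] .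
  have faf: "f \<otimes> a \<otimes> f = f \<otimes> a" using c by (simp add: m_assoc fa[symmetric])
  have fae: "f \<otimes> a \<otimes> e = \<zero>" using c unfolding fa by (simp add: m_assoc)
  have "(f \<otimes> a \<otimes> f) \<otimes> (f \<otimes> x \<otimes> f) \<oplus> f \<otimes> (b \<otimes> y) \<otimes> f = (f \<otimes> a \<otimes> f) \<otimes> x \<otimes> f \<oplus> f \<otimes> (b \<otimes> y) \<otimes> f"
    using c by (simp add: m_assoc)
  also have "\<dots> = f \<otimes> (a \<otimes> x \<oplus> b \<otimes> y) \<otimes> f"
    unfolding faf using c by (simp add: m_assoc l_distr r_distr)
  finally have "(f \<otimes> a \<otimes> f) \<otimes> (f \<otimes> x \<otimes> f) \<oplus> f \<otimes> (b \<otimes> y) \<otimes> f = f" by (simp add: eq)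
  then obtain s where s: "s \<in> carrier R" "f \<otimes> s = s" "s \<otimes> f = s"
      "f \<otimes> a \<otimes> f \<oplus> f \<otimes> (b \<otimes> y) \<otimes> f \<otimes> s \<in> Units (corner R f)"
    using c stable_range_oneD[OF sr, of "f \<otimes> a \<otimes> f" "f \<otimes> x \<otimes> f" "f \<otimes> (b \<otimes> y) \<otimes> f"]
    by (auto simp: m_assoc)
  have se: "s \<otimes> e = \<zero>" by (metis s(1,3) fe m_assoc e f r_null)
  let ?z = "a \<oplus> b \<otimes> (y \<otimes> s)"
  have "e \<otimes> ?z \<otimes> e = e \<otimes> a \<otimes> e" "f \<otimes> ?z \<otimes> e = \<zero>"
    using c s(1) se fae by (simp_all add: l_distr r_distr m_assoc)
  moreover have "f \<otimes> ?z \<otimes> f = f \<otimes> a \<otimes> f \<oplus> f \<otimes> (b \<otimes> y) \<otimes> f \<otimes> s"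
    using c s(1-3) by (simp add: l_distr r_distr m_assoc)
  ultimately have "?z \<in> Units R" using triangular_unit[of ?z] c s u by simp
  then show ?thesis using c s by blast
qed

text \<open>The hypothesis on \<open>e\<close> is spent on making the \<open>e\<close> block of the
  first entry a unit, by \<open>pivot\<close>, after which \<open>clear\<close> makes this entry
  block diagonal. The hypothesis on \<open>f\<close> then finishes through
  \<open>reducible_if_diagonal\<close>.\<close>

lemma stable_range_one_if_corners:
  assumes sr_e: "stable_range_one (corner R e)" and sr_f: "stable_range_one (corner R f)"
  shows "stable_range_one R"
proof (rule stable_range_one_if_reduced)
  fix a x b assume c: "a \<in> carrier R" "x \<in> carrier R" "b \<in> carrier R" and eq: "a \<otimes> x \<oplus> b = \<one>"
  obtain s u' where s: "s \<in> carrier (corner R e)" and u': "u' \<in> carrier (corner R e)"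
    and u: "u' \<otimes> (e \<otimes> (a \<otimes> (\<one> \<oplus> f \<otimes> x \<otimes> s) \<oplus> b \<otimes> s) \<otimes> e) = e"
      "e \<otimes> (a \<otimes> (\<one> \<oplus> f \<otimes> x \<otimes> s) \<oplus> b \<otimes> s) \<otimes> e \<otimes> u' = e"
    using pivot[OF sr_e c eq] .
  have s': "s \<in> carrier R" "e \<otimes> s = s" "s \<otimes> e = s" using s by auto
  have u'': "u' \<in> carrier R" "e \<otimes> u' = u'" "u' \<otimes> e = u'" using u' by auto
  define v where "v = f \<otimes> x \<otimes> s"
  define a1 where "a1 = a \<otimes> (\<one> \<oplus> v) \<oplus> b \<otimes> s"
  define p where "p = f \<otimes> a1 \<otimes> u'"
  define q where "q = u' \<otimes> a1 \<otimes> f"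
  have uf: "u' \<otimes> f = \<zero>" "f \<otimes> u' = \<zero>" "s \<otimes> f = \<zero>"
    by (metis s' u'' ef fe m_assoc e f r_null l_null)+
  have vc: "v \<in> carrier R" "e \<otimes> v = \<zero>" "v \<otimes> f = \<zero>"
    using c s' uf by (simp_all add: v_def m_assoc)
  have a1: "a1 \<in> carrier R" using c s' vc by (simp add: a1_def)
  have pc: "p \<in> carrier R" "e \<otimes> p = \<zero>" "p \<otimes> f = \<zero>" and qc: "q \<in> carrier R" "f \<otimes> q = \<zero>" "q \<otimes> e = \<zero>"
    using a1 u'' uf by (simp_all add: p_def q_def m_assoc) (simp add: m_assoc[symmetric] uf)
  \<comment> \<open>The right operation is the column operation of the pivot followed by the
    clearing factor \<open>\<one> \<ominus> q\<close>; the multiple of \<open>b\<close> has to be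
    carried through the latter, whence \<open>?s\<close>.\<close>
  let ?p = "\<one> \<ominus> p" and ?q = "(\<one> \<oplus> v) \<otimes> (\<one> \<ominus> q)" and ?s = "s \<otimes> (\<one> \<ominus> q)"
  let ?a = "?p \<otimes> (a \<otimes> ?q \<oplus> b \<otimes> ?s)" and ?b = "?p \<otimes> b"
  have pU: "?p \<in> Units R" and qU: "?q \<in> Units R"
    using off_diagonal_square[OF qc] off_diagonal_square'[OF pc] off_diagonal_square'[OF vc] pc qc vc
    by (simp_all add: square_zero_units)
  have a2: "?a = ?p \<otimes> a1 \<otimes> (\<one> \<ominus> q)"
    using c s' vc pc qc a1 by (simp add: a1_def l_distr m_assoc)
  note cl = clear[OF a1 u'' u[folded v_def, folded a1_def] p_def q_def, folded a2]
  have ac: "?a \<in> carrier R" "?b \<in> carrier R" using c s' vc pc qc by auto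
  have "e \<otimes> ?a \<otimes> e \<in> Units (corner R e)"
    unfolding cl(2) Units_corner using u[folded v_def, folded a1_def] u' a1
    by (auto simp: m_assoc)
  note red = reducible_if_diagonal[OF sr_f ac _ _ _ cl(1) this]
  show "\<exists>p\<in>Units R. \<exists>q\<in>Units R. \<exists>s\<in>carrier R. \<forall>x\<in>carrier R. \<forall>y\<in>carrier R.
      p \<otimes> (a \<otimes> q \<oplus> b \<otimes> s) \<otimes> x \<oplus> p \<otimes> b \<otimes> y = \<one> \<longrightarrow>
      (\<exists>t\<in>carrier R. p \<otimes> (a \<otimes> q \<oplus> b \<otimes> s) \<oplus> p \<otimes> b \<otimes> t \<in> Units R)"
    using pU qU s' qc red by (intro bexI[of _ ?p] bexI[of _ ?q] bexI[of _ ?s]) auto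
qed

text \<open>For \<open>b = \<zero>\<close>, \<open>pivot\<close> and \<open>clear\<close> split off the block of \<open>e\<close> from a unit \<open>g\<close>.\<close>

lemma unit_split_off:
  assumes sr: "stable_range_one (corner R e)" and g: "g \<in> Units R"
  obtains p h q v where
    "p \<in> carrier R" "e \<otimes> p = \<zero>" "p \<otimes> e = p" "v \<in> carrier R" "e \<otimes> v = \<zero>" "v \<otimes> e = v"
    "q \<in> carrier R" "e \<otimes> q = q" "q \<otimes> e = \<zero>" "h \<in> Units R" "e \<otimes> h = h \<otimes> e"
    "g = (\<one> \<oplus> p) \<otimes> h \<otimes> (\<one> \<oplus> q) \<otimes> (\<one> \<oplus> v)"
    "\<And>k. \<lbrakk>k \<in> carrier R; k \<otimes> e = \<zero>; e \<otimes> k = \<zero>; k \<otimes> g = g \<otimes> k\<rbrakk> \<Longrightarrow>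
      k \<otimes> p = \<zero> \<and> k \<otimes> v = \<zero> \<and> q \<otimes> k = \<zero> \<and> k \<otimes> h = h \<otimes> k"
proof -
  have c: "g \<in> carrier R" "inv g \<in> carrier R" "g \<otimes> inv g \<oplus> \<zero> = \<one>" using g by auto
  obtain s u' where s: "s \<in> carrier (corner R e)" and u': "u' \<in> carrier (corner R e)"
    and u: "u' \<otimes> (e \<otimes> (g \<otimes> (\<one> \<oplus> f \<otimes> inv g \<otimes> s) \<oplus> \<zero> \<otimes> s) \<otimes> e) = e"
      "e \<otimes> (g \<otimes> (\<one> \<oplus> f \<otimes> inv g \<otimes> s) \<oplus> \<zero> \<otimes> s) \<otimes> e \<otimes> u' = e"
    using pivot[OF sr c(1,2) _ c(3)] by blast
  have s': "s \<in> carrier R" "e \<otimes> s = s" "s \<otimes> e = s" using s by auto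
  have u'': "u' \<in> carrier R" "e \<otimes> u' = u'" "u' \<otimes> e = u'" using u' by auto
  define v where "v = f \<otimes> inv g \<otimes> s"
  define a1 where "a1 = g \<otimes> (\<one> \<oplus> v)"
  define p where "p = f \<otimes> a1 \<otimes> u'"
  define q where "q = u' \<otimes> a1 \<otimes> f"
  define h where "h = (\<one> \<ominus> p) \<otimes> a1 \<otimes> (\<one> \<ominus> q)"
  have uf: "u' \<otimes> f = \<zero>" "f \<otimes> u' = \<zero>" "s \<otimes> f = \<zero>"
    by (metis s' u'' ef fe m_assoc e f r_null l_null)+
  have vc: "v \<in> carrier R" "e \<otimes> v = \<zero>" "v \<otimes> f = \<zero>" "v \<otimes> e = v"
    using c s' uf by (simp_all add: v_def m_assoc)
  have a1: "a1 \<in> carrier R" using c s' vc by (simp add: a1_def)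
  have pc: "p \<in> carrier R" "e \<otimes> p = \<zero>" "p \<otimes> f = \<zero>" and qc: "q \<in> carrier R" "f \<otimes> q = \<zero>" "q \<otimes> e = \<zero>"
    using a1 u'' uf by (simp_all add: p_def q_def m_assoc) (simp add: m_assoc[symmetric] uf)
  have pe: "p \<otimes> e = p" and eq: "e \<otimes> q = q"
    using a1 u'' by (simp_all add: p_def q_def m_assoc) (simp add: m_assoc[symmetric])
  have u1: "u' \<otimes> (e \<otimes> a1 \<otimes> e) = e" "e \<otimes> a1 \<otimes> e \<otimes> u' = e"
    using u c vc by (simp_all add: a1_def v_def[symmetric] s')
  have eh: "e \<otimes> h = h \<otimes> e" using clear(1)[OF a1 u'' u1 p_def q_def] by (simp add: h_def)
  note sq = off_diagonal_square[OF qc] off_diagonal_square'[OF pc] off_diagonal_square'[OF vc(1-3)]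
  have U: "\<one> \<ominus> p \<in> Units R" "\<one> \<ominus> q \<in> Units R" "\<one> \<oplus> v \<in> Units R"
    using sq pc qc vc by (simp_all add: square_zero_units)
  have hU: "h \<in> Units R" using U g by (simp add: h_def a1_def)
  have hc: "h \<in> carrier R" using hU by (rule Units_closed)
  have "(\<one> \<oplus> p) \<otimes> h \<otimes> (\<one> \<oplus> q) = ((\<one> \<oplus> p) \<otimes> (\<one> \<ominus> p)) \<otimes> a1 \<otimes> ((\<one> \<ominus> q) \<otimes> (\<one> \<oplus> q))"
    using pc qc a1 by (simp add: h_def m_assoc)
  then have "(\<one> \<oplus> p) \<otimes> h \<otimes> (\<one> \<oplus> q) = a1"
    using square_zero_inverse sq pc qc a1 by simp
  \<comment> \<open>The pivot multiplied \<open>g\<close> on the right by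
    \<open>\<one> \<oplus> v\<close>; the element returned in the last factor is therefore
    \<open>\<ominus> v\<close>.\<close>
  moreover have "a1 \<otimes> (\<one> \<oplus> \<ominus> v) = g"
    using square_zero_inverse(1)[OF vc(1)] sq vc c by (simp add: a1_def m_assoc minus_eq)
  ultimately have ga: "g = (\<one> \<oplus> p) \<otimes> h \<otimes> (\<one> \<oplus> q) \<otimes> (\<one> \<oplus> \<ominus> v)" by simp
  \<comment> \<open>The elements \<open>s\<close> and \<open>u'\<close> lie in the corner of
    \<open>e\<close>, so \<open>k\<close> annihilates them on both sides, and \<open>k\<close>
    commutes with \<open>g\<close> and \<open>inv g\<close>. All factors are built from these.
    Applied to the other idempotents of a family, this confines the elimination to the blocks that
    \<open>g\<close> really moves.\<close>
  have k: "k \<otimes> p = \<zero> \<and> k \<otimes> \<ominus> v = \<zero> \<and> q \<otimes> k = \<zero> \<and> k \<otimes> h = h \<otimes> k"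
    if k: "k \<in> carrier R" "k \<otimes> e = \<zero>" "e \<otimes> k = \<zero>" "k \<otimes> g = g \<otimes> k" for k
  proof -
    have kf: "k \<otimes> f = k" "f \<otimes> k = k" using k by (simp_all add: f_eq minus_eq l_distr r_distr l_minus r_minus)
    have ki: "k \<otimes> inv g = inv g \<otimes> k" using commute_inv[OF g k(1,4)] .
    have ku: "k \<otimes> u' = \<zero>" "u' \<otimes> k = \<zero>" "k \<otimes> s = \<zero>" "s \<otimes> k = \<zero>"
      by (metis k(1-3) u'' s' e m_assoc l_null r_null)+
    have kv: "k \<otimes> v = \<zero>" "v \<otimes> k = \<zero>"
    proof -
      have "k \<otimes> v = (k \<otimes> inv g) \<otimes> s" using k c s' kf by (simp add: v_def m_assoc[symmetric])
      also have "\<dots> = \<zero>" unfolding ki using k c s' ku by (simp add: m_assoc)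
      finally show "k \<otimes> v = \<zero>" .
      show "v \<otimes> k = \<zero>" using k c s' ku by (simp add: v_def m_assoc)
    qed
    have ka: "k \<otimes> a1 = g \<otimes> k" "a1 \<otimes> k = g \<otimes> k"
    proof -
      have "k \<otimes> a1 = (k \<otimes> g) \<otimes> (\<one> \<oplus> v)" using k(1) c vc by (simp add: a1_def m_assoc)
      also have "\<dots> = g \<otimes> k" unfolding k(4) using k(1) c vc kv by (simp add: m_assoc r_distr)
      finally show "k \<otimes> a1 = g \<otimes> k" .
      show "a1 \<otimes> k = g \<otimes> k" using k(1) c vc kv by (simp add: a1_def m_assoc l_distr)
    qed
    have kp: "k \<otimes> p = \<zero>" "p \<otimes> k = \<zero>"
    proof -
      have "k \<otimes> p = (k \<otimes> a1) \<otimes> u'" using k a1 u'' kf by (simp add: p_def m_assoc[symmetric])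
      then show "k \<otimes> p = \<zero>" unfolding ka using k(1) c u'' ku by (simp add: m_assoc)
      show "p \<otimes> k = \<zero>" using k(1) a1 u'' ku by (simp add: p_def m_assoc)
    qed
    have kq: "k \<otimes> q = \<zero>" "q \<otimes> k = \<zero>"
    proof -
      have "q \<otimes> k = u' \<otimes> (a1 \<otimes> k)" using k a1 u'' kf by (simp add: q_def m_assoc)
      also have "\<dots> = u' \<otimes> (k \<otimes> g)" unfolding ka k(4) ..
      also have "\<dots> = \<zero>" using k(1) c u'' ku by (simp add: m_assoc[symmetric])
      finally show "q \<otimes> k = \<zero>" .
      show "k \<otimes> q = \<zero>" using k(1) a1 u'' ku by (simp add: q_def m_assoc[symmetric])
    qed
    have "k \<otimes> h = (k \<otimes> (\<one> \<ominus> p)) \<otimes> a1 \<otimes> (\<one> \<ominus> q)"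
      using k(1) pc qc a1 by (simp add: h_def m_assoc)
    also have "k \<otimes> (\<one> \<ominus> p) = k" using k(1) pc kp by (simp add: minus_eq r_distr r_minus)
    also have "k \<otimes> a1 \<otimes> (\<one> \<ominus> q) = g \<otimes> (k \<otimes> (\<one> \<ominus> q))" unfolding ka using k(1) c qc by (simp add: m_assoc)
    also have "k \<otimes> (\<one> \<ominus> q) = k" using k(1) qc kq by (simp add: minus_eq r_distr r_minus)
    also have "g \<otimes> k = k \<otimes> a1" using ka by simp
    finally have 1: "k \<otimes> h = k \<otimes> a1" .
    have "h \<otimes> k = (\<one> \<ominus> p) \<otimes> (a1 \<otimes> ((\<one> \<ominus> q) \<otimes> k))"
      using k(1) pc qc a1 by (simp add: h_def m_assoc)
    also have "(\<one> \<ominus> q) \<otimes> k = k" using k(1) qc kq by (simp add: minus_eq l_distr l_minus)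
    also have "(\<one> \<ominus> p) \<otimes> (a1 \<otimes> k) = (\<one> \<ominus> p) \<otimes> (k \<otimes> a1)" using ka by simp
    also have "\<dots> = ((\<one> \<ominus> p) \<otimes> k) \<otimes> a1" using k(1) pc a1 by (simp add: m_assoc)
    also have "(\<one> \<ominus> p) \<otimes> k = k" using k(1) pc kp by (simp add: minus_eq l_distr l_minus)
    finally show ?thesis using 1 kp kq kv k(1) vc by (simp add: r_minus)
  qed
  show ?thesis
    by (rule that[of p "\<ominus> v" q h]) (use pc pe eq qc vc hU eh ga k in \<open>simp_all add: r_minus l_minus\<close>)
qed

end

subsection \<open>Semi-local rings have stable range one\<close>

context ring
begin

text \<open>The equations for \<open>g\<close> say that \<open>e\<close> lies below it; this is what
  allows the two-block result, proved for a whole ring, to be applied inside the corner of a partial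
  sum.\<close>

lemma corner_corner:
  assumes e: "e \<in> carrier R" "e \<otimes> e = e" and g: "g \<in> carrier R" "e \<otimes> g = e" "g \<otimes> e = e"
  shows "corner (corner R g) e = corner R e"
proof -
  have "{a \<in> carrier (corner R g). e \<otimes> a = a \<and> a \<otimes> e = a} = {a \<in> carrier R. e \<otimes> a = a \<and> a \<otimes> e = a}"
  proof (intro Collect_cong iffI)
    fix a assume a: "a \<in> carrier R \<and> e \<otimes> a = a \<and> a \<otimes> e = a"
    then have "a \<in> carrier R" "g \<otimes> (e \<otimes> a) = e \<otimes> a" "a \<otimes> e \<otimes> g = a \<otimes> e"
      using e g by (metis m_assoc)+
    then show "a \<in> carrier (corner R g) \<and> e \<otimes> a = a \<and> a \<otimes> e = a" using a by simp
  qed simp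
  then show ?thesis by (simp add: corner_def)
qed

lemma stable_range_one_corner_add:
  assumes e: "e \<in> carrier R" "e \<otimes> e = e" and f: "f \<in> carrier R" "f \<otimes> f = f"
    and ef: "e \<otimes> f = \<zero>" "f \<otimes> e = \<zero>"
    and sr: "stable_range_one (corner R e)" "stable_range_one (corner R f)"
  shows "stable_range_one (corner R (e \<oplus> f))"
proof -
  let ?g = "e \<oplus> f"
  have g: "?g \<in> carrier R" "e \<otimes> ?g = e" "?g \<otimes> e = e" "f \<otimes> ?g = f" "?g \<otimes> f = f" "?g \<otimes> ?g = ?g"
    using e f ef by (simp_all add: l_distr r_distr)
  interpret C: ring "corner R ?g" by (rule corner_ring) (use g in auto)
  interpret C: complementary_idempotents "corner R ?g" e f
    by unfold_locales (use e f ef g in auto)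
  show ?thesis
    by (rule C.stable_range_one_if_corners) (use sr e f g in \<open>simp_all add: corner_corner\<close>)
qed

lemma stable_range_one_corner_zero: "stable_range_one (corner R \<zero>)"
proof -
  have "carrier (corner R \<zero>) = {\<zero>}" by auto
  then show ?thesis unfolding stable_range_one_def Units_def by auto
qed

text \<open>Orthogonal idempotents are added one at a time. Idempotence of the partial sum is
  carried along, because the step treats that sum as one idempotent orthogonal to the next.\<close>

lemma stable_range_one_corner_sum:
  assumes "finite I"
    and "\<And>i. i \<in> I \<Longrightarrow> e i \<in> carrier R \<and> e i \<otimes> e i = e i"
    and "\<And>i j. i \<in> I \<Longrightarrow> j \<in> I \<Longrightarrow> i \<noteq> j \<Longrightarrow> e i \<otimes> e j = \<zero>"
    and "\<And>i. i \<in> I \<Longrightarrow> stable_range_one (corner R (e i))"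
  shows "(\<Oplus>i\<in>I. e i) \<otimes> (\<Oplus>i\<in>I. e i) = (\<Oplus>i\<in>I. e i) \<and> stable_range_one (corner R (\<Oplus>i\<in>I. e i))"
  using assms
proof (induction I rule: finite_induct)
  case empty
  then show ?case by (simp add: stable_range_one_corner_zero)
next
  case (insert k I)
  let ?s = "\<Oplus>i\<in>I. e i"
  have c: "e \<in> I \<rightarrow> carrier R" "e k \<in> carrier R" "e k \<otimes> e k = e k" using insert.prems by auto
  then have s: "?s \<in> carrier R" by simp
  have IH: "?s \<otimes> ?s = ?s \<and> stable_range_one (corner R ?s)"
    using insert.prems by (intro insert.IH) auto
  have "e k \<otimes> ?s = (\<Oplus>i\<in>I. e k \<otimes> e i)" using insert.hyps c by (simp add: finsum_rdistr)
  also have "\<dots> = (\<Oplus>i\<in>I. \<zero>)" using insert.prems(2) insert.hyps c by (intro add.finprod_cong') auto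
  finally have 1: "e k \<otimes> ?s = \<zero>" by simp
  have "?s \<otimes> e k = (\<Oplus>i\<in>I. e i \<otimes> e k)" using insert.hyps c by (simp add: finsum_ldistr)
  also have "\<dots> = (\<Oplus>i\<in>I. \<zero>)" using insert.prems(2) insert.hyps c by (intro add.finprod_cong') auto
  finally have 2: "?s \<otimes> e k = \<zero>" by simp
  have 3: "(\<Oplus>i\<in>insert k I. e i) = e k \<oplus> ?s" using insert.hyps c by simp
  show ?case unfolding 3
    using stable_range_one_corner_add[of "e k" ?s] c s IH 1 2 insert.prems(3)
    by (simp add: l_distr r_distr)
qed

lemma stable_range_one_if_finsum_one:
  assumes "finite I" "(\<Oplus>i\<in>I. e i) = \<one>"
    and "\<And>i. i \<in> I \<Longrightarrow> e i \<in> carrier R \<and> e i \<otimes> e i = e i"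
    and "\<And>i j. i \<in> I \<Longrightarrow> j \<in> I \<Longrightarrow> i \<noteq> j \<Longrightarrow> e i \<otimes> e j = \<zero>"
    and "\<And>i. i \<in> I \<Longrightarrow> stable_range_one (corner R (e i))"
  shows "stable_range_one R"
  using stable_range_one_corner_sum[of I e] assms(1,3,4,5) stable_range_one_corner_one
  by (simp add: assms(2))

lemma stable_range_one_if_division:
  assumes "\<And>a. a \<in> carrier R \<Longrightarrow> a \<noteq> \<zero> \<Longrightarrow> a \<in> Units R"
  shows "stable_range_one R"
  unfolding stable_range_one_def
proof (intro ballI impI)
  fix a x b assume c: "a \<in> carrier R" "x \<in> carrier R" "b \<in> carrier R" and eq: "a \<otimes> x \<oplus> b = \<one>"
  show "\<exists>t\<in>carrier R. a \<oplus> b \<otimes> t \<in> Units R"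
  proof (cases "a = \<zero>")
    case True
    then have "b = \<one>" using eq c by simp
    then show ?thesis using True by (intro bexI[of _ \<one>]) auto
  next
    case False
    then show ?thesis using assms[OF c(1)] c by (intro bexI[of _ \<zero>]) auto
  qed
qed

lemma finsum_swap:
  assumes "finite A" "finite B" "\<And>i j. i \<in> A \<Longrightarrow> j \<in> B \<Longrightarrow> f i j \<in> carrier R"
  shows "(\<Oplus>i\<in>A. \<Oplus>j\<in>B. f i j) = (\<Oplus>j\<in>B. \<Oplus>i\<in>A. f i j)"
  using assms
proof (induction A rule: finite_induct)
  case (insert k A)
  have "(\<Oplus>i\<in>insert k A. \<Oplus>j\<in>B. f i j) = (\<Oplus>j\<in>B. f k j) \<oplus> (\<Oplus>j\<in>B. \<Oplus>i\<in>A. f i j)"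
    using insert by (subst add.finprod_insert) auto
  also have "\<dots> = (\<Oplus>j\<in>B. f k j \<oplus> (\<Oplus>i\<in>A. f i j))"
    using insert by (intro add.finprod_multf[symmetric]) auto
  also have "\<dots> = (\<Oplus>j\<in>B. \<Oplus>i\<in>insert k A. f i j)"
    using insert by (intro add.finprod_cong') auto
  finally show ?case .
qed simp

lemma finsum_single:
  assumes "finite A" "k \<in> A" "f k \<in> carrier R" "\<And>i. i \<in> A \<Longrightarrow> i \<noteq> k \<Longrightarrow> f i = \<zero>"
  shows "(\<Oplus>i\<in>A. f i) = f k"
proof -
  have "(\<Oplus>i\<in>A. f i) = (\<Oplus>i\<in>A. if k = i then f i else \<zero>)"
    using assms by (intro add.finprod_cong') auto
  also have "\<dots> = f k" using assms by (intro add.finprod_singleton) (auto, metis zero_closed)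
  finally show ?thesis .
qed

end

section \<open>Matrix rings over division rings and their finite products\<close>

lemma matrix_ring_carrierD:
  "A \<in> carrier (matrix_ring m D) \<Longrightarrow> i < m \<Longrightarrow> j < m \<Longrightarrow> A (i, j) \<in> carrier D"
  by (auto simp: matrix_ring_def PiE_def Pi_def)

lemma matrix_ring_eqI:
  assumes "A \<in> carrier (matrix_ring m D)" "B \<in> carrier (matrix_ring m D)"
    and "\<And>i j. i < m \<Longrightarrow> j < m \<Longrightarrow> A (i, j) = B (i, j)"
  shows "A = B"
  by (rule PiE_ext[of A "{..<m} \<times> {..<m}" "\<lambda>_. carrier D"]) (use assms in \<open>auto simp: matrix_ring_def\<close>)

lemma matrix_ring_entries:
  assumes "i < m" "j < m"
  shows "(A \<otimes>\<^bsub>matrix_ring m D\<^esub> B) (i, j) = (\<Oplus>\<^bsub>D\<^esub>k\<in>{..<m}. A (i, k) \<otimes>\<^bsub>D\<^esub> B (k, j))"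
    "(A \<oplus>\<^bsub>matrix_ring m D\<^esub> B) (i, j) = A (i, j) \<oplus>\<^bsub>D\<^esub> B (i, j)"
    "\<one>\<^bsub>matrix_ring m D\<^esub> (i, j) = (if i = j then \<one>\<^bsub>D\<^esub> else \<zero>\<^bsub>D\<^esub>)"
    "\<zero>\<^bsub>matrix_ring m D\<^esub> (i, j) = \<zero>\<^bsub>D\<^esub>"
  using assms by (simp_all add: matrix_ring_def)

context
  fixes D :: "('a, 'm) ring_scheme" (structure) and m :: nat
  assumes D: "ring D"
begin

interpretation ring D by (rule D)

lemma matrix_ring_memI:
  assumes "\<And>i j. i < m \<Longrightarrow> j < m \<Longrightarrow> f i j \<in> carrier D"
  shows "(\<lambda>(i, j)\<in>{..<m} \<times> {..<m}. f i j) \<in> carrier (matrix_ring m D)"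
  using assms by (auto simp: matrix_ring_def)

lemma matrix_ring_closed:
  assumes "A \<in> carrier (matrix_ring m D)" "B \<in> carrier (matrix_ring m D)"
  shows "A \<otimes>\<^bsub>matrix_ring m D\<^esub> B \<in> carrier (matrix_ring m D)"
    "A \<oplus>\<^bsub>matrix_ring m D\<^esub> B \<in> carrier (matrix_ring m D)"
  using assms[THEN matrix_ring_carrierD]
  by (auto simp: matrix_ring_def intro!: finsum_closed)

lemma matrix_ring_one_zero_closed:
  "\<one>\<^bsub>matrix_ring m D\<^esub> \<in> carrier (matrix_ring m D)"
  "\<zero>\<^bsub>matrix_ring m D\<^esub> \<in> carrier (matrix_ring m D)"
  by (auto simp: matrix_ring_def)

lemma matrix_ring_is_ring: "ring (matrix_ring m D)"
proof (rule ringI)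
  let ?M = "matrix_ring m D"
  note cl = matrix_ring_closed matrix_ring_one_zero_closed and en = matrix_ring_entries and cD = matrix_ring_carrierD
  show "abelian_group ?M"
  proof (rule abelian_groupI)
    fix A assume A: "A \<in> carrier ?M"
    let ?B = "\<lambda>(i, j)\<in>{..<m} \<times> {..<m}. \<ominus> A (i, j)"
    have B: "?B \<in> carrier ?M" using A by (intro matrix_ring_memI) (auto dest: cD)
    have "?B \<oplus>\<^bsub>?M\<^esub> A = \<zero>\<^bsub>?M\<^esub>"
      by (rule matrix_ring_eqI[of _ m D]) (use A B in \<open>auto simp: cl en dest: cD intro: l_neg\<close>)
    then show "\<exists>B\<in>carrier ?M. B \<oplus>\<^bsub>?M\<^esub> A = \<zero>\<^bsub>?M\<^esub>" using B by blast
  next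
    fix A B C assume *: "A \<in> carrier ?M" "B \<in> carrier ?M" "C \<in> carrier ?M"
    show "A \<oplus>\<^bsub>?M\<^esub> B \<oplus>\<^bsub>?M\<^esub> C = A \<oplus>\<^bsub>?M\<^esub> (B \<oplus>\<^bsub>?M\<^esub> C)"
      by (rule matrix_ring_eqI[of _ m D]) (use * in \<open>simp_all add: cl en cD a_assoc\<close>)
  next
    fix A B assume *: "A \<in> carrier ?M" "B \<in> carrier ?M"
    show "A \<oplus>\<^bsub>?M\<^esub> B = B \<oplus>\<^bsub>?M\<^esub> A"
      by (rule matrix_ring_eqI[of _ m D]) (use * in \<open>simp_all add: cl en cD a_comm\<close>)
  next
    fix A assume *: "A \<in> carrier ?M"
    show "\<zero>\<^bsub>?M\<^esub> \<oplus>\<^bsub>?M\<^esub> A = A"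
      by (rule matrix_ring_eqI[of _ m D]) (use * in \<open>simp_all add: cl en cD\<close>)
  qed (simp_all add: cl)
  show "Group.monoid ?M"
  proof (rule monoidI)
    fix A B C assume *: "A \<in> carrier ?M" "B \<in> carrier ?M" "C \<in> carrier ?M"
    show "A \<otimes>\<^bsub>?M\<^esub> B \<otimes>\<^bsub>?M\<^esub> C = A \<otimes>\<^bsub>?M\<^esub> (B \<otimes>\<^bsub>?M\<^esub> C)"
    proof (rule matrix_ring_eqI[of _ m D])
      fix i j assume ij: "i < m" "j < m"
      have c: "A (k, l) \<in> carrier D" "B (k, l) \<in> carrier D" "C (k, l) \<in> carrier D" if "k < m" "l < m" for k l
        using that * by (auto dest: cD)
      have "(A \<otimes>\<^bsub>?M\<^esub> B \<otimes>\<^bsub>?M\<^esub> C) (i, j) = (\<Oplus>k\<in>{..<m}. (\<Oplus>l\<in>{..<m}. A (i, l) \<otimes> B (l, k)) \<otimes> C (k, j))"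
        using ij unfolding en(1)[OF ij] by (intro finsum_cong') (use c in \<open>auto simp: en(1)\<close>)
      also have "\<dots> = (\<Oplus>k\<in>{..<m}. \<Oplus>l\<in>{..<m}. A (i, l) \<otimes> B (l, k) \<otimes> C (k, j))"
        using ij * by (intro finsum_cong') (auto intro!: finsum_ldistr finsum_closed dest: cD)
      also have "\<dots> = (\<Oplus>l\<in>{..<m}. \<Oplus>k\<in>{..<m}. A (i, l) \<otimes> B (l, k) \<otimes> C (k, j))"
        using ij * by (intro finsum_swap) (auto dest: cD)
      also have "\<dots> = (\<Oplus>l\<in>{..<m}. A (i, l) \<otimes> (\<Oplus>k\<in>{..<m}. B (l, k) \<otimes> C (k, j)))"
      proof (intro finsum_cong' refl)
        fix l assume l: "l \<in> {..<m}"
        have "(\<Oplus>k\<in>{..<m}. A (i, l) \<otimes> B (l, k) \<otimes> C (k, j)) = (\<Oplus>k\<in>{..<m}. A (i, l) \<otimes> (B (l, k) \<otimes> C (k, j)))"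
          using ij l * by (intro finsum_cong') (auto simp: cD m_assoc)
        also have "\<dots> = A (i, l) \<otimes> (\<Oplus>k\<in>{..<m}. B (l, k) \<otimes> C (k, j))"
          using ij l * by (intro finsum_rdistr[symmetric]) (auto dest: cD)
        finally show "(\<Oplus>k\<in>{..<m}. A (i, l) \<otimes> B (l, k) \<otimes> C (k, j)) = A (i, l) \<otimes> (\<Oplus>k\<in>{..<m}. B (l, k) \<otimes> C (k, j))" .
      qed (use ij * in \<open>auto intro!: m_closed finsum_closed dest: cD\<close>)
      also have "\<dots> = (A \<otimes>\<^bsub>?M\<^esub> (B \<otimes>\<^bsub>?M\<^esub> C)) (i, j)"
        using ij unfolding en(1)[OF ij] by (intro finsum_cong') (use c in \<open>auto simp: en(1)\<close>)
      finally show "(A \<otimes>\<^bsub>?M\<^esub> B \<otimes>\<^bsub>?M\<^esub> C) (i, j) = (A \<otimes>\<^bsub>?M\<^esub> (B \<otimes>\<^bsub>?M\<^esub> C)) (i, j)" .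
    qed (use * in \<open>simp_all add: cl\<close>)
  next
    fix A assume A: "A \<in> carrier ?M"
    show "\<one>\<^bsub>?M\<^esub> \<otimes>\<^bsub>?M\<^esub> A = A"
    proof (rule matrix_ring_eqI[of _ m D])
      fix i j assume ij: "i < m" "j < m"
      have "(\<one>\<^bsub>?M\<^esub> \<otimes>\<^bsub>?M\<^esub> A) (i, j) = \<one>\<^bsub>?M\<^esub> (i, i) \<otimes> A (i, j)"
        unfolding en(1)[OF ij] using ij A by (intro finsum_single) (auto simp: en cD)
      then show "(\<one>\<^bsub>?M\<^esub> \<otimes>\<^bsub>?M\<^esub> A) (i, j) = A (i, j)" using ij A by (simp add: en cD)
    qed (use A in \<open>simp_all add: cl\<close>)
    show "A \<otimes>\<^bsub>?M\<^esub> \<one>\<^bsub>?M\<^esub> = A"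
    proof (rule matrix_ring_eqI[of _ m D])
      fix i j assume ij: "i < m" "j < m"
      have "(A \<otimes>\<^bsub>?M\<^esub> \<one>\<^bsub>?M\<^esub>) (i, j) = A (i, j) \<otimes> \<one>\<^bsub>?M\<^esub> (j, j)"
        unfolding en(1)[OF ij] using ij A by (intro finsum_single) (auto simp: en cD)
      then show "(A \<otimes>\<^bsub>?M\<^esub> \<one>\<^bsub>?M\<^esub>) (i, j) = A (i, j)" using ij A by (simp add: en cD)
    qed (use A in \<open>simp_all add: cl\<close>)
  qed (auto simp: cl intro: matrix_ring_memI[of "\<lambda>i j. if i = j then \<one> else \<zero>"])
  fix A B C assume *: "A \<in> carrier ?M" "B \<in> carrier ?M" "C \<in> carrier ?M"
  show "(A \<oplus>\<^bsub>?M\<^esub> B) \<otimes>\<^bsub>?M\<^esub> C = A \<otimes>\<^bsub>?M\<^esub> C \<oplus>\<^bsub>?M\<^esub> B \<otimes>\<^bsub>?M\<^esub> C"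
  proof (rule matrix_ring_eqI[of _ m D])
    fix i j assume ij: "i < m" "j < m"
    have "(\<Oplus>k\<in>{..<m}. (A \<oplus>\<^bsub>?M\<^esub> B) (i, k) \<otimes> C (k, j)) = (\<Oplus>k\<in>{..<m}. A (i, k) \<otimes> C (k, j) \<oplus> B (i, k) \<otimes> C (k, j))"
      using ij * by (intro finsum_cong') (auto simp: en cD l_distr)
    also have "\<dots> = (\<Oplus>k\<in>{..<m}. A (i, k) \<otimes> C (k, j)) \<oplus> (\<Oplus>k\<in>{..<m}. B (i, k) \<otimes> C (k, j))"
      using ij * by (intro finsum_addf) (auto dest: cD)
    finally show "((A \<oplus>\<^bsub>?M\<^esub> B) \<otimes>\<^bsub>?M\<^esub> C) (i, j) = (A \<otimes>\<^bsub>?M\<^esub> C \<oplus>\<^bsub>?M\<^esub> B \<otimes>\<^bsub>?M\<^esub> C) (i, j)"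
      using ij by (simp add: en)
  qed (use * in \<open>simp_all add: cl\<close>)
  show "C \<otimes>\<^bsub>?M\<^esub> (A \<oplus>\<^bsub>?M\<^esub> B) = C \<otimes>\<^bsub>?M\<^esub> A \<oplus>\<^bsub>?M\<^esub> C \<otimes>\<^bsub>?M\<^esub> B"
  proof (rule matrix_ring_eqI[of _ m D])
    fix i j assume ij: "i < m" "j < m"
    have "(\<Oplus>k\<in>{..<m}. C (i, k) \<otimes> (A \<oplus>\<^bsub>?M\<^esub> B) (k, j)) = (\<Oplus>k\<in>{..<m}. C (i, k) \<otimes> A (k, j) \<oplus> C (i, k) \<otimes> B (k, j))"
      using ij * by (intro finsum_cong') (auto simp: en cD r_distr)
    also have "\<dots> = (\<Oplus>k\<in>{..<m}. C (i, k) \<otimes> A (k, j)) \<oplus> (\<Oplus>k\<in>{..<m}. C (i, k) \<otimes> B (k, j))"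
      using ij * by (intro finsum_addf) (auto dest: cD)
    finally show "(C \<otimes>\<^bsub>?M\<^esub> (A \<oplus>\<^bsub>?M\<^esub> B)) (i, j) = (C \<otimes>\<^bsub>?M\<^esub> A \<oplus>\<^bsub>?M\<^esub> C \<otimes>\<^bsub>?M\<^esub> B) (i, j)"
      using ij by (simp add: en)
  qed (use * in \<open>simp_all add: cl\<close>)
qed

definition matrix_entry :: "nat \<Rightarrow> nat \<Rightarrow> 'a \<Rightarrow> nat \<times> nat \<Rightarrow> 'a" where
  "matrix_entry p q a = (\<lambda>(i, j)\<in>{..<m} \<times> {..<m}. if i = p \<and> j = q then a else \<zero>)"

lemma matrix_entry_closed: "a \<in> carrier D \<Longrightarrow> matrix_entry p q a \<in> carrier (matrix_ring m D)"
  unfolding matrix_entry_def by (rule matrix_ring_memI) auto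

lemma matrix_entry_at: "i < m \<Longrightarrow> j < m \<Longrightarrow> matrix_entry p q a (i, j) = (if i = p \<and> j = q then a else \<zero>)"
  by (simp add: matrix_entry_def)

lemma matrix_entry_mult_left:
  assumes "A \<in> carrier (matrix_ring m D)" "a \<in> carrier D" "i < m" "j < m" "p < m" "q < m"
  shows "(matrix_entry p q a \<otimes>\<^bsub>matrix_ring m D\<^esub> A) (i, j) = (if i = p then a \<otimes> A (q, j) else \<zero>)"
proof -
  have "(matrix_entry p q a \<otimes>\<^bsub>matrix_ring m D\<^esub> A) (i, j) = matrix_entry p q a (i, q) \<otimes> A (q, j)"
    unfolding matrix_ring_entries(1)[OF assms(3,4)]
    using assms matrix_ring_carrierD[OF assms(1)]
    by (intro finsum_single) (auto simp: matrix_entry_at)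
  then show ?thesis using assms matrix_ring_carrierD[OF assms(1)] by (simp add: matrix_entry_at)
qed

lemma matrix_entry_mult_right:
  assumes "A \<in> carrier (matrix_ring m D)" "a \<in> carrier D" "i < m" "j < m" "p < m" "q < m"
  shows "(A \<otimes>\<^bsub>matrix_ring m D\<^esub> matrix_entry p q a) (i, j) = (if j = q then A (i, p) \<otimes> a else \<zero>)"
proof -
  have "(A \<otimes>\<^bsub>matrix_ring m D\<^esub> matrix_entry p q a) (i, j) = A (i, p) \<otimes> matrix_entry p q a (p, j)"
    unfolding matrix_ring_entries(1)[OF assms(3,4)]
    using assms matrix_ring_carrierD[OF assms(1)]
    by (intro finsum_single) (auto simp: matrix_entry_at)
  then show ?thesis using assms matrix_ring_carrierD[OF assms(1)] by (simp add: matrix_entry_at)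
qed

lemma matrix_entry_mult:
  assumes "a \<in> carrier D" "b \<in> carrier D" "p < m" "q < m" "r < m" "s < m"
  shows "matrix_entry p q a \<otimes>\<^bsub>matrix_ring m D\<^esub> matrix_entry r s b =
    (if q = r then matrix_entry p s (a \<otimes> b) else \<zero>\<^bsub>matrix_ring m D\<^esub>)"
  by (rule matrix_ring_eqI[of _ m D])
    (use assms in \<open>auto simp: matrix_entry_mult_left matrix_entry_at matrix_ring_entries(4)
      matrix_entry_closed matrix_ring_closed matrix_ring_one_zero_closed\<close>)

text \<open>The number \<open>k\<close> of summands is kept apart from the size \<open>m\<close>, so
  that induction can run in a fixed ring; \<open>k = m\<close> gives the identity matrix.\<close>

lemma matrix_units_sum:
  assumes "k \<le> m" "i < m" "j < m"
  shows "(\<Oplus>\<^bsub>matrix_ring m D\<^esub>l\<in>{..<k}. matrix_entry l l \<one>) (i, j) =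
    (if i = j \<and> i < k then \<one> else \<zero>)"
  using assms(1)
proof (induction k)
  interpret M: ring "matrix_ring m D" by (rule matrix_ring_is_ring)
  case 0
  show ?case using assms by (simp add: matrix_ring_entries)
next
  interpret M: ring "matrix_ring m D" by (rule matrix_ring_is_ring)
  case (Suc k)
  have "(\<Oplus>\<^bsub>matrix_ring m D\<^esub>l\<in>{..<Suc k}. matrix_entry l l \<one>) =
      matrix_entry k k \<one> \<oplus>\<^bsub>matrix_ring m D\<^esub> (\<Oplus>\<^bsub>matrix_ring m D\<^esub>l\<in>{..<k}. matrix_entry l l \<one>)"
    unfolding lessThan_Suc by (rule M.add.finprod_insert) (auto intro: matrix_entry_closed)
  then show ?case using Suc assms by (auto simp: matrix_ring_entries matrix_entry_at)
qed

text \<open>The identity is the sum of the orthogonal diagonal matrix units, and the corner of each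
  of them is a copy of \<open>D\<close>, in which every nonzero element is a unit.\<close>

lemma matrix_ring_stable_range_one:
  assumes D': "division_ring D"
  shows "stable_range_one (matrix_ring m D)"
proof -
  let ?M = "matrix_ring m D"
  interpret M: ring ?M by (rule matrix_ring_is_ring)
  have one: "(\<Oplus>\<^bsub>?M\<^esub>i\<in>{..<m}. matrix_entry i i \<one>) = \<one>\<^bsub>?M\<^esub>"
    by (rule matrix_ring_eqI[of _ m D])
      (auto simp: matrix_units_sum matrix_ring_entries matrix_entry_closed intro!: M.finsum_closed)
  have corner: "stable_range_one (corner ?M (matrix_entry p p \<one>))" if p: "p < m" for p
  proof -
    let ?e = "matrix_entry p p \<one>"
    interpret C: ring "corner ?M ?e"
      by (rule M.corner_ring) (use p in \<open>simp_all add: matrix_entry_closed matrix_entry_mult\<close>)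
    show ?thesis
    proof (rule C.stable_range_one_if_division)
      fix A assume A: "A \<in> carrier (corner ?M ?e)" "A \<noteq> \<zero>\<^bsub>corner ?M ?e\<^esub>"
      then have Ac: "A \<in> carrier ?M" and eA: "?e \<otimes>\<^bsub>?M\<^esub> A = A" and Ae: "A \<otimes>\<^bsub>?M\<^esub> ?e = A" by auto
      define a where "a = A (p, p)"
      have a: "a \<in> carrier D" using Ac p matrix_ring_carrierD by (simp add: a_def)
      have Aa: "A = matrix_entry p p a"
      proof (rule matrix_ring_eqI[of _ m D])
        fix i j assume ij: "i < m" "j < m"
        have 1: "A (i, j) = (if i = p then A (p, j) else \<zero>)"
          using matrix_entry_mult_left[OF Ac one_closed ij p p] matrix_ring_carrierD[OF Ac] p ij by (simp add: eA)
        have 2: "A (i, j) = (if j = p then A (i, p) else \<zero>)"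
          using matrix_entry_mult_right[OF Ac one_closed ij p p] matrix_ring_carrierD[OF Ac] p ij by (simp add: Ae)
        show "A (i, j) = matrix_entry p p a (i, j)" using 1 2 ij by (auto simp: matrix_entry_at a_def)
      qed (use Ac a in \<open>simp_all add: matrix_entry_closed\<close>)
      have "a \<noteq> \<zero>"
      proof
        assume "a = \<zero>"
        then have "A = \<zero>\<^bsub>?M\<^esub>" unfolding Aa by (auto simp: matrix_entry_def matrix_ring_def fun_eq_iff)
        then show False using A by simp
      qed
      then have "a \<in> Units D" using D' a by (simp add: division_ring_def)
      then have b: "inv a \<in> carrier D" "a \<otimes> inv a = \<one>" "inv a \<otimes> a = \<one>" by auto
      show "A \<in> Units (corner ?M ?e)" unfolding Units_corner
        using A(1) p a b by (intro conjI bexI[of _ "matrix_entry p p (inv a)"])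
          (simp_all add: Aa matrix_entry_mult matrix_entry_closed)
    qed
  qed
  show ?thesis
    by (rule M.stable_range_one_if_finsum_one[OF _ one])
      (simp_all add: matrix_entry_closed matrix_entry_mult corner)
qed

end

lemma stable_range_one_iso:
  assumes h: "h \<in> ring_iso R S" and "ring R" and sr: "stable_range_one S"
  shows "stable_range_one R"
  unfolding stable_range_one_def
proof (intro ballI impI)
  interpret ring R by fact
  fix a x b assume c: "a \<in> carrier R" "x \<in> carrier R" "b \<in> carrier R"
    and eq: "a \<otimes>\<^bsub>R\<^esub> x \<oplus>\<^bsub>R\<^esub> b = \<one>\<^bsub>R\<^esub>"
  note hom = ring_iso_memE[OF h]
  have inj: "inj_on h (carrier R)" and surj: "h ` carrier R = carrier S"
    using hom(5) by (auto simp: bij_betw_def)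
  have "h (a \<otimes>\<^bsub>R\<^esub> x \<oplus>\<^bsub>R\<^esub> b) = \<one>\<^bsub>S\<^esub>" unfolding eq by (rule hom(4))
  then have "h a \<otimes>\<^bsub>S\<^esub> h x \<oplus>\<^bsub>S\<^esub> h b = \<one>\<^bsub>S\<^esub>" using c by (simp add: hom(2,3))
  then obtain t' where t': "t' \<in> carrier S" "h a \<oplus>\<^bsub>S\<^esub> h b \<otimes>\<^bsub>S\<^esub> t' \<in> Units S"
    using stable_range_oneD[OF sr hom(1)[OF c(1)] hom(1)[OF c(2)] hom(1)[OF c(3)]] by blast
  obtain t where t: "t \<in> carrier R" "t' = h t" using t'(1) surj by blast
  define u where "u = a \<oplus>\<^bsub>R\<^esub> b \<otimes>\<^bsub>R\<^esub> t"
  have u: "u \<in> carrier R" using c t by (simp add: u_def)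
  have "h u \<in> Units S" using t'(2) c t by (simp add: u_def hom(2,3))
  then obtain w' where w': "w' \<in> carrier S" "w' \<otimes>\<^bsub>S\<^esub> h u = \<one>\<^bsub>S\<^esub>" "h u \<otimes>\<^bsub>S\<^esub> w' = \<one>\<^bsub>S\<^esub>"
    unfolding Units_def by blast
  obtain w where w: "w \<in> carrier R" "w' = h w" using w'(1) surj by blast
  have "h (w \<otimes>\<^bsub>R\<^esub> u) = h \<one>\<^bsub>R\<^esub>" "h (u \<otimes>\<^bsub>R\<^esub> w) = h \<one>\<^bsub>R\<^esub>"
    using w' by (simp_all only: w(2) hom(2)[OF w(1) u] hom(2)[OF u w(1)] hom(4))
  then have "w \<otimes>\<^bsub>R\<^esub> u = \<one>\<^bsub>R\<^esub>" "u \<otimes>\<^bsub>R\<^esub> w = \<one>\<^bsub>R\<^esub>"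
    by (auto intro!: inj_onD[OF inj] u w(1))
  then have "u \<in> Units R" using u w(1) unfolding Units_def by blast
  then show "\<exists>t\<in>carrier R. a \<oplus>\<^bsub>R\<^esub> b \<otimes>\<^bsub>R\<^esub> t \<in> Units R" using t(1) unfolding u_def by blast
qed

lemma stable_range_one_RDirProd:
  assumes "ring R" "ring S" "stable_range_one R" "stable_range_one S"
  shows "stable_range_one (RDirProd R S)"
proof -
  have Units: "(x, y) \<in> Units (RDirProd R S)" if "x \<in> Units R" "y \<in> Units S" for x y
    using that by (auto simp: Units_def RDirProd_def DirProd_def monoid.defs)
  show ?thesis unfolding stable_range_one_def
  proof (intro ballI impI)
    fix a x b assume "a \<in> carrier (RDirProd R S)" "x \<in> carrier (RDirProd R S)" "b \<in> carrier (RDirProd R S)"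
      and eq: "a \<otimes>\<^bsub>RDirProd R S\<^esub> x \<oplus>\<^bsub>RDirProd R S\<^esub> b = \<one>\<^bsub>RDirProd R S\<^esub>"
    moreover obtain a1 a2 x1 x2 b1 b2 where ab: "a = (a1, a2)" "x = (x1, x2)" "b = (b1, b2)" by force
    ultimately have c: "a1 \<in> carrier R" "x1 \<in> carrier R" "b1 \<in> carrier R"
        "a2 \<in> carrier S" "x2 \<in> carrier S" "b2 \<in> carrier S" by (auto simp: RDirProd_carrier)
    have "a1 \<otimes>\<^bsub>R\<^esub> x1 \<oplus>\<^bsub>R\<^esub> b1 = \<one>\<^bsub>R\<^esub>" "a2 \<otimes>\<^bsub>S\<^esub> x2 \<oplus>\<^bsub>S\<^esub> b2 = \<one>\<^bsub>S\<^esub>"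
      using eq by (auto simp: ab RDirProd_def DirProd_def monoid.defs)
    then obtain t1 t2 where t: "t1 \<in> carrier R" "a1 \<oplus>\<^bsub>R\<^esub> b1 \<otimes>\<^bsub>R\<^esub> t1 \<in> Units R"
        "t2 \<in> carrier S" "a2 \<oplus>\<^bsub>S\<^esub> b2 \<otimes>\<^bsub>S\<^esub> t2 \<in> Units S"
      using c stable_range_oneD[OF assms(3)] stable_range_oneD[OF assms(4)] by metis
    have "a \<oplus>\<^bsub>RDirProd R S\<^esub> b \<otimes>\<^bsub>RDirProd R S\<^esub> (t1, t2) =
        (a1 \<oplus>\<^bsub>R\<^esub> b1 \<otimes>\<^bsub>R\<^esub> t1, a2 \<oplus>\<^bsub>S\<^esub> b2 \<otimes>\<^bsub>S\<^esub> t2)"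
      by (simp add: ab RDirProd_def DirProd_def monoid.defs)
    then show "\<exists>t\<in>carrier (RDirProd R S). a \<oplus>\<^bsub>RDirProd R S\<^esub> b \<otimes>\<^bsub>RDirProd R S\<^esub> t \<in> Units (RDirProd R S)"
      using t Units by (intro bexI[of _ "(t1, t2)"]) (auto simp: RDirProd_carrier)
  qed
qed

lemma stable_range_one_RDirProd_list:
  assumes "\<And>R. R \<in> set Rs \<Longrightarrow> ring R \<and> stable_range_one R"
  shows "stable_range_one (RDirProd_list Rs)"
  using assms
proof (induction Rs)
  case Nil
  show ?case unfolding stable_range_one_def Units_def by (simp add: monoid.defs)
next
  case (Cons R Rs)
  have r: "ring (RDirProd_list Rs)" "ring (RDirProd_list (R # Rs))"
    using Cons.prems nth_mem[of _ "R # Rs"]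
    by (auto intro!: RDirProd_list_is_ring simp del: nth_mem) (meson nth_mem)+
  have "stable_range_one (RDirProd R (RDirProd_list Rs))"
    using Cons r by (intro stable_range_one_RDirProd) auto
  then show ?case by (rule stable_range_one_iso[OF RDirProd_list_iso2 r(2)])
qed

section \<open>The Jacobson radical and lifting of units modulo it\<close>

context ring
begin

lemma left_ideal_mem:
  assumes "left_ideal R J"
  shows "J \<subseteq> carrier R" "\<zero> \<in> J" "\<And>x y. x \<in> J \<Longrightarrow> y \<in> J \<Longrightarrow> x \<oplus> y \<in> J"
    "\<And>x. x \<in> J \<Longrightarrow> \<ominus> x \<in> J" "\<And>r x. r \<in> carrier R \<Longrightarrow> x \<in> J \<Longrightarrow> r \<otimes> x \<in> J"
  using assms by (auto simp: left_ideal_def additive_subgroup_def subgroup_def a_inv_def)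

lemma left_idealI:
  assumes "J \<subseteq> carrier R" "\<zero> \<in> J" "\<And>x y. x \<in> J \<Longrightarrow> y \<in> J \<Longrightarrow> x \<oplus> y \<in> J"
    "\<And>r x. r \<in> carrier R \<Longrightarrow> x \<in> J \<Longrightarrow> r \<otimes> x \<in> J"
  shows "left_ideal R J"
proof -
  have "\<ominus> x \<in> J" if "x \<in> J" for x
    using assms(4)[of "\<ominus> \<one>" x] that assms(1) by (auto simp: l_minus)
  then show ?thesis using assms
    by (auto simp: left_ideal_def additive_subgroup_def subgroup_def a_inv_def)
qed

text \<open>Zorn's lemma for the left ideals that contain \<open>I\<close> and avoid
  \<open>\<one>\<close>. Properness is expressed through \<open>\<one>\<close> since this passes to
  unions of chains.\<close>

lemma left_ideal_maximal_exists:
  assumes I: "left_ideal R I" and one: "\<one> \<notin> I"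
  obtains M where "maximal_left_ideal R M" "I \<subseteq> M"
proof -
  define S where "S = {J. left_ideal R J \<and> I \<subseteq> J \<and> \<one> \<notin> J}"
  have "\<exists>M\<in>S. \<forall>J\<in>S. M \<subseteq> J \<longrightarrow> J = M"
  proof (rule Zorn_Lemma2, rule ballI)
    fix C assume ch: "C \<in> Zorn.chains S"
    show "\<exists>y\<in>S. \<forall>x\<in>C. x \<subseteq> y"
    proof (cases "C = {}")
      case True
      then show ?thesis using assms by (auto simp: S_def)
    next
      case ne: False
      have CS: "C \<subseteq> S" using ch by (auto simp: Zorn.chains_def)
      have tot: "A \<subseteq> B \<or> B \<subseteq> A" if "A \<in> C" "B \<in> C" for A B
        using ch that by (auto simp: Zorn.chains_def chain_subset_def)
      have li: "left_ideal R J" if "J \<in> C" for J using that CS by (auto simp: S_def)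
      have "left_ideal R (\<Union>C)"
      proof (rule left_idealI)
        fix x y assume "x \<in> \<Union>C" "y \<in> \<Union>C"
        then obtain A B where AB: "A \<in> C" "B \<in> C" "x \<in> A" "y \<in> B" by blast
        then obtain E where "E \<in> C" "x \<in> E" "y \<in> E" using tot[OF AB(1,2)] by blast
        then show "x \<oplus> y \<in> \<Union>C" using left_ideal_mem(3)[OF li] by blast
      next
        fix r x assume "r \<in> carrier R" "x \<in> \<Union>C"
        then show "r \<otimes> x \<in> \<Union>C" using left_ideal_mem(5)[OF li] by blast
      next
        show "\<zero> \<in> \<Union>C" using left_ideal_mem(2)[OF li] ne by blast
      qed (use left_ideal_mem(1)[OF li] in blast)
      then have "\<Union>C \<in> S" using CS ne by (auto simp: S_def)
      then show ?thesis by blast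
    qed
  qed
  then obtain M where M: "M \<in> S" "\<And>J. J \<in> S \<Longrightarrow> M \<subseteq> J \<Longrightarrow> J = M" by blast
  have "J = M \<or> J = carrier R" if J: "left_ideal R J" "M \<subseteq> J" for J
  proof (cases "\<one> \<in> J")
    case True
    have "x \<in> J" if "x \<in> carrier R" for x using left_ideal_mem(5)[OF J(1) that True] that by simp
    then show ?thesis using left_ideal_mem(1)[OF J(1)] by blast
  next
    case False
    then show ?thesis using M J by (auto simp: S_def)
  qed
  then have "maximal_left_ideal R M" using M(1) by (auto simp: maximal_left_ideal_def S_def)
  then show ?thesis using that M(1) by (auto simp: S_def)
qed

lemma maximal_left_ideal_one:
  assumes "maximal_left_ideal R M" shows "\<one> \<notin> M"
proof
  assume "\<one> \<in> M"
  have l: "left_ideal R M" "M \<noteq> carrier R" using assms by (auto simp: maximal_left_ideal_def)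
  have "x \<in> M" if "x \<in> carrier R" for x using left_ideal_mem(5)[OF l(1) that \<open>\<one> \<in> M\<close>] that by simp
  then show False using l left_ideal_mem(1)[OF l(1)] by blast
qed

text \<open>If \<open>1 + rx\<close> had no left inverse, the left ideal it generates would lie in a
  maximal one, which contains \<open>x\<close> and hence \<open>1\<close>. Conversely, a maximal
  left ideal \<open>M\<close> missing \<open>x\<close> gives \<open>1 = m + rx\<close> with
  \<open>m\<close> in \<open>M\<close>, and a left inverse of \<open>m = 1 - rx\<close> puts
  \<open>1\<close> into \<open>M\<close>.\<close>

lemma jacobson_radical_iff:
  "x \<in> jacobson_radical R \<longleftrightarrow>
     x \<in> carrier R \<and> (\<forall>r\<in>carrier R. \<exists>w\<in>carrier R. w \<otimes> (\<one> \<oplus> r \<otimes> x) = \<one>)"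
proof (intro iffI conjI ballI)
  assume x: "x \<in> jacobson_radical R"
  then show xc: "x \<in> carrier R" by (simp add: jacobson_radical_def)
  fix r assume r: "r \<in> carrier R"
  let ?y = "\<one> \<oplus> r \<otimes> x"
  let ?I = "{w \<otimes> ?y | w. w \<in> carrier R}"
  have I: "left_ideal R ?I"
  proof (rule left_idealI)
    show "\<zero> \<in> ?I" using xc r by (intro CollectI exI[of _ \<zero>]) simp
  next
    fix a b assume "a \<in> ?I" "b \<in> ?I"
    then obtain v w where "a = v \<otimes> ?y" "b = w \<otimes> ?y" "v \<in> carrier R" "w \<in> carrier R" by blast
    then show "a \<oplus> b \<in> ?I" using xc r by (intro CollectI exI[of _ "v \<oplus> w"]) (simp add: l_distr)
  next
    fix s a assume "s \<in> carrier R" "a \<in> ?I"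
    then show "s \<otimes> a \<in> ?I" using xc r by (auto simp: m_assoc[symmetric])
  qed (use xc r in auto)
  show "\<exists>w\<in>carrier R. w \<otimes> ?y = \<one>"
  proof (rule ccontr)
    assume "\<not> ?thesis"
    then have "\<one> \<notin> ?I" by force
    then obtain M where M: "maximal_left_ideal R M" "?I \<subseteq> M"
      using left_ideal_maximal_exists[OF I] by blast
    have l: "left_ideal R M" using M by (simp add: maximal_left_ideal_def)
    have "x \<in> M" using x M(1) by (auto simp: jacobson_radical_def)
    then have 1: "\<ominus> (r \<otimes> x) \<in> M" using left_ideal_mem(4,5)[OF l] r by blast
    have "\<one> \<otimes> ?y \<in> ?I" by blast
    then have "?y \<in> M" using M(2) xc r by auto
    then have "?y \<oplus> \<ominus> (r \<otimes> x) \<in> M" using 1 left_ideal_mem(3)[OF l] by blast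
    moreover have "?y \<oplus> \<ominus> (r \<otimes> x) = \<one>" using xc r by (simp add: a_assoc r_neg)
    ultimately show False using maximal_left_ideal_one[OF M(1)] by simp
  qed
next
  assume x: "x \<in> carrier R \<and> (\<forall>r\<in>carrier R. \<exists>w\<in>carrier R. w \<otimes> (\<one> \<oplus> r \<otimes> x) = \<one>)"
  have "x \<in> M" if M: "maximal_left_ideal R M" for M
  proof (rule ccontr)
    assume xM: "x \<notin> M"
    have l: "left_ideal R M" and max: "\<And>J. left_ideal R J \<Longrightarrow> M \<subseteq> J \<Longrightarrow> J = M \<or> J = carrier R"
      using M by (auto simp: maximal_left_ideal_def)
    note lm = left_ideal_mem[OF l]
    let ?J = "{m \<oplus> r \<otimes> x | m r. m \<in> M \<and> r \<in> carrier R}"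
    have J: "left_ideal R ?J"
    proof (rule left_idealI)
      show "?J \<subseteq> carrier R" using lm(1) x by auto
      show "\<zero> \<in> ?J" using lm(2) x by (intro CollectI exI[of _ \<zero>]) simp
    next
      fix a b assume "a \<in> ?J" "b \<in> ?J"
      then obtain m r m' r' where *: "a = m \<oplus> r \<otimes> x" "b = m' \<oplus> r' \<otimes> x"
        "m \<in> M" "m' \<in> M" "r \<in> carrier R" "r' \<in> carrier R" by blast
      then have "a \<oplus> b = (m \<oplus> m') \<oplus> (r \<oplus> r') \<otimes> x"
        using lm(1) x by (auto simp: l_distr a_ac subset_iff)
      then show "a \<oplus> b \<in> ?J" using * lm(3) by blast
    next
      fix s a assume s: "s \<in> carrier R" "a \<in> ?J"
      then obtain m r where *: "a = m \<oplus> r \<otimes> x" "m \<in> M" "r \<in> carrier R" by blast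
      then have "s \<otimes> a = s \<otimes> m \<oplus> (s \<otimes> r) \<otimes> x"
        using lm(1) x s by (auto simp: r_distr m_assoc subset_iff)
      then show "s \<otimes> a \<in> ?J" using * s lm(5) by blast
    qed
    have "m \<in> ?J" if "m \<in> M" for m
      using that x lm(1) by (intro CollectI exI[of _ m] exI[of _ \<zero>]) auto
    moreover have "x \<in> ?J"
      using x lm(2) by (intro CollectI exI[of _ \<zero>] exI[of _ \<one>]) auto
    ultimately have "?J = carrier R" using max[OF J] xM by blast
    then obtain m r where mr: "m \<in> M" "r \<in> carrier R" "\<one> = m \<oplus> r \<otimes> x" using one_closed by blast
    have mc: "m \<in> carrier R" using mr lm(1) by blast
    have "m = \<one> \<oplus> (\<ominus> r) \<otimes> x" unfolding mr(3) using mc mr(2) x by (simp add: l_minus a_assoc r_neg)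
    then obtain w where "w \<in> carrier R" "w \<otimes> m = \<one>" using x mr(2) by (metis a_inv_closed)
    then have "\<one> \<in> M" using lm(5)[of w m] mr(1) by simp
    then show False using maximal_left_ideal_one[OF M] by simp
  qed
  then show "x \<in> jacobson_radical R" using x by (auto simp: jacobson_radical_def)
qed

lemma jacobson_radical_left_ideal: "left_ideal R (jacobson_radical R)"
proof -
  have l: "left_ideal R M" if "maximal_left_ideal R M" for M
    using that by (simp add: maximal_left_ideal_def)
  show ?thesis
    by (rule left_idealI) (auto simp: jacobson_radical_def intro: left_ideal_mem[OF l])
qed

text \<open>If \<open>w\<close> is a left inverse of \<open>\<one> \<oplus> b \<otimes> a\<close>, then \<open>\<one> \<ominus> a \<otimes> w \<otimes> b\<close> is one of \<open>\<one> \<oplus> a \<otimes> b\<close>.\<close>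

lemma jacobson_radical_ideal: "ideal (jacobson_radical R) R"
proof (rule idealI)
  note J = jacobson_radical_left_ideal
  show "ring R" by (rule ring_axioms)
  show "subgroup (jacobson_radical R) (add_monoid R)"
    using J by (simp add: left_ideal_def additive_subgroup_def)
  fix a x assume a: "a \<in> jacobson_radical R" and x: "x \<in> carrier R"
  show "x \<otimes> a \<in> jacobson_radical R" using left_ideal_mem(5)[OF J x a] .
  have ac: "a \<in> carrier R" using a jacobson_radical_iff by blast
  show "a \<otimes> x \<in> jacobson_radical R" unfolding jacobson_radical_iff
  proof (intro conjI ballI)
    fix r assume r: "r \<in> carrier R"
    obtain w where w: "w \<in> carrier R" "w \<otimes> (\<one> \<oplus> (x \<otimes> r) \<otimes> a) = \<one>"
      using a x r jacobson_radical_iff[of a] by (metis m_closed)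
    let ?b = "r \<otimes> a"
    have "(\<one> \<ominus> ?b \<otimes> w \<otimes> x) \<otimes> (\<one> \<oplus> ?b \<otimes> x) =
        \<one> \<oplus> ?b \<otimes> x \<ominus> ?b \<otimes> (w \<otimes> (\<one> \<oplus> (x \<otimes> r) \<otimes> a)) \<otimes> x"
      using w(1) x r ac by (simp add: minus_eq l_distr r_distr l_minus r_minus m_assoc a_ac minus_add)
    also have "\<dots> = \<one>" unfolding w(2) using x r ac by (simp add: minus_eq a_assoc r_neg)
    finally show "\<exists>w\<in>carrier R. w \<otimes> (\<one> \<oplus> r \<otimes> (a \<otimes> x)) = \<one>"
      using w(1) x r ac by (intro bexI[of _ "\<one> \<ominus> ?b \<otimes> w \<otimes> x"]) (simp_all add: m_assoc)
  qed (use ac x in simp)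
qed

text \<open>A left inverse \<open>w\<close> of \<open>1 + j\<close> equals \<open>1 - wj\<close>, to
  which the criterion applies again, so \<open>w\<close> has a left inverse as well. Having inverses
  on both sides, \<open>w\<close> is a unit, and \<open>1 + j\<close> is its inverse.\<close>

lemma one_plus_jacobson_radical:
  assumes j: "j \<in> jacobson_radical R"
  shows "\<one> \<oplus> j \<in> Units R"
proof -
  have jc: "j \<in> carrier R" using j jacobson_radical_iff by blast
  have left: "\<exists>w\<in>carrier R. w \<otimes> (\<one> \<oplus> k) = \<one>" if "k \<in> jacobson_radical R" for k
    using that jacobson_radical_iff[of k] by (metis l_one one_closed)
  obtain w where w: "w \<in> carrier R" "w \<otimes> (\<one> \<oplus> j) = \<one>" using left[OF j] by blast
  have "w \<otimes> (\<one> \<oplus> j) \<oplus> \<ominus> (w \<otimes> j) = w" using w(1) jc by (simp add: r_distr a_assoc r_neg)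
  then have "w = \<one> \<oplus> \<ominus> (w \<otimes> j)" unfolding w(2) by simp
  moreover have "\<ominus> (w \<otimes> j) \<in> jacobson_radical R"
    using left_ideal_mem(4,5)[OF jacobson_radical_left_ideal] w(1) j by blast
  ultimately obtain v where v: "v \<in> carrier R" "v \<otimes> w = \<one>" using left[of "\<ominus> (w \<otimes> j)"] by auto
  then have "w \<in> Units R" using w jc by (intro Units_left_right[of w v "\<one> \<oplus> j"]) auto
  then have "inv w \<in> Units R" by auto
  moreover have "inv w = \<one> \<oplus> j" using w jc \<open>w \<in> Units R\<close> by (intro inv_unique[of "inv w" w "\<one> \<oplus> j"]) auto
  ultimately show ?thesis by simp
qed

text \<open>Units lift: if the class of \<open>w\<close> inverts the class of \<open>u\<close>, then
  \<open>wu\<close> and \<open>uw\<close> differ from \<open>1\<close> by elements of the radical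
  and are units, which gives \<open>u\<close> inverses on both sides.\<close>

lemma stable_range_one_if_quotient:
  assumes sr: "stable_range_one (R Quot (jacobson_radical R))"
  shows "stable_range_one R"
  unfolding stable_range_one_def
proof (intro ballI impI)
  let ?J = "jacobson_radical R"
  interpret J: ideal ?J R by (rule jacobson_radical_ideal)
  interpret Q: ring "R Quot ?J" by (rule J.quotient_is_ring)
  define h where "h = (+>) ?J"
  note hom = ring_hom_memE[OF J.rcos_ring_hom, folded h_def]
  have surj: "\<exists>y\<in>carrier R. z = h y" if "z \<in> carrier (R Quot ?J)" for z
    using that by (auto simp: FactRing_def A_RCOSETS_def' h_def)
  have unit: "z \<in> Units R" if "z \<in> carrier R" "h z = h \<one>" for z
  proof -
    have "z \<in> ?J +> \<one>" using that J.a_rcos_self[of z] by (simp add: h_def)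
    then obtain j where "j \<in> ?J" "z = j \<oplus> \<one>" by (auto simp: a_r_coset_def')
    then show ?thesis using one_plus_jacobson_radical[of j] J.a_Hcarr by (simp add: a_comm)
  qed
  fix a x b assume c: "a \<in> carrier R" "x \<in> carrier R" "b \<in> carrier R" and eq: "a \<otimes> x \<oplus> b = \<one>"
  have "h (a \<otimes> x \<oplus> b) = \<one>\<^bsub>R Quot ?J\<^esub>" unfolding eq by (rule hom(4))
  then have "h a \<otimes>\<^bsub>R Quot ?J\<^esub> h x \<oplus>\<^bsub>R Quot ?J\<^esub> h b = \<one>\<^bsub>R Quot ?J\<^esub>" using c by (simp add: hom(2,3))
  then obtain t' where t': "t' \<in> carrier (R Quot ?J)" "h a \<oplus>\<^bsub>R Quot ?J\<^esub> h b \<otimes>\<^bsub>R Quot ?J\<^esub> t' \<in> Units (R Quot ?J)"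
    using stable_range_oneD[OF sr hom(1)[OF c(1)] hom(1)[OF c(2)] hom(1)[OF c(3)]] by blast
  obtain t where t: "t \<in> carrier R" "t' = h t" using surj[OF t'(1)] by blast
  define u where "u = a \<oplus> b \<otimes> t"
  have u: "u \<in> carrier R" using c t by (simp add: u_def)
  have "h u \<in> Units (R Quot ?J)" using t'(2) c t by (simp add: u_def hom(2,3))
  then obtain w' where w': "w' \<in> carrier (R Quot ?J)" "w' \<otimes>\<^bsub>R Quot ?J\<^esub> h u = \<one>\<^bsub>R Quot ?J\<^esub>" "h u \<otimes>\<^bsub>R Quot ?J\<^esub> w' = \<one>\<^bsub>R Quot ?J\<^esub>"
    unfolding Units_def by blast
  obtain w where w: "w \<in> carrier R" "w' = h w" using surj[OF w'(1)] by blast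
  have "h (w \<otimes> u) = h \<one>" "h (u \<otimes> w) = h \<one>"
    using w' by (simp_all only: w(2) hom(2)[OF w(1) u] hom(2)[OF u w(1)] hom(4))
  then have 1: "w \<otimes> u \<in> Units R" "u \<otimes> w \<in> Units R" using unit u w(1) by auto
  have "(inv (w \<otimes> u) \<otimes> w) \<otimes> u = \<one>" "u \<otimes> (w \<otimes> inv (u \<otimes> w)) = \<one>"
    using 1 u w(1) by (simp_all add: m_assoc) (simp add: m_assoc[symmetric])
  then have "u \<in> Units R" by (rule Units_left_right[rotated 3]) (use u w(1) 1 in auto)
  then show "\<exists>t\<in>carrier R. a \<oplus> b \<otimes> t \<in> Units R" using t(1) unfolding u_def by blast
qed

lemma semilocal_stable_range_one:
  assumes "semilocal TYPE('d) R"
  shows "stable_range_one R"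
proof -
  obtain ds :: "(nat \<times> 'd ring) list" where ds: "\<forall>(m, D)\<in>set ds. 0 < m \<and> division_ring D"
    and "R Quot (jacobson_radical R) \<simeq> RDirProd_list (map (\<lambda>(m, D). matrix_ring m D) ds)"
    using assms unfolding semilocal_def by blast
  then obtain h where h: "h \<in> ring_iso (R Quot (jacobson_radical R)) (RDirProd_list (map (\<lambda>(m, D). matrix_ring m D) ds))"
    by (auto simp: is_ring_iso_def)
  have "stable_range_one (RDirProd_list (map (\<lambda>(m, D). matrix_ring m D) ds))"
    using ds by (intro stable_range_one_RDirProd_list)
      (auto intro!: matrix_ring_is_ring matrix_ring_stable_range_one simp: division_ring_def)
  then have "stable_range_one (R Quot (jacobson_radical R))"
    by (rule stable_range_one_iso[OF h ideal.quotient_is_ring[OF jacobson_radical_ideal]])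
  then show ?thesis by (rule stable_range_one_if_quotient)
qed

end

section \<open>Elementary reduction\<close>

text \<open>Semi-locality is represented by stable range one, which passes to the corners of the
  idempotents and so drives the elimination block by block.\<close>

locale idempotent_family = ring R for R (structure) +
  fixes n :: nat and e :: "nat \<Rightarrow> 'a"
  assumes complete: "complete_orthogonal_idempotents R n e"
    and stable_range_one: "stable_range_one R"
begin

abbreviation "Diag \<equiv> carrier (diagonal_group R n e)"

lemma e_closed [simp]: "i \<in> {1..n} \<Longrightarrow> e i \<in> carrier R"
  and e_idem [simp]: "i \<in> {1..n} \<Longrightarrow> e i \<otimes> e i = e i"
  and e_orth: "i \<in> {1..n} \<Longrightarrow> j \<in> {1..n} \<Longrightarrow> i \<noteq> j \<Longrightarrow> e i \<otimes> e j = \<zero>"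
  and e_sum: "(\<Oplus>i\<in>{1..n}. e i) = \<one>"
  using complete by (auto simp: complete_orthogonal_idempotents_def)

lemma e_idem_left [simp]: "i \<in> {1..n} \<Longrightarrow> x \<in> carrier R \<Longrightarrow> e i \<otimes> (e i \<otimes> x) = e i \<otimes> x"
  by (simp add: m_assoc[symmetric])

lemma e_orth_left: "\<lbrakk>i \<in> {1..n}; j \<in> {1..n}; i \<noteq> j; x \<in> carrier R\<rbrakk> \<Longrightarrow> e i \<otimes> (e j \<otimes> x) = \<zero>"
  using e_orth[of i j] by (simp add: m_assoc[symmetric])

lemmas peirce_mem = peirce_iff[OF ring_axioms complete]

lemma peirceD:
  assumes "i \<in> {1..n}" "j \<in> {1..n}" "a \<in> peirce R e i j"
  shows "a \<in> carrier R" "e i \<otimes> a = a" "a \<otimes> e j = a"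
  using assms by (auto simp: peirce_mem)

lemma peirce_zero:
  assumes "i \<in> {1..n}" "j \<in> {1..n}" "a \<in> peirce R e i j" "k \<in> {1..n}"
  shows "k \<noteq> i \<Longrightarrow> e k \<otimes> a = \<zero>" "k \<noteq> j \<Longrightarrow> a \<otimes> e k = \<zero>"
  using peirceD[OF assms(1-3)] e_orth[of k i] e_orth[of j k] assms(1,2,4)
  by (metis e_closed l_null m_assoc, metis e_closed m_assoc r_null)

lemma peirce_uminus: "i \<in> {1..n} \<Longrightarrow> j \<in> {1..n} \<Longrightarrow> a \<in> peirce R e i j \<Longrightarrow> \<ominus> a \<in> peirce R e i j"
  by (auto simp: peirce_mem l_minus r_minus)

lemma zero_in_peirce: "i \<in> {1..n} \<Longrightarrow> j \<in> {1..n} \<Longrightarrow> \<zero> \<in> peirce R e i j"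
  by (auto simp: peirce_mem)

lemma complementary_e:
  assumes "i \<in> {1..n}" shows "complementary_idempotents R (e i) (\<one> \<ominus> e i)"
  using assms by (intro complementary) auto

lemma corner_e: "i \<in> {1..n} \<Longrightarrow> stable_range_one (corner R (e i))"
  by (rule stable_range_one_corner[OF stable_range_one]) auto

lemma eq_if_rows_eq:
  assumes c: "x \<in> carrier R" "y \<in> carrier R" and eq: "\<And>i. i \<in> {1..n} \<Longrightarrow> e i \<otimes> x = e i \<otimes> y"
  shows "x = y"
proof -
  have "z = (\<Oplus>i\<in>{1..n}. e i \<otimes> z)" if "z \<in> carrier R" for z
    using finsum_ldistr[of "{1..n}" z e] that by (simp add: e_sum[simplified] Pi_iff)
  then have "x = (\<Oplus>i\<in>{1..n}. e i \<otimes> x)" "y = (\<Oplus>i\<in>{1..n}. e i \<otimes> y)" using c by blast+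
  moreover have "(\<Oplus>i\<in>{1..n}. e i \<otimes> x) = (\<Oplus>i\<in>{1..n}. e i \<otimes> y)"
    using eq c by (intro finsum_cong') auto
  ultimately show ?thesis by simp
qed

lemma eq_if_columns_eq:
  assumes c: "x \<in> carrier R" "y \<in> carrier R" and eq: "\<And>i. i \<in> {1..n} \<Longrightarrow> x \<otimes> e i = y \<otimes> e i"
  shows "x = y"
proof -
  have "z = (\<Oplus>i\<in>{1..n}. z \<otimes> e i)" if "z \<in> carrier R" for z
    using finsum_rdistr[of "{1..n}" z e] that by (simp add: e_sum[simplified] Pi_iff)
  then have "x = (\<Oplus>i\<in>{1..n}. x \<otimes> e i)" "y = (\<Oplus>i\<in>{1..n}. y \<otimes> e i)" using c by blast+
  moreover have "(\<Oplus>i\<in>{1..n}. x \<otimes> e i) = (\<Oplus>i\<in>{1..n}. y \<otimes> e i)"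
    using eq c by (intro finsum_cong') auto
  ultimately show ?thesis by simp
qed

lemma eq_if_blocks_eq:
  assumes c: "x \<in> carrier R" "y \<in> carrier R"
    and eq: "\<And>i j. i \<in> {1..n} \<Longrightarrow> j \<in> {1..n} \<Longrightarrow> e i \<otimes> x \<otimes> e j = e i \<otimes> y \<otimes> e j"
  shows "x = y"
  by (rule eq_if_rows_eq[OF c], rule eq_if_columns_eq) (use c eq in auto)

lemma diagonal_groupI:
  assumes h: "h \<in> Units R" and comm: "\<And>i. i \<in> {1..n} \<Longrightarrow> e i \<otimes> h = h \<otimes> e i"
  shows "h \<in> Diag"
proof -
  have "e i \<otimes> h \<otimes> e j = \<zero>" if "i \<in> {1..n}" "j \<in> {1..n}" "i \<noteq> j" for i j
    using that h e_orth[OF that] unfolding comm[OF that(1)] by (simp add: m_assoc Units_closed)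
  then show ?thesis using h by (auto simp: diagonal_group_def units_of_carrier)
qed

lemma diagonal_groupD:
  assumes "h \<in> Diag"
  shows "h \<in> Units R" "\<And>i. i \<in> {1..n} \<Longrightarrow> e i \<otimes> h = h \<otimes> e i"
proof -
  show "h \<in> Units R" using assms by (simp add: diagonal_group_def units_of_carrier)
  show "e i \<otimes> h = h \<otimes> e i" if "i \<in> {1..n}" for i
    by (rule diagonal_group_commute[OF ring_axioms complete assms that])
qed

lemma diagonal_group_is_group: "group (diagonal_group R n e)"
proof -
  interpret GL: group "GL R" by (rule units_group)
  have "subgroup (Diag) (GL R)"
  proof (rule GL.subgroupI)
    show "Diag \<subseteq> carrier (GL R)"
      by (auto simp: diagonal_group_def)
    have "\<one> \<in> Diag" by (rule diagonal_groupI) auto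
    then show "Diag \<noteq> {}" by blast
  next
    fix h assume h: "h \<in> Diag"
    note hD = diagonal_groupD[OF h]
    have "inv h \<in> Diag"
      by (rule diagonal_groupI) (use hD in \<open>auto intro: commute_inv\<close>)
    then show "inv\<^bsub>GL R\<^esub> h \<in> Diag" using hD(1) by (simp add: units_of_inv)
  next
    fix g h assume g: "g \<in> Diag" and h: "h \<in> Diag"
    note gD = diagonal_groupD[OF g] and hD = diagonal_groupD[OF h]
    have "g \<otimes> h \<in> Diag"
    proof (rule diagonal_groupI)
      fix i assume i: "i \<in> {1..n}"
      have "e i \<otimes> (g \<otimes> h) = (e i \<otimes> g) \<otimes> h" using i gD(1) hD(1) by (simp add: m_assoc Units_closed)
      also have "\<dots> = g \<otimes> (e i \<otimes> h)" unfolding gD(2)[OF i] using i gD(1) hD(1) by (simp add: m_assoc Units_closed)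
      also have "\<dots> = g \<otimes> h \<otimes> e i" unfolding hD(2)[OF i] using i gD(1) hD(1) by (simp add: m_assoc Units_closed)
      finally show "e i \<otimes> (g \<otimes> h) = g \<otimes> h \<otimes> e i" .
    qed (use gD hD in auto)
    then show "g \<otimes>\<^bsub>GL R\<^esub> h \<in> Diag" by (simp add: units_of_mult)
  qed
  then have "group ((GL R)\<lparr>carrier := Diag\<rparr>)"
    by (rule GL.subgroup_imp_group)
  then show ?thesis by (simp add: diagonal_group_def)
qed

lemma diagonal_group_simps:
  assumes "h \<in> Diag"
  shows "inv\<^bsub>diagonal_group R n e\<^esub> h = inv h" "g \<otimes>\<^bsub>diagonal_group R n e\<^esub> h = g \<otimes> h"
    "\<one>\<^bsub>diagonal_group R n e\<^esub> = \<one>" "inv h \<in> Diag"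
proof -
  interpret D: group "diagonal_group R n e" by (rule diagonal_group_is_group)
  have m: "g \<otimes>\<^bsub>diagonal_group R n e\<^esub> h = g \<otimes> h" "\<one>\<^bsub>diagonal_group R n e\<^esub> = \<one>" for g h
    by (simp_all add: diagonal_group_def units_of_mult units_of_one)
  then show "g \<otimes>\<^bsub>diagonal_group R n e\<^esub> h = g \<otimes> h" "\<one>\<^bsub>diagonal_group R n e\<^esub> = \<one>" by auto
  have hU: "h \<in> Units R" using diagonal_groupD[OF assms] by simp
  have i: "inv\<^bsub>diagonal_group R n e\<^esub> h \<in> carrier R" "inv\<^bsub>diagonal_group R n e\<^esub> h \<otimes> h = \<one>"
    using D.l_inv[OF assms] diagonal_groupD(1)[OF D.inv_closed[OF assms]] by (simp_all add: m Units_closed)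
  then show *: "inv\<^bsub>diagonal_group R n e\<^esub> h = inv h"
    using hU by (intro inv_unique[of _ h "inv h"]) auto
  show "inv h \<in> Diag" using D.inv_closed[OF assms] * by simp
qed

text \<open>The left side of the identity differs from \<open>1\<close> only in the blocks of
  \<open>i\<close> and \<open>k\<close>, so the other idempotents commute with it, and the
  annihilation clause of \<open>unit_split_off\<close> forces the new factors into the blocks
  \<open>(i, k)\<close> and \<open>(k, i)\<close>. The identity is lifted from GL(R) in
  \<open>rank_one_gauss\<close>.\<close>

lemma rank_one_reduction:
  assumes ik: "i \<in> {1..n}" "k \<in> {1..n}" "i \<noteq> k"
    and a: "a \<in> peirce R e k i" and b: "b \<in> peirce R e i k" and c: "c \<in> peirce R e k i"
  obtains p h q t where "p \<in> peirce R e i k" "q \<in> peirce R e k i" "t \<in> peirce R e i k"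
    "h \<in> Diag"
    "(\<one> \<oplus> a) \<otimes> (\<one> \<oplus> b) \<otimes> (\<one> \<oplus> c) = (\<one> \<oplus> p) \<otimes> h \<otimes> (\<one> \<oplus> q) \<otimes> (\<one> \<oplus> t)"
proof -
  let ?g = "(\<one> \<oplus> a) \<otimes> (\<one> \<oplus> b) \<otimes> (\<one> \<oplus> c)"
  interpret C: complementary_idempotents R "e k" "\<one> \<ominus> e k" by (rule complementary_e[OF ik(2)])
  have abc: "a \<in> carrier R" "b \<in> carrier R" "c \<in> carrier R" using a b c peirceD ik by blast+
  have g: "?g \<in> Units R"
    using one_plus_peirce[OF ring_axioms complete] ik a b c by (metis Units_m_closed)
  obtain p h q v where *: "p \<in> carrier R" "e k \<otimes> p = \<zero>" "p \<otimes> e k = p"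
      "v \<in> carrier R" "e k \<otimes> v = \<zero>" "v \<otimes> e k = v"
      "q \<in> carrier R" "e k \<otimes> q = q" "q \<otimes> e k = \<zero>" "h \<in> Units R" "e k \<otimes> h = h \<otimes> e k"
    and eq: "?g = (\<one> \<oplus> p) \<otimes> h \<otimes> (\<one> \<oplus> q) \<otimes> (\<one> \<oplus> v)"
    and ann: "\<And>f. \<lbrakk>f \<in> carrier R; f \<otimes> e k = \<zero>; e k \<otimes> f = \<zero>; f \<otimes> ?g = ?g \<otimes> f\<rbrakk> \<Longrightarrow>
      f \<otimes> p = \<zero> \<and> f \<otimes> v = \<zero> \<and> q \<otimes> f = \<zero> \<and> f \<otimes> h = h \<otimes> f"
    by (rule C.unit_split_off[OF corner_e[OF ik(2)] g]) (rule that, assumption+)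
  have ann': "e l \<otimes> p = \<zero> \<and> e l \<otimes> v = \<zero> \<and> q \<otimes> e l = \<zero> \<and> e l \<otimes> h = h \<otimes> e l"
    if l: "l \<in> {1..n}" "l \<noteq> i" "l \<noteq> k" for l
  proof (rule ann)
    note z = peirce_zero[OF _ _ a l(1)] peirce_zero[OF _ _ b l(1)] peirce_zero[OF _ _ c l(1)]
    have "e l \<otimes> (\<one> \<oplus> x) = e l" "(\<one> \<oplus> x) \<otimes> e l = e l" if "x \<in> {a, b, c}" for x
      using z that l ik abc by (auto simp: l_distr r_distr)
    then have "e l \<otimes> ?g = e l" "?g \<otimes> e l = e l"
      using l abc by (simp_all add: m_assoc) (simp add: m_assoc[symmetric])
    then show "e l \<otimes> ?g = ?g \<otimes> e l" by simp
  qed (use l ik e_orth in auto)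
  \<comment> \<open>As the idempotents sum to \<open>\<one>\<close>, an element annihilated from the
    left by every other \<open>e l\<close> is supported in row \<open>i\<close>; \<open>col\<close>
    is the same for columns.\<close>
  have row: "e i \<otimes> x = x" if "x \<in> carrier R" "\<And>l. l \<in> {1..n} \<Longrightarrow> l \<noteq> i \<Longrightarrow> e l \<otimes> x = \<zero>" for x
  proof (rule eq_if_rows_eq)
    fix l assume l: "l \<in> {1..n}"
    show "e l \<otimes> (e i \<otimes> x) = e l \<otimes> x"
      using that l ik e_orth_left[of l i x] by (cases "l = i") auto
  qed (use that ik in auto)
  have col: "x \<otimes> e i = x" if "x \<in> carrier R" "\<And>l. l \<in> {1..n} \<Longrightarrow> l \<noteq> i \<Longrightarrow> x \<otimes> e l = \<zero>" for x
  proof (rule eq_if_columns_eq)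
    fix l assume l: "l \<in> {1..n}"
    show "x \<otimes> e i \<otimes> e l = x \<otimes> e l"
      using that l ik e_orth[of i l] by (cases "l = i") (auto simp: m_assoc)
  qed (use that ik in auto)
  have "p \<in> peirce R e i k" "v \<in> peirce R e i k" "q \<in> peirce R e k i"
    using * ann' row[of p] row[of v] col[of q] ik by (auto simp: peirce_mem)
  moreover have "h \<in> Diag"
  proof (rule diagonal_groupI)
    fix l assume l: "l \<in> {1..n}"
    have hc: "h \<in> carrier R" using *(10) by (rule Units_closed)
    show "e l \<otimes> h = h \<otimes> e l"
    proof (cases "l = i")
      case True
      \<comment> \<open>Every \<open>e m\<close> with \<open>m \<noteq> i\<close> is already known
        to commute with \<open>h\<close>, so the off-diagonal blocks in row and column
        \<open>i\<close> vanish too.\<close>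
      have off: "e i \<otimes> h \<otimes> e m = \<zero>" "e m \<otimes> h \<otimes> e i = \<zero>" if m: "m \<in> {1..n}" "m \<noteq> i" for m
      proof -
        have comm: "e m \<otimes> h = h \<otimes> e m" using ann' *(11) m by (cases "m = k") auto
        then show "e m \<otimes> h \<otimes> e i = \<zero>" using m ik hc e_orth[of m i] by (simp add: m_assoc)
        have "e i \<otimes> h \<otimes> e m = e i \<otimes> (e m \<otimes> h)" unfolding comm using m ik hc by (simp add: m_assoc)
        then show "e i \<otimes> h \<otimes> e m = \<zero>" using m ik hc by (simp add: e_orth_left)
      qed
      show ?thesis unfolding True
      proof (rule eq_if_blocks_eq)
        fix r s assume rs: "r \<in> {1..n}" "s \<in> {1..n}"
        show "e r \<otimes> (e i \<otimes> h) \<otimes> e s = e r \<otimes> (h \<otimes> e i) \<otimes> e s"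
          using rs ik hc off[of r] off[of s] e_orth[of i s]
          by (cases "r = i"; cases "s = i") (auto simp: m_assoc e_orth_left)
      qed (use ik hc in auto)
    qed (use ann' *(11) l in \<open>cases "l = k"; auto\<close>)
  qed (use * in auto)
  ultimately show ?thesis using that eq by blast
qed

text \<open>Since \<open>p = p e_k\<close>, the element \<open>p\<close> annihilates every
  \<open>x\<close> with \<open>e_k x = 0\<close>; hence the factors \<open>1 + e_i p\<close>
  multiply to \<open>1\<close> plus the sum of the \<open>e_i p\<close>. The set \<open>H\<close> is
  only assumed to be closed under products, so that the image of a subgroup can be substituted for
  it.\<close>

lemma off_diagonal_column_product:
  assumes H: "\<one> \<in> H" "\<And>g h. g \<in> H \<Longrightarrow> h \<in> H \<Longrightarrow> g \<otimes> h \<in> H"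
      "\<And>i j a. \<lbrakk>i \<in> {1..n}; j \<in> {1..n}; i \<noteq> j; a \<in> peirce R e i j\<rbrakk> \<Longrightarrow> \<one> \<oplus> a \<in> H"
    and k: "k \<in> {1..n}" and p: "p \<in> carrier R" "e k \<otimes> p = \<zero>" "p \<otimes> e k = p"
  shows "\<one> \<oplus> p \<in> H"
proof -
  have "\<one> \<oplus> (\<Oplus>i\<in>I. e i \<otimes> p) \<in> H" if "finite I" "I \<subseteq> {1..n}" for I
    using that
  proof (induction I rule: finite_induct)
    case empty
    then show ?case using H by simp
  next
    case (insert i I)
    let ?s = "\<Oplus>i\<in>I. e i \<otimes> p"
    have i: "i \<in> {1..n}" and f: "(\<lambda>i. e i \<otimes> p) \<in> I \<rightarrow> carrier R" using insert.prems p by auto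
    have sc: "?s \<in> carrier R" using f by simp
    have "e k \<otimes> ?s = (\<Oplus>i\<in>I. e k \<otimes> (e i \<otimes> p))" using insert.hyps f k by (simp add: finsum_rdistr)
    also have "\<dots> = (\<Oplus>i\<in>I. \<zero>)"
    proof (intro finsum_cong' refl)
      fix j assume "j \<in> I"
      then show "e k \<otimes> (e j \<otimes> p) = \<zero>"
        using insert.prems p k e_orth_left[of k j p] by (cases "j = k") auto
    qed auto
    finally have ks: "e k \<otimes> ?s = \<zero>" by simp
    have ips: "e i \<otimes> p \<otimes> ?s = \<zero>"
    proof -
      have "e i \<otimes> p \<otimes> ?s = e i \<otimes> (p \<otimes> e k) \<otimes> ?s" using p by simp
      also have "\<dots> = e i \<otimes> p \<otimes> (e k \<otimes> ?s)" using p(1) i k sc by (simp add: m_assoc)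
      finally show ?thesis using ks p(1) i by simp
    qed
    have ip: "\<one> \<oplus> e i \<otimes> p \<in> H"
    proof (cases "i = k")
      case True then show ?thesis using p H by simp
    next
      case False
      have "e i \<otimes> p \<in> peirce R e i k" using p k i by (simp add: peirce_mem m_assoc)
      then show ?thesis using H(3)[OF i k False] by blast
    qed
    have "(\<one> \<oplus> e i \<otimes> p) \<otimes> (\<one> \<oplus> ?s) = \<one> \<oplus> (e i \<otimes> p \<oplus> ?s)"
      using ips p(1) i sc by (simp add: l_distr r_distr a_ac)
    also have "e i \<otimes> p \<oplus> ?s = (\<Oplus>i\<in>insert i I. e i \<otimes> p)"
      using insert.hyps f p i by simp
    finally show ?case using H(2)[OF ip insert.IH] insert.prems by simp
  qed
  from this[of "{1..n}"] show ?thesis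
    using finsum_ldistr[of "{1..n}" p e] p by (simp add: e_sum[simplified] Pi_iff)
qed

text \<open>The transposed argument: here the partial sum is annihilated by \<open>e k\<close> from
  the right, so each new factor is appended on the right.\<close>

lemma off_diagonal_row_product:
  assumes H: "\<one> \<in> H" "\<And>g h. g \<in> H \<Longrightarrow> h \<in> H \<Longrightarrow> g \<otimes> h \<in> H"
      "\<And>i j a. \<lbrakk>i \<in> {1..n}; j \<in> {1..n}; i \<noteq> j; a \<in> peirce R e i j\<rbrakk> \<Longrightarrow> \<one> \<oplus> a \<in> H"
    and k: "k \<in> {1..n}" and p: "p \<in> carrier R" "e k \<otimes> p = p" "p \<otimes> e k = \<zero>"
  shows "\<one> \<oplus> p \<in> H"
proof -
  have "\<one> \<oplus> (\<Oplus>i\<in>I. p \<otimes> e i) \<in> H" if "finite I" "I \<subseteq> {1..n}" for I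
    using that
  proof (induction I rule: finite_induct)
    case empty
    then show ?case using H by simp
  next
    case (insert i I)
    let ?s = "\<Oplus>i\<in>I. p \<otimes> e i"
    have i: "i \<in> {1..n}" and f: "(\<lambda>i. p \<otimes> e i) \<in> I \<rightarrow> carrier R" using insert.prems p by auto
    have sc: "?s \<in> carrier R" using f by simp
    have "?s \<otimes> e k = (\<Oplus>i\<in>I. (p \<otimes> e i) \<otimes> e k)" using insert.hyps f k by (simp add: finsum_ldistr)
    also have "\<dots> = (\<Oplus>i\<in>I. \<zero>)"
    proof (intro finsum_cong' refl)
      fix j assume "j \<in> I"
      then show "p \<otimes> e j \<otimes> e k = \<zero>"
        using insert.prems p k e_orth[of j k] by (cases "j = k") (auto simp: m_assoc)
    qed auto
    finally have ks: "?s \<otimes> e k = \<zero>" by simp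
    have ips: "?s \<otimes> (p \<otimes> e i) = \<zero>"
    proof -
      have "?s \<otimes> (p \<otimes> e i) = ?s \<otimes> ((e k \<otimes> p) \<otimes> e i)" using p by simp
      also have "\<dots> = (?s \<otimes> e k) \<otimes> (p \<otimes> e i)" using p(1) i k sc by (simp add: m_assoc)
      finally show ?thesis using ks p(1) i by simp
    qed
    have ip: "\<one> \<oplus> p \<otimes> e i \<in> H"
    proof (cases "i = k")
      case True then show ?thesis using p H by simp
    next
      case False
      have "p \<otimes> e i \<in> peirce R e k i" using p k i by (simp add: peirce_mem m_assoc) (simp add: m_assoc[symmetric])
      then show ?thesis using H(3)[OF k i] False by blast
    qed
    have "(\<one> \<oplus> ?s) \<otimes> (\<one> \<oplus> p \<otimes> e i) = \<one> \<oplus> (p \<otimes> e i \<oplus> ?s)"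
      using ips p(1) i sc by (simp add: l_distr r_distr a_ac)
    also have "p \<otimes> e i \<oplus> ?s = (\<Oplus>i\<in>insert i I. p \<otimes> e i)"
      using insert.hyps f p i by simp
    finally show ?case using H(2)[OF insert.IH ip] insert.prems by simp
  qed
  from this[of "{1..n}"] show ?thesis
    using finsum_rdistr[of "{1..n}" p e] p by (simp add: e_sum[simplified] Pi_iff)
qed

text \<open>Blocks are split off in the order of the indices. By the annihilation clause of
  \<open>unit_split_off\<close>, the remaining factor \<open>h\<close> still commutes with the
  idempotents treated before, so after the last block it is diagonal.\<close>

lemma GL_elementary_diagonal:
  assumes H: "\<one> \<in> H" "\<And>g h. g \<in> H \<Longrightarrow> h \<in> H \<Longrightarrow> g \<otimes> h \<in> H"
      "\<And>i j a. \<lbrakk>i \<in> {1..n}; j \<in> {1..n}; i \<noteq> j; a \<in> peirce R e i j\<rbrakk> \<Longrightarrow> \<one> \<oplus> a \<in> H"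
    and D: "\<And>h. h \<in> Diag \<Longrightarrow> h \<in> H"
    and g: "g \<in> Units R"
  shows "g \<in> H"
proof -
  \<comment> \<open>\<open>m\<close> counts the blocks still to be split off: the idempotents up to
    \<open>n - m\<close> commute with \<open>g\<close> already. In the step for
    \<open>Suc m\<close>, the next index is \<open>k = n - m\<close>.\<close>
  have "g \<in> H" if "g \<in> Units R" "\<And>i. i \<in> {1..n} \<Longrightarrow> i \<le> n - m \<Longrightarrow> e i \<otimes> g = g \<otimes> e i" "m \<le> n" for g m
    using that
  proof (induction m arbitrary: g)
    case 0
    then show ?case by (intro D diagonal_groupI) auto
  next
    case (Suc m)
    define k where "k = n - m"
    have k: "k \<in> {1..n}" using Suc.prems by (auto simp: k_def)
    interpret C: complementary_idempotents R "e k" "\<one> \<ominus> e k" by (rule complementary_e[OF k])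
    obtain p h q v where *: "p \<in> carrier R" "e k \<otimes> p = \<zero>" "p \<otimes> e k = p"
        "v \<in> carrier R" "e k \<otimes> v = \<zero>" "v \<otimes> e k = v"
        "q \<in> carrier R" "e k \<otimes> q = q" "q \<otimes> e k = \<zero>" "h \<in> Units R" "e k \<otimes> h = h \<otimes> e k"
      and eq: "g = (\<one> \<oplus> p) \<otimes> h \<otimes> (\<one> \<oplus> q) \<otimes> (\<one> \<oplus> v)"
      and ann: "\<And>f. \<lbrakk>f \<in> carrier R; f \<otimes> e k = \<zero>; e k \<otimes> f = \<zero>; f \<otimes> g = g \<otimes> f\<rbrakk> \<Longrightarrow>
        f \<otimes> p = \<zero> \<and> f \<otimes> v = \<zero> \<and> q \<otimes> f = \<zero> \<and> f \<otimes> h = h \<otimes> f"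
      by (rule C.unit_split_off[OF corner_e[OF k] Suc.prems(1)]) (rule that, assumption+)
    have "h \<in> H"
    proof (rule Suc.IH)
      fix i assume i: "i \<in> {1..n}" "i \<le> n - m"
      show "e i \<otimes> h = h \<otimes> e i"
      proof (cases "i = k")
        case False
        then have "i \<le> n - Suc m" using i by (auto simp: k_def)
        then show ?thesis using ann[of "e i"] Suc.prems(2) i k e_orth False by auto
      qed (use * in simp)
    qed (use Suc.prems * in auto)
    moreover have "\<one> \<oplus> p \<in> H" "\<one> \<oplus> v \<in> H" using off_diagonal_column_product[OF H k] * by auto
    moreover have "\<one> \<oplus> q \<in> H" using off_diagonal_row_product[OF H k] * by auto
    ultimately show ?case unfolding eq using H(2) by blast
  qed
  from this[of g n] g show ?thesis by auto
qed

end

section \<open>Root subgroups\<close>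

text \<open>\<open>generate\<close> is built with arbitrary products, whereas the arguments below
  peel off one generator at a time. The claim is strengthened to: multiplying by \<open>w\<close> on
  the left preserves \<open>P\<close>, which is itself stable under products.\<close>

lemma (in group) generate_left_induct [consumes 2, case_names one step]:
  assumes S: "S \<subseteq> carrier G" and w: "w \<in> generate G S"
    and inv: "\<And>s. s \<in> S \<Longrightarrow> inv s \<in> S"
    and one: "P \<one>"
    and step: "\<And>s w. \<lbrakk>s \<in> S; w \<in> generate G S; P w\<rbrakk> \<Longrightarrow> P (s \<otimes> w)"
  shows "P w"
proof -
  have "\<forall>v\<in>generate G S. P v \<longrightarrow> P (w \<otimes> v)" using w
  proof (induction rule: generate.induct)
    case one
    then show ?case using generate_in_carrier[OF S] by auto
  next
    case (incl h)
    then show ?case using step by blast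
  next
    case (inv h)
    then show ?case using step assms(3) by blast
  next
    case (eng g h)
    have "g \<otimes> h \<otimes> v = g \<otimes> (h \<otimes> v)" if "v \<in> generate G S" for v
      using that eng generate_in_carrier[OF S] by (simp add: m_assoc)
    then show ?case using eng generate.eng by metis
  qed
  moreover have "w \<otimes> \<one> = w" using generate_in_carrier[OF S w] by simp
  ultimately show ?thesis using one generate.one by metis
qed

lemma (in idempotent_family) mult_eq_zero_if:
  assumes "a \<in> carrier R" "b \<in> carrier R" "\<And>k. k \<in> {1..n} \<Longrightarrow> a \<otimes> e k \<otimes> b = \<zero>"
  shows "a \<otimes> b = \<zero>"
proof -
  have "a \<otimes> b = a \<otimes> (\<Oplus>k\<in>{1..n}. e k \<otimes> b)"
    using finsum_ldistr[of "{1..n}" b e] assms by (simp add: e_sum[simplified] Pi_iff)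
  also have "\<dots> = (\<Oplus>k\<in>{1..n}. a \<otimes> (e k \<otimes> b))"
    using assms by (intro finsum_rdistr) auto
  also have "\<dots> = (\<Oplus>k\<in>{1..n}. \<zero>)"
    using assms by (intro finsum_cong') (auto simp: m_assoc)
  finally show ?thesis by simp
qed

lemma third_index:
  fixes n :: nat
  assumes "n \<ge> 3"
  shows "\<exists>k\<in>{1..n}. k \<noteq> i \<and> k \<noteq> j"
proof -
  have "\<exists>k\<in>{1, 2, 3}. k \<noteq> i \<and> k \<noteq> j" by auto
  then show ?thesis using assms by force
qed

text \<open>Interpreted twice, by the generators of St(R) and by their images in the product of its
  automorphism group with GL(R). Commutator relations take the form \<open>u v = z (v u)\<close>,
  free of inverses. Morita equivalence appears as additive generation of each block by products
  through an arbitrary index \<open>k\<close>.\<close>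

locale steinberg_relations = idempotent_family R n e + W: group W
  for R (structure) and n :: nat and e :: "nat \<Rightarrow> 'a" and W :: "('w, 'k) monoid_scheme" +
  fixes x :: "nat \<Rightarrow> nat \<Rightarrow> 'a \<Rightarrow> 'w"
  assumes x_closed: "\<lbrakk>i \<in> {1..n}; j \<in> {1..n}; i \<noteq> j; a \<in> peirce R e i j\<rbrakk> \<Longrightarrow> x i j a \<in> carrier W"
    and x_add: "\<lbrakk>i \<in> {1..n}; j \<in> {1..n}; i \<noteq> j; a \<in> peirce R e i j; b \<in> peirce R e i j\<rbrakk> \<Longrightarrow>
      x i j a \<otimes>\<^bsub>W\<^esub> x i j b = x i j (a \<oplus> b)"
    and x_comm: "\<lbrakk>i \<in> {1..n}; j \<in> {1..n}; i \<noteq> j; k \<in> {1..n}; l \<in> {1..n}; k \<noteq> l; j \<noteq> k; i \<noteq> l;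
      a \<in> peirce R e i j; b \<in> peirce R e k l\<rbrakk> \<Longrightarrow>
      x i j a \<otimes>\<^bsub>W\<^esub> x k l b = x k l b \<otimes>\<^bsub>W\<^esub> x i j a"
    and x_mult: "\<lbrakk>i \<in> {1..n}; j \<in> {1..n}; i \<noteq> j; k \<in> {1..n}; j \<noteq> k; i \<noteq> k;
      a \<in> peirce R e i j; b \<in> peirce R e j k\<rbrakk> \<Longrightarrow>
      x i j a \<otimes>\<^bsub>W\<^esub> x j k b = x i k (a \<otimes> b) \<otimes>\<^bsub>W\<^esub> (x j k b \<otimes>\<^bsub>W\<^esub> x i j a)"
    and peirce_generated: "\<lbrakk>i \<in> {1..n}; j \<in> {1..n}; k \<in> {1..n}\<rbrakk> \<Longrightarrow>
      peirce R e i j \<subseteq> generate (add_monoid R) {a \<otimes> b | a b. a \<in> peirce R e i k \<and> b \<in> peirce R e k j}"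
begin

abbreviation W_mult (infixl "\<bullet>" 70) where "g \<bullet> h \<equiv> g \<otimes>\<^bsub>W\<^esub> h"

lemma x_zero:
  assumes "i \<in> {1..n}" "j \<in> {1..n}" "i \<noteq> j" shows "x i j \<zero> = \<one>\<^bsub>W\<^esub>"
proof -
  have "x i j \<zero> \<bullet> x i j \<zero> = x i j \<zero>" using x_add[OF assms zero_in_peirce zero_in_peirce] assms by simp
  then show ?thesis using x_closed[OF assms zero_in_peirce] assms by (simp add: W.r_cancel_one)
qed

lemma x_inv:
  assumes "i \<in> {1..n}" "j \<in> {1..n}" "i \<noteq> j" "a \<in> peirce R e i j"
  shows "inv\<^bsub>W\<^esub> x i j a = x i j (\<ominus> a)"
proof (rule W.inv_equality)
  have a: "\<ominus> a \<in> peirce R e i j" "a \<in> carrier R" using peirce_uminus peirceD assms by blast+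
  show "x i j (\<ominus> a) \<bullet> x i j a = \<one>\<^bsub>W\<^esub>"
    using x_add[OF assms(1-3) a(1) assms(4)] x_zero assms a by (simp add: l_neg)
  show "x i j a \<in> carrier W" "x i j (\<ominus> a) \<in> carrier W" using x_closed assms a by blast+
qed

text \<open>The products \<open>b \<otimes> c\<close> span the block additively, and
  \<open>x i j\<close> is additive. Membership in the block is carried through the induction because
  \<open>x_add\<close> asks for it.\<close>

lemma x_in_subgroup_if_products:
  assumes S: "subgroup S W" and ij: "i \<in> {1..n}" "j \<in> {1..n}" "k \<in> {1..n}" "i \<noteq> j"
    and a: "a \<in> peirce R e i j"
    and S_prod: "\<And>b c. b \<in> peirce R e i k \<Longrightarrow> c \<in> peirce R e k j \<Longrightarrow> x i j (b \<otimes> c) \<in> S"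
  shows "x i j a \<in> S"
proof -
  have "a \<in> generate (add_monoid R) {b \<otimes> c | b c. b \<in> peirce R e i k \<and> c \<in> peirce R e k j}"
    using peirce_generated[OF ij(1-3)] a by blast
  then have "a \<in> peirce R e i j \<and> x i j a \<in> S"
  proof (induction rule: generate.induct)
    case one
    then show ?case using x_zero[of i j] subgroup.one_closed[OF S] zero_in_peirce ij by simp
  next
    case (incl h)
    then show ?case using S_prod peirce_mult[OF ring_axioms complete] ij by blast
  next
    case (inv h)
    then obtain b c where h: "h = b \<otimes> c" "b \<in> peirce R e i k" "c \<in> peirce R e k j" by blast
    have "b \<in> carrier R" "c \<in> carrier R" using h ij peirceD by blast+
    then have "inv\<^bsub>add_monoid R\<^esub> h = (\<ominus> b) \<otimes> c" using h(1) by (simp add: a_inv_def[symmetric] l_minus)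
    then show ?case
      using S_prod[OF peirce_uminus[OF ij(1,3) h(2)] h(3)] peirce_mult[OF ring_axioms complete ij(1,3,2)]
        peirce_uminus[OF ij(1,3) h(2)] h(3) by simp
  next
    case (eng g h)
    have "x i j (g \<oplus> h) = x i j g \<bullet> x i j h" using x_add[of i j g h] eng ij by auto
    then show ?case using eng subgroup.m_closed[OF S] peirce_add[OF ring_axioms complete ij(1,2)] by simp
  qed
  then show ?thesis by simp
qed

text \<open>The relation (St3) writes \<open>x i j (b \<otimes> c)\<close> as a commutator of two
  elements of \<open>S\<close>. This is perfectness in the form needed later: two root subgroups in
  \<open>S\<close> force a third one into it.\<close>

lemma x_in_subgroup_if_commutators:
  assumes S: "subgroup S W" and ij: "i \<in> {1..n}" "j \<in> {1..n}" "k \<in> {1..n}" "i \<noteq> j" "i \<noteq> k" "j \<noteq> k"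
    and a: "a \<in> peirce R e i j"
    and S_ik: "\<And>b. b \<in> peirce R e i k \<Longrightarrow> x i k b \<in> S" and S_kj: "\<And>c. c \<in> peirce R e k j \<Longrightarrow> x k j c \<in> S"
  shows "x i j a \<in> S"
proof (rule x_in_subgroup_if_products[OF S ij(1-4) a])
  fix b c assume b: "b \<in> peirce R e i k" and c: "c \<in> peirce R e k j"
  have p: "b \<otimes> c \<in> peirce R e i j" using peirce_mult[OF ring_axioms complete] ij b c by blast
  have cl: "x i j (b \<otimes> c) \<in> carrier W" "x i k b \<in> carrier W" "x k j c \<in> carrier W"
    using x_closed ij b c p by auto
  have "x i k b \<bullet> x k j c = x i j (b \<otimes> c) \<bullet> (x k j c \<bullet> x i k b)"
    using x_mult[of i k j b c] ij b c by auto
  then have "x i j (b \<otimes> c) = x i k b \<bullet> x k j c \<bullet> inv\<^bsub>W\<^esub> (x k j c \<bullet> x i k b)"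
    using cl by (simp add: W.inv_solve_right)
  also have "\<dots> \<in> S"
    using S_ik[OF b] S_kj[OF c] subgroup.m_closed[OF S] subgroup.m_inv_closed[OF S] by simp
  finally show "x i j (b \<otimes> c) \<in> S" .
qed

end

section \<open>Subgroups attached to sets of roots, and their images in GL(R)\<close>

locale steinberg_family = steinberg_relations R n e W x
  for R (structure) and n and e :: "nat \<Rightarrow> 'a" and W :: "('w, 'k) monoid_scheme" and x +
  fixes \<delta> :: "'a \<Rightarrow> 'w" and \<pi> :: "'w \<Rightarrow> 'a"
  assumes \<delta>_hom: "\<delta> \<in> hom (diagonal_group R n e) W"
    and \<delta>_x: "\<lbrakk>h \<in> Diag; i \<in> {1..n}; j \<in> {1..n}; i \<noteq> j; a \<in> peirce R e i j\<rbrakk> \<Longrightarrow>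
      \<delta> h \<otimes>\<^bsub>W\<^esub> x i j a = x i j (h \<otimes> a \<otimes> inv h) \<otimes>\<^bsub>W\<^esub> \<delta> h"
    and \<pi>_hom: "\<pi> \<in> hom W (GL R)"
    and \<pi>_x: "\<lbrakk>i \<in> {1..n}; j \<in> {1..n}; i \<noteq> j; a \<in> peirce R e i j\<rbrakk> \<Longrightarrow> \<pi> (x i j a) = \<one> \<oplus> a"
    and \<pi>_\<delta>: "h \<in> Diag \<Longrightarrow> \<pi> (\<delta> h) = h"
begin

interpretation D: group "diagonal_group R n e" by (rule diagonal_group_is_group)

text \<open>The roots of the system of type A of rank \<open>n - 1\<close>, the pair
  \<open>(i, j)\<close> standing for the difference of two coordinate vectors; composing pairs is
  adding roots.\<close>

definition root_pairs :: "(nat \<times> nat) set" where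
  "root_pairs = {(i, j). i \<in> {1..n} \<and> j \<in> {1..n} \<and> i \<noteq> j}"

definition root_elements :: "(nat \<times> nat) set \<Rightarrow> 'w set" where
  "root_elements \<Phi> = {x i j a | i j a. (i, j) \<in> \<Phi> \<and> a \<in> peirce R e i j}"

definition U :: "(nat \<times> nat) set \<Rightarrow> 'w set" where
  "U \<Phi> = generate W (root_elements \<Phi>)"

lemma rootsD: "(i, j) \<in> root_pairs \<Longrightarrow> i \<in> {1..n} \<and> j \<in> {1..n} \<and> i \<noteq> j"
  by (simp add: root_pairs_def)

lemma \<pi>_closed: "w \<in> carrier W \<Longrightarrow> \<pi> w \<in> Units R"
  using \<pi>_hom by (auto simp: hom_def units_of_carrier)

lemma \<pi>_closed': "w \<in> carrier W \<Longrightarrow> \<pi> w \<in> carrier R"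
  using \<pi>_closed by (simp add: Units_closed)

lemma \<pi>_mult: "v \<in> carrier W \<Longrightarrow> w \<in> carrier W \<Longrightarrow> \<pi> (v \<bullet> w) = \<pi> v \<otimes> \<pi> w"
  using \<pi>_hom by (auto simp: hom_def units_of_mult)

lemma \<pi>_one: "\<pi> \<one>\<^bsub>W\<^esub> = \<one>"
  using hom_one[OF \<pi>_hom W.is_group units_group] by (simp add: units_of_one)

lemma \<delta>_closed: "h \<in> Diag \<Longrightarrow> \<delta> h \<in> carrier W"
  using \<delta>_hom by (auto simp: hom_def)

lemma \<delta>_mult: "\<lbrakk>g \<in> Diag; h \<in> Diag\<rbrakk> \<Longrightarrow>
    \<delta> (g \<otimes> h) = \<delta> g \<bullet> \<delta> h"
  using \<delta>_hom by (auto simp: hom_def diagonal_group_simps)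

lemma diagonal_mult_closed: "\<lbrakk>g \<in> Diag; h \<in> Diag\<rbrakk> \<Longrightarrow>
    g \<otimes> h \<in> Diag"
  using D.m_closed[of g h] by (simp add: diagonal_group_simps)

lemma one_diagonal: "\<one> \<in> Diag"
  by (rule diagonal_groupI) auto

lemma \<delta>_one: "\<delta> \<one> = \<one>\<^bsub>W\<^esub>"
  using hom_one[OF \<delta>_hom diagonal_group_is_group W.is_group] one_diagonal
  by (simp add: diagonal_group_simps)

lemma \<delta>_inv: "h \<in> Diag \<Longrightarrow> inv\<^bsub>W\<^esub> \<delta> h = \<delta> (inv h)"
  using group_hom.hom_inv[OF group_hom.intro[OF diagonal_group_is_group W.is_group
      group_hom_axioms.intro[OF \<delta>_hom]], of h]
    diagonal_group_simps[of h] by simp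

lemma root_elements_closed: "\<Phi> \<subseteq> root_pairs \<Longrightarrow> root_elements \<Phi> \<subseteq> carrier W"
  by (auto simp: root_elements_def root_pairs_def intro!: x_closed)

lemma root_elements_inv: "\<Phi> \<subseteq> root_pairs \<Longrightarrow> s \<in> root_elements \<Phi> \<Longrightarrow> inv\<^bsub>W\<^esub> s \<in> root_elements \<Phi>"
proof -
  assume \<Phi>: "\<Phi> \<subseteq> root_pairs" and "s \<in> root_elements \<Phi>"
  then obtain i j a where s: "s = x i j a" "(i, j) \<in> \<Phi>" "a \<in> peirce R e i j" by (auto simp: root_elements_def)
  have ij: "i \<in> {1..n}" "j \<in> {1..n}" "i \<noteq> j" using s \<Phi> by (auto simp: root_pairs_def)
  show ?thesis unfolding s(1) x_inv[OF ij s(3)] using s(2) peirce_uminus[OF ij(1,2) s(3)]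
    by (auto simp: root_elements_def)
qed

lemma U_subgroup: "\<Phi> \<subseteq> root_pairs \<Longrightarrow> subgroup (U \<Phi>) W"
  unfolding U_def by (rule W.generate_is_subgroup[OF root_elements_closed])

lemma U_closed: "\<Phi> \<subseteq> root_pairs \<Longrightarrow> w \<in> U \<Phi> \<Longrightarrow> w \<in> carrier W"
  using U_subgroup subgroup.mem_carrier by metis

lemma U_mult: "v \<in> U \<Phi> \<Longrightarrow> w \<in> U \<Phi> \<Longrightarrow> v \<bullet> w \<in> U \<Phi>"
  unfolding U_def by (rule generate.eng)

lemma U_one: "\<one>\<^bsub>W\<^esub> \<in> U \<Phi>"
  unfolding U_def by (rule generate.one)

lemma U_inv: "\<Phi> \<subseteq> root_pairs \<Longrightarrow> w \<in> U \<Phi> \<Longrightarrow> inv\<^bsub>W\<^esub> w \<in> U \<Phi>"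
  using U_subgroup subgroup.m_inv_closed by metis

lemma x_in_U: "(i, j) \<in> \<Phi> \<Longrightarrow> a \<in> peirce R e i j \<Longrightarrow> x i j a \<in> U \<Phi>"
  unfolding U_def by (rule generate.incl) (auto simp: root_elements_def)

lemma U_mono: "\<Phi> \<subseteq> \<Psi> \<Longrightarrow> U \<Phi> \<subseteq> U \<Psi>"
  unfolding U_def by (rule W.mono_generate) (auto simp: root_elements_def)

lemma U_induct [consumes 2, case_names one step]:
  assumes "\<Phi> \<subseteq> root_pairs" "w \<in> U \<Phi>"
    and "P \<one>\<^bsub>W\<^esub>"
    and "\<And>i j a w. \<lbrakk>(i, j) \<in> \<Phi>; i \<in> {1..n}; j \<in> {1..n}; i \<noteq> j; a \<in> peirce R e i j;
      w \<in> U \<Phi>; w \<in> carrier W; P w\<rbrakk> \<Longrightarrow> P (x i j a \<bullet> w)"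
  shows "P w"
proof (rule W.generate_left_induct[OF root_elements_closed[OF assms(1)] assms(2)[unfolded U_def]])
  fix s w assume "s \<in> root_elements \<Phi>" "w \<in> generate W (root_elements \<Phi>)" "P w"
  then show "P (s \<bullet> w)"
    using assms(4) assms(1) U_closed[OF assms(1)] by (auto simp: root_elements_def root_pairs_def U_def)
qed (use assms root_elements_inv in auto)

text \<open>This is one inclusion only, conjugation by \<open>g\<close> mapping
  \<open>U \<Phi>\<close> into itself; for the other direction it is used at the inverse root
  element, as in \<open>adjoinable_swap\<close>. Without inverses the condition composes
  directly.\<close>

definition normalizes :: "'w \<Rightarrow> (nat \<times> nat) set \<Rightarrow> bool" where
  "normalizes g \<Phi> \<longleftrightarrow> (\<forall>w\<in>U \<Phi>. \<exists>w'\<in>U \<Phi>. g \<bullet> w = w' \<bullet> g)"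

text \<open>A root of \<open>\<Phi>\<close> that composes with \<open>(p, q)\<close> has the form
  \<open>(q, j)\<close> or \<open>(i, p)\<close>, and \<open>l\<close> and \<open>r\<close> put the
  resulting root \<open>(p, j)\<close> or \<open>(i, q)\<close> into \<open>\<Phi>\<close>. The
  opposite root is excluded because no commutator relation governs it.\<close>

lemma x_normalizes:
  assumes \<Phi>: "\<Phi> \<subseteq> root_pairs" and pq: "(p, q) \<in> root_pairs" "(q, p) \<notin> \<Phi>" and b: "b \<in> peirce R e p q"
    and l: "\<And>j. (q, j) \<in> \<Phi> \<Longrightarrow> (p, j) \<in> \<Phi>" and r: "\<And>i. (i, p) \<in> \<Phi> \<Longrightarrow> (i, q) \<in> \<Phi>"
  shows "normalizes (x p q b) \<Phi>"
  unfolding normalizes_def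
proof
  fix w assume "w \<in> U \<Phi>"
  have pq': "p \<in> {1..n}" "q \<in> {1..n}" "p \<noteq> q" using rootsD[OF pq(1)] by auto
  have xb: "x p q b \<in> carrier W" using x_closed pq' b by blast
  show "\<exists>w'\<in>U \<Phi>. x p q b \<bullet> w = w' \<bullet> x p q b"
    using \<Phi> \<open>w \<in> U \<Phi>\<close>
  proof (induction rule: U_induct)
    case one
    show ?case using xb by (intro bexI[OF _ U_one]) simp
  next
    case (step i j a w)
    obtain w' where w': "w' \<in> U \<Phi>" "x p q b \<bullet> w = w' \<bullet> x p q b" using step by blast
    have w'c: "w' \<in> carrier W" using U_closed[OF \<Phi> w'(1)] .
    have xa: "x i j a \<in> carrier W" using x_closed step by blast
    have "\<exists>u\<in>U \<Phi>. x p q b \<bullet> x i j a = u \<bullet> x p q b"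
    proof -
      consider "i = q" | "j = p" "i \<noteq> q" | "i \<noteq> q" "j \<noteq> p" by blast
      then show ?thesis
      proof cases
        case 1
        have "j \<noteq> p" using step(1) pq(2) 1 by auto
        then have "x p q b \<bullet> x q j a = x p j (b \<otimes> a) \<bullet> (x q j a \<bullet> x p q b)"
          using x_mult[of p q j b a] pq' b step 1 by auto
        moreover have ba: "b \<otimes> a \<in> peirce R e p j"
          using peirce_mult[OF ring_axioms complete] pq' step b 1 by blast
        moreover have "x p j (b \<otimes> a) \<in> U \<Phi>" "x q j a \<in> U \<Phi>" using x_in_U l ba step 1 by auto
        moreover have "x p j (b \<otimes> a) \<in> carrier W" using U_closed[OF \<Phi>] calculation by blast
        ultimately show ?thesis using xa xb 1
          by (intro bexI[of _ "x p j (b \<otimes> a) \<bullet> x q j a"]) (auto simp: W.m_assoc U_mult)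
      next
        case 2
        then have eq: "x i p a \<bullet> x p q b = x i q (a \<otimes> b) \<bullet> (x p q b \<bullet> x i p a)"
          using x_mult[of i p q a b] pq' b step by auto
        have ab: "a \<otimes> b \<in> peirce R e i q"
          using peirce_mult[OF ring_axioms complete] pq' step b 2 by blast
        then have u: "x i q (a \<otimes> b) \<in> U \<Phi>" "x i p a \<in> U \<Phi>" using x_in_U r step 2 by auto
        note uc = u[THEN U_closed[OF \<Phi>]]
        have "x p q b \<bullet> x i p a = inv\<^bsub>W\<^esub> x i q (a \<otimes> b) \<bullet> (x i p a \<bullet> x p q b)"
          unfolding eq using uc xb by (simp add: W.m_assoc[symmetric])
        then show ?thesis using u uc xb U_inv[OF \<Phi> u(1)] 2
          by (intro bexI[of _ "inv\<^bsub>W\<^esub> x i q (a \<otimes> b) \<bullet> x i p a"]) (auto simp: W.m_assoc U_mult)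
      next
        case 3
        then show ?thesis using x_comm[of p q i j b a] pq' b step x_in_U by auto
      qed
    qed
    then obtain u where u: "u \<in> U \<Phi>" "x p q b \<bullet> x i j a = u \<bullet> x p q b" by blast
    have uc: "u \<in> carrier W" using U_closed[OF \<Phi> u(1)] .
    have "x p q b \<bullet> (x i j a \<bullet> w) = (x p q b \<bullet> x i j a) \<bullet> w"
      using xa xb step by (simp add: W.m_assoc)
    also have "\<dots> = u \<bullet> (x p q b \<bullet> w)" unfolding u(2) using uc xb step by (simp add: W.m_assoc)
    also have "\<dots> = (u \<bullet> w') \<bullet> x p q b" unfolding w'(2) using uc xb w'c by (simp add: W.m_assoc)
    finally show ?case using U_mult[OF u(1) w'(1)] by blast
  qed
qed

lemma \<delta>_normalizes:
  assumes \<Phi>: "\<Phi> \<subseteq> root_pairs" and h: "h \<in> Diag"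
  shows "normalizes (\<delta> h) \<Phi>"
  unfolding normalizes_def
proof
  fix w assume "w \<in> U \<Phi>"
  have hc: "\<delta> h \<in> carrier W" using \<delta>_closed h .
  show "\<exists>w'\<in>U \<Phi>. \<delta> h \<bullet> w = w' \<bullet> \<delta> h"
    using \<Phi> \<open>w \<in> U \<Phi>\<close>
  proof (induction rule: U_induct)
    case one
    show ?case using hc by (intro bexI[OF _ U_one]) simp
  next
    case (step i j a w)
    obtain w' where w': "w' \<in> U \<Phi>" "\<delta> h \<bullet> w = w' \<bullet> \<delta> h" using step by blast
    have w'c: "w' \<in> carrier W" using U_closed[OF \<Phi> w'(1)] .
    have xa: "x i j a \<in> carrier W" using x_closed step by blast
    let ?u = "x i j (h \<otimes> a \<otimes> inv h)"
    have u: "?u \<in> U \<Phi>"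
      using x_in_U[OF step(1)] diagonal_conj[OF ring_axioms complete h step(2,3,5)] by blast
    have uc: "?u \<in> carrier W" using U_closed[OF \<Phi> u] .
    have "\<delta> h \<bullet> (x i j a \<bullet> w) = (\<delta> h \<bullet> x i j a) \<bullet> w"
      using xa hc step by (simp add: W.m_assoc)
    also have "\<dots> = ?u \<bullet> (\<delta> h \<bullet> w)" unfolding \<delta>_x[OF h step(2-5)] using uc hc step by (simp add: W.m_assoc)
    also have "\<dots> = (?u \<bullet> w') \<bullet> \<delta> h" unfolding w'(2) using uc hc w'c by (simp add: W.m_assoc)
    finally show ?case using U_mult[OF u w'(1)] by blast
  qed
qed

lemma normalizesE:
  assumes "normalizes g \<Phi>" "w \<in> U \<Phi>"
  obtains w' where "w' \<in> U \<Phi>" "g \<bullet> w = w' \<bullet> g"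
  using assms unfolding normalizes_def by blast

text \<open>Under these conditions, the root subgroup of \<open>(p, q)\<close> normalizes \<open>U \<Phi>\<close>.\<close>

definition adjoinable :: "nat \<Rightarrow> nat \<Rightarrow> (nat \<times> nat) set \<Rightarrow> bool" where
  "adjoinable p q \<Phi> \<longleftrightarrow> \<Phi> \<subseteq> root_pairs \<and> (p, q) \<in> root_pairs \<and> (q, p) \<notin> \<Phi> \<and>
     (\<forall>j. (q, j) \<in> \<Phi> \<longrightarrow> (p, j) \<in> \<Phi>) \<and> (\<forall>i. (i, p) \<in> \<Phi> \<longrightarrow> (i, q) \<in> \<Phi>)"

lemma adjoinableD:
  assumes "adjoinable p q \<Phi>"
  shows "\<Phi> \<subseteq> root_pairs" "p \<in> {1..n}" "q \<in> {1..n}" "p \<noteq> q" "b \<in> peirce R e p q \<Longrightarrow> normalizes (x p q b) \<Phi>"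
  using assms x_normalizes[of \<Phi> p q b] rootsD[of p q] unfolding adjoinable_def by blast+

lemma adjoinable_swap:
  assumes pq: "adjoinable p q \<Phi>" and b: "b \<in> peirce R e p q" and w: "w \<in> U \<Phi>"
  obtains w' where "w' \<in> U \<Phi>" "w \<bullet> x p q b = x p q b \<bullet> w'"
proof -
  note D = adjoinableD[OF pq]
  have b': "\<ominus> b \<in> peirce R e p q" using peirce_uminus D b by blast
  obtain w' where w': "w' \<in> U \<Phi>" "x p q (\<ominus> b) \<bullet> w = w' \<bullet> x p q (\<ominus> b)"
    using normalizesE[OF D(5)[OF b'] w] .
  have c: "x p q b \<in> carrier W" "w \<in> carrier W" "w' \<in> carrier W" using x_closed D b U_closed w w' by blast+
  have "w \<bullet> x p q b = x p q b \<bullet> (inv\<^bsub>W\<^esub> x p q b \<bullet> w) \<bullet> x p q b"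
    using c by (simp add: W.m_assoc[symmetric])
  also have "inv\<^bsub>W\<^esub> x p q b \<bullet> w = w' \<bullet> inv\<^bsub>W\<^esub> x p q b"
    using w'(2) x_inv[OF D(2-4) b] by simp
  also have "x p q b \<bullet> (w' \<bullet> inv\<^bsub>W\<^esub> x p q b) \<bullet> x p q b = x p q b \<bullet> w'"
    using c by (simp add: W.m_assoc)
  finally have "w \<bullet> x p q b = x p q b \<bullet> w'" .
  then show ?thesis using that w' by blast
qed

text \<open>Elements of \<open>U \<Phi>\<close> can be moved to the right past the root subgroup of
  \<open>(p, q)\<close> by \<open>adjoinable_swap\<close>, so the latter can be collected on the
  left.\<close>

lemma U_insertE:
  assumes pq: "adjoinable p q \<Phi>" and w: "w \<in> U (insert (p, q) \<Phi>)"
  obtains b w' where "b \<in> peirce R e p q" "w' \<in> U \<Phi>" "w = x p q b \<bullet> w'"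
proof -
  note D = adjoinableD[OF pq]
  have \<Phi>: "insert (p, q) \<Phi> \<subseteq> root_pairs" using pq by (auto simp: adjoinable_def)
  have "\<exists>b\<in>peirce R e p q. \<exists>w'\<in>U \<Phi>. w = x p q b \<bullet> w'" using \<Phi> w
  proof (induction rule: U_induct)
    case one
    show ?case using zero_in_peirce[OF D(2,3)] U_one x_zero[OF D(2-4)]
      by (intro bexI[of _ \<zero>] bexI[of _ "\<one>\<^bsub>W\<^esub>"]) auto
  next
    case (step i j a w)
    obtain b w' where b: "b \<in> peirce R e p q" and w': "w' \<in> U \<Phi>" and w: "w = x p q b \<bullet> w'" using step by blast
    have c: "x p q b \<in> carrier W" "w' \<in> carrier W" "x i j a \<in> carrier W"
      using x_closed D b U_closed[OF D(1)] w' step by blast+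
    show ?case
    proof (cases "(i, j) = (p, q)")
      case True
      then have "x i j a \<bullet> w = x p q (a \<oplus> b) \<bullet> w'"
        using w c b step x_add[of p q a b] by (simp add: W.m_assoc[symmetric])
      moreover have "a \<oplus> b \<in> peirce R e p q"
        using peirce_add[OF ring_axioms complete D(2,3)] step b True by blast
      ultimately show ?thesis using w' by blast
    next
      case False
      then have "x i j a \<in> U \<Phi>" using step x_in_U by blast
      then obtain u where u: "u \<in> U \<Phi>" "x i j a \<bullet> x p q b = x p q b \<bullet> u"
        using adjoinable_swap[OF pq b] by blast
      have uc: "u \<in> carrier W" using u U_closed[OF D(1)] by blast
      have "x i j a \<bullet> w = (x i j a \<bullet> x p q b) \<bullet> w'" unfolding w using c by (simp add: W.m_assoc)
      also have "\<dots> = x p q b \<bullet> (u \<bullet> w')" unfolding u(2) using c uc by (simp add: W.m_assoc)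
      finally show ?thesis using U_mult[OF u(1) w'] b by blast
    qed
  qed
  then show ?thesis using that by blast
qed

text \<open>As \<open>(i, i)\<close> is never a root, a closed set contains no two opposite roots:
  it is a strict partial order on the indices.\<close>

definition closed_roots :: "(nat \<times> nat) set \<Rightarrow> bool" where
  "closed_roots \<Phi> \<longleftrightarrow> \<Phi> \<subseteq> root_pairs \<and> (\<forall>i j k. (i, j) \<in> \<Phi> \<and> (j, k) \<in> \<Phi> \<longrightarrow> (i, k) \<in> \<Phi>)"

text \<open>Images of \<open>U \<Phi>\<close> are unipotent with support in \<open>\<Phi>\<close>.
  Multiplying by \<open>\<one> \<oplus> a\<close> with \<open>a\<close> in the block
  \<open>(p, q)\<close> adds a multiple of row \<open>q\<close> to row \<open>p\<close>; if
  \<open>(p, j)\<close> is not in \<open>\<Phi>\<close>, then closedness excludes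
  \<open>(q, j)\<close> and also \<open>q = j\<close>, so the added block is zero.\<close>

lemma \<pi>_U_blocks:
  assumes \<Phi>: "closed_roots \<Phi>" and w: "w \<in> U \<Phi>" and ij: "i \<in> {1..n}" "j \<in> {1..n}" "(i, j) \<notin> \<Phi>"
  shows "e i \<otimes> \<pi> w \<otimes> e j = (if i = j then e i else \<zero>)"
proof -
  have \<Phi>': "\<Phi> \<subseteq> root_pairs" using \<Phi> by (simp add: closed_roots_def)
  from \<Phi>' w ij show ?thesis
  proof (induction arbitrary: i j rule: U_induct)
    case one
    then show ?case using e_orth by (simp add: \<pi>_one)
  next
    case (step p q a w)
    have c: "\<pi> w \<in> carrier R" "a \<in> carrier R" using \<pi>_closed' step peirceD by blast+
    have "\<pi> (x p q a \<bullet> w) = (\<one> \<oplus> a) \<otimes> \<pi> w"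
      using step by (simp add: \<pi>_mult x_closed \<pi>_x)
    then have eq: "e i \<otimes> \<pi> (x p q a \<bullet> w) \<otimes> e j = e i \<otimes> \<pi> w \<otimes> e j \<oplus> e i \<otimes> a \<otimes> \<pi> w \<otimes> e j"
      using c step.prems by (simp add: l_distr r_distr m_assoc)
    have "e i \<otimes> a \<otimes> \<pi> w \<otimes> e j = \<zero>"
    proof (cases "i = p")
      case True
      have "e i \<otimes> a \<otimes> \<pi> w \<otimes> e j = a \<otimes> e q \<otimes> \<pi> w \<otimes> e j" using True step peirceD[of p q a] by simp
      also have "\<dots> = a \<otimes> (e q \<otimes> \<pi> w \<otimes> e j)" using c step by (simp add: m_assoc)
      also have "e q \<otimes> \<pi> w \<otimes> e j = \<zero>"
      proof -
        have "q \<noteq> j" using step True by auto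
        moreover have "(q, j) \<notin> \<Phi>" using \<Phi> step True unfolding closed_roots_def by blast
        ultimately show ?thesis using step.IH[OF step(3) step.prems(2)] by simp
      qed
      finally show ?thesis using c by simp
    next
      case False
      then show ?thesis using c step peirce_zero(1)[of p q a i] by simp
    qed
    then show ?case unfolding eq using step.IH[OF step.prems] step.prems by simp
  qed
qed

definition faithful :: "(nat \<times> nat) set \<Rightarrow> bool" where
  "faithful \<Phi> \<longleftrightarrow> (\<forall>w\<in>U \<Phi>. \<pi> w = \<one> \<longrightarrow> w = \<one>\<^bsub>W\<^esub>)"

lemma faithful_empty: "faithful {}"
  by (simp add: faithful_def U_def root_elements_def W.generate_empty)

text \<open>In the form \<open>x p q b \<bullet> w'\<close> the image has block \<open>b\<close> at
  \<open>(p, q)\<close>, because the image of \<open>w'\<close> has \<open>\<zero>\<close> there and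
  \<open>e q\<close> at \<open>(q, q)\<close>. A trivial image thus forces
  \<open>b = \<zero>\<close> and reduces the claim to \<open>w'\<close>.\<close>

lemma faithful_insert:
  assumes adj: "adjoinable p q \<Phi>" and \<Phi>: "closed_roots \<Phi>" "(p, q) \<notin> \<Phi>" "faithful \<Phi>"
  shows "faithful (insert (p, q) \<Phi>)"
  unfolding faithful_def
proof (intro ballI impI)
  fix w assume "w \<in> U (insert (p, q) \<Phi>)" and w1: "\<pi> w = \<one>"
  then obtain b w' where b: "b \<in> peirce R e p q" and w': "w' \<in> U \<Phi>" and w: "w = x p q b \<bullet> w'"
    using U_insertE[OF adj] by blast
  note pqD = adjoinableD(2-4)[OF adj]
  have w'c: "w' \<in> carrier W" using U_closed[OF adjoinableD(1)[OF adj] w'] .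
  have c: "b \<in> carrier R" "\<pi> w' \<in> carrier R" using peirceD b pqD \<pi>_closed' w'c by blast+
  have eqw: "\<pi> w = (\<one> \<oplus> b) \<otimes> \<pi> w'" using w w'c b pqD by (simp add: \<pi>_mult x_closed \<pi>_x)
  have bD: "e p \<otimes> b = b" "b \<otimes> e q = b" using peirceD[of p q b] b pqD by auto
  have qq: "(q, q) \<notin> \<Phi>" using adjoinableD(1)[OF adj] by (auto simp: root_pairs_def)
  have "e p \<otimes> \<pi> w \<otimes> e q = e p \<otimes> \<pi> w' \<otimes> e q \<oplus> (e p \<otimes> b) \<otimes> \<pi> w' \<otimes> e q"
    unfolding eqw using c pqD by (simp add: l_distr r_distr m_assoc)
  also have "(e p \<otimes> b) \<otimes> \<pi> w' \<otimes> e q = (b \<otimes> e q) \<otimes> \<pi> w' \<otimes> e q"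
    unfolding bD ..
  also have "\<dots> = b \<otimes> (e q \<otimes> \<pi> w' \<otimes> e q)" using c pqD by (simp add: m_assoc)
  also have "e p \<otimes> \<pi> w' \<otimes> e q \<oplus> \<dots> = b"
    using \<pi>_U_blocks[OF \<Phi>(1) w' pqD(1,2) \<Phi>(2)] \<pi>_U_blocks[OF \<Phi>(1) w' pqD(2,2) qq] pqD c bD by simp
  finally have "b = \<zero>" using w1 pqD e_orth[of p q] by simp
  then have "w = w'" using w x_zero pqD w'c by simp
  then show "w = \<one>\<^bsub>W\<^esub>" using \<Phi>(3) w' w1 by (auto simp: faithful_def)
qed

text \<open>The roots that are positive for the order given by \<open>r\<close>, in the order in which they are removed
  one by one in \<open>U_initial_roots_faithful\<close>: by columns, and by rows inside a column.\<close>

definition initial_roots :: "(nat \<Rightarrow> nat) \<Rightarrow> nat \<Rightarrow> nat \<Rightarrow> (nat \<times> nat) set" where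
  "initial_roots r k m = {(i, j) \<in> root_pairs. r i < r j \<and> (r j < k \<or> r j = k \<and> r i < m)}"

lemma closed_initial_roots: "closed_roots (initial_roots r k m)"
  by (auto simp: closed_roots_def initial_roots_def root_pairs_def)

lemma U_initial_roots_faithful:
  assumes r: "inj_on r {1..n}"
  shows "faithful (initial_roots r k m)"
proof (induction k arbitrary: m)
  have step: "faithful (initial_roots r k m)" if zero: "faithful (initial_roots r k 0)" for k m
  proof (induction m)
    case 0
    then show ?case by (rule zero)
  next
    case (Suc m)
    let ?\<Phi> = "initial_roots r k m"
    show ?case
    \<comment> \<open>By injectivity of \<open>r\<close>, raising \<open>m\<close> by one adds at
      most one root, the one in row \<open>m\<close> and column \<open>k\<close>.\<close>
    proof (cases "\<exists>(p, q)\<in>root_pairs. r p = m \<and> r q = k \<and> m < k")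
      case False
      then have "initial_roots r k (Suc m) = ?\<Phi>"
        by (auto simp: initial_roots_def less_Suc_eq)
      then show ?thesis using Suc by simp
    next
      case True
      then obtain p q where pq: "(p, q) \<in> root_pairs" "r p = m" "r q = k" "m < k" by blast
      note pqD = rootsD[OF pq(1)]
      have "initial_roots r k (Suc m) = insert (p, q) ?\<Phi>"
        using pq pqD inj_onD[OF r] by (auto simp: initial_roots_def less_Suc_eq root_pairs_def)
      moreover have "adjoinable p q ?\<Phi>"
        using pq pqD by (auto simp: adjoinable_def initial_roots_def root_pairs_def)
      moreover have "(p, q) \<notin> ?\<Phi>" using pq by (auto simp: initial_roots_def)
      ultimately show ?thesis using faithful_insert[OF _ closed_initial_roots _ Suc] by simp
    qed
  qed
  {
    case 0
    have "initial_roots r 0 0 = {}" by (auto simp: initial_roots_def)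
    then show ?case using step[of 0] faithful_empty by simp
  next
    case (Suc k)
    \<comment> \<open>Column \<open>k\<close> is complete once the row bound is \<open>k\<close>,
      since its roots satisfy \<open>r i < r j = k\<close>.\<close>
    have "initial_roots r (Suc k) 0 = initial_roots r k k" by (auto simp: initial_roots_def)
    then show ?case using step[of "Suc k"] Suc by simp
  }
qed

definition positive :: "(nat \<times> nat) set" where "positive = {(i, j) \<in> root_pairs. i < j}"
definition negative :: "(nat \<times> nat) set" where "negative = {(i, j) \<in> root_pairs. j < i}"

lemma positive_roots: "positive \<subseteq> root_pairs" and negative_roots: "negative \<subseteq> root_pairs"
  by (auto simp: positive_def negative_def)

lemma closed_pos: "closed_roots positive" and closed_neg: "closed_roots negative"
  by (auto simp: closed_roots_def positive_def negative_def root_pairs_def)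

lemma faithful_positive: "faithful positive"
proof -
  have "positive = initial_roots (\<lambda>i. i) (Suc n) 0" by (auto simp: positive_def initial_roots_def root_pairs_def)
  then show ?thesis using U_initial_roots_faithful[of "\<lambda>i. i"] by simp
qed

lemma faithful_negative: "faithful negative"
proof -
  \<comment> \<open>Reversing the indices turns negative roots into positive ones; the truncated
    subtraction is injective because no index exceeds \<open>n\<close>.\<close>
  have "negative = initial_roots (\<lambda>i. n - i) (Suc n) 0" by (auto simp: negative_def initial_roots_def root_pairs_def)
  moreover have "inj_on (\<lambda>i. n - i) {1..n}" by (auto simp: inj_on_def)
  ultimately show ?thesis using U_initial_roots_faithful[of "\<lambda>i. n - i"] by simp
qed

text \<open>If such a product is \<open>\<one>\<close>, then its lower unitriangular factor is upper triangular, hence \<open>\<one>\<close>.\<close>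

lemma gauss_product_faithful:
  assumes u: "u \<in> U positive" and m: "m \<in> U negative" and v: "v \<in> U positive" and h: "h \<in> Diag"
    and eq: "\<pi> (u \<bullet> m \<bullet> v \<bullet> \<delta> h) = \<one>"
  shows "u \<bullet> m \<bullet> v \<bullet> \<delta> h = \<one>\<^bsub>W\<^esub>"
proof -
  note c = U_closed[OF positive_roots u] U_closed[OF negative_roots m] U_closed[OF positive_roots v]
  note hD = diagonal_groupD[OF h]
  have hc: "h \<in> carrier R" "inv h \<in> carrier R" using hD(1) by (auto simp: Units_closed)
  have ui: "inv\<^bsub>W\<^esub> u \<in> U positive" "inv\<^bsub>W\<^esub> v \<in> U positive" using U_inv[OF positive_roots] u v by auto
  note uic = ui[THEN U_closed[OF positive_roots]]
  note pc = c[THEN \<pi>_closed'] uic[THEN \<pi>_closed']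
  have one: "\<pi> u \<otimes> \<pi> (inv\<^bsub>W\<^esub> u) = \<one>" "\<pi> (inv\<^bsub>W\<^esub> u) \<otimes> \<pi> u = \<one>"
    "\<pi> v \<otimes> \<pi> (inv\<^bsub>W\<^esub> v) = \<one>" "\<pi> (inv\<^bsub>W\<^esub> v) \<otimes> \<pi> v = \<one>"
    using c uic by (simp_all add: \<pi>_mult[symmetric] \<pi>_one)
  have eq': "\<pi> u \<otimes> \<pi> m \<otimes> \<pi> v \<otimes> h = \<one>" using eq c \<delta>_closed[OF h] by (simp add: \<pi>_mult \<pi>_\<delta>[OF h])
  have "\<pi> m = \<pi> (inv\<^bsub>W\<^esub> u) \<otimes> (\<pi> u \<otimes> \<pi> m \<otimes> \<pi> v \<otimes> h) \<otimes> inv h \<otimes> \<pi> (inv\<^bsub>W\<^esub> v)"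
  proof -
    have "\<pi> (inv\<^bsub>W\<^esub> u) \<otimes> (\<pi> u \<otimes> \<pi> m \<otimes> \<pi> v \<otimes> h) \<otimes> inv h \<otimes> \<pi> (inv\<^bsub>W\<^esub> v) =
        (\<pi> (inv\<^bsub>W\<^esub> u) \<otimes> \<pi> u) \<otimes> \<pi> m \<otimes> (\<pi> v \<otimes> ((h \<otimes> inv h) \<otimes> \<pi> (inv\<^bsub>W\<^esub> v)))"
      using pc hc by (simp add: m_assoc del: Units_r_inv)
    then show ?thesis using one hD pc by simp
  qed
  then have m_eq: "\<pi> m = \<pi> (inv\<^bsub>W\<^esub> u) \<otimes> inv h \<otimes> \<pi> (inv\<^bsub>W\<^esub> v)" unfolding eq' using pc hc by simp
  have upper: "e i \<otimes> \<pi> w \<otimes> e j = \<zero>" if "w \<in> U positive" "i \<in> {1..n}" "j \<in> {1..n}" "j < i" for w i j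
    using \<pi>_U_blocks[OF closed_pos that(1-3)] that by (auto simp: positive_def)
  have tri: "e i \<otimes> (y \<otimes> z) \<otimes> e j = \<zero>"
    if yz: "y \<in> carrier R" "z \<in> carrier R" "i \<in> {1..n}" "j \<in> {1..n}" "j < i"
      "\<And>i j. i \<in> {1..n} \<Longrightarrow> j \<in> {1..n} \<Longrightarrow> j < i \<Longrightarrow> e i \<otimes> y \<otimes> e j = \<zero>"
      "\<And>i j. i \<in> {1..n} \<Longrightarrow> j \<in> {1..n} \<Longrightarrow> j < i \<Longrightarrow> e i \<otimes> z \<otimes> e j = \<zero>" for y z i j
  proof -
    have "e i \<otimes> y \<otimes> e k \<otimes> (e k \<otimes> z \<otimes> e j) = \<zero>" if "k \<in> {1..n}" for k
      using yz that by (cases "k < i") auto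
    then have k0: "(e i \<otimes> y) \<otimes> e k \<otimes> (z \<otimes> e j) = \<zero>" if "k \<in> {1..n}" for k
      using yz(1-4) that by (simp add: m_assoc)
    have "(e i \<otimes> y) \<otimes> (z \<otimes> e j) = \<zero>"
      by (rule mult_eq_zero_if[OF _ _ k0]) (use yz(1-4) in simp_all)
    then show ?thesis using yz(1-4) by (simp add: m_assoc)
  qed
  have "\<pi> m = \<one>"
  proof (rule eq_if_blocks_eq)
    fix i j assume ij: "i \<in> {1..n}" "j \<in> {1..n}"
    show "e i \<otimes> \<pi> m \<otimes> e j = e i \<otimes> \<one> \<otimes> e j"
    proof (cases "j < i")
      case True
      have d: "e i \<otimes> inv h \<otimes> e j = \<zero>" if "i \<in> {1..n}" "j \<in> {1..n}" "j < i" for i j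
        using that e_orth[of i j] hc commute_inv[OF hD(1) e_closed hD(2), of i] by (simp add: m_assoc)
      have "e i \<otimes> \<pi> m \<otimes> e j = \<zero>" unfolding m_eq
        by (intro tri m_closed) (use ij True pc hc d upper ui in auto)
      then show ?thesis using True ij e_orth[of i j] by simp
    next
      case False
      then show ?thesis using \<pi>_U_blocks[OF closed_neg m ij] ij e_orth[of i j] by (auto simp: negative_def)
    qed
  qed (use pc in auto)
  then have m1: "m = \<one>\<^bsub>W\<^esub>" using faithful_negative m by (simp add: faithful_def)
  \<comment> \<open>With \<open>m\<close> gone, the image of \<open>u \<bullet> v\<close> is
    \<open>inv h\<close>. It is both upper unitriangular and diagonal, hence \<open>\<one>\<close>,
    and faithfulness applies a second time.\<close>
  have uv: "u \<bullet> v \<in> U positive" using U_mult u v by blast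
  have uvc: "\<pi> (u \<bullet> v) \<in> carrier R" using c by (simp add: \<pi>_closed')
  have "\<pi> (u \<bullet> v) \<otimes> h = \<one>" using eq' c pc hc by (simp add: m1 \<pi>_one \<pi>_mult m_assoc)
  then have "\<pi> (u \<bullet> v) \<otimes> h \<otimes> inv h = inv h" using hc by simp
  then have uvh: "\<pi> (u \<bullet> v) = inv h" using uvc hc hD(1) by (simp add: m_assoc)
  have "\<pi> (u \<bullet> v) = \<one>"
  proof (rule eq_if_blocks_eq)
    fix i j assume ij: "i \<in> {1..n}" "j \<in> {1..n}"
    show "e i \<otimes> \<pi> (u \<bullet> v) \<otimes> e j = e i \<otimes> \<one> \<otimes> e j"
    proof (cases "i < j")
      case True
      have "e i \<otimes> inv h \<otimes> e j = \<zero>"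
        using True ij e_orth[of i j] hc commute_inv[OF hD(1) e_closed hD(2), of i] by (simp add: m_assoc)
      then show ?thesis unfolding uvh using True ij e_orth[of i j] by simp
    next
      case False
      then show ?thesis using \<pi>_U_blocks[OF closed_pos uv ij] ij e_orth[of i j] by (auto simp: positive_def)
    qed
  qed (use uvc in auto)
  then have "u \<bullet> v = \<one>\<^bsub>W\<^esub>" "inv h = \<one>" using faithful_positive uv uvh by (auto simp: faithful_def)
  moreover from this have "h = \<one>" using hD(1) by (metis Units_inv_inv inv_one)
  ultimately show ?thesis using c by (simp add: m1 \<delta>_one)
qed

section \<open>Gauss products and their stability under left multiplication\<close>

definition gauss_products :: "'w set" where
  "gauss_products = {u \<bullet> m \<bullet> v \<bullet> \<delta> h | u m v h.
     u \<in> U positive \<and> m \<in> U negative \<and> v \<in> U positive \<and> h \<in> Diag}"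

definition generated :: "'w set" where
  "generated = generate W (root_elements root_pairs \<union> \<delta> ` Diag)"

lemma gauss_productsI:
  "\<lbrakk>u \<in> U positive; m \<in> U negative; v \<in> U positive; h \<in> Diag\<rbrakk> \<Longrightarrow>
    u \<bullet> m \<bullet> v \<bullet> \<delta> h \<in> gauss_products"
  by (auto simp: gauss_products_def)

lemma gauss_products_closed: "w \<in> gauss_products \<Longrightarrow> w \<in> carrier W"
  using U_closed[OF positive_roots] U_closed[OF negative_roots] \<delta>_closed
  by (auto simp: gauss_products_def)

lemma gauss_products_faithful: "w \<in> gauss_products \<Longrightarrow> \<pi> w = \<one> \<Longrightarrow> w = \<one>\<^bsub>W\<^esub>"
  unfolding gauss_products_def using gauss_product_faithful by blast

lemma mult_\<delta>_gauss_products: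
  assumes h: "h \<in> Diag" and w: "w \<in> gauss_products"
  shows "\<delta> h \<bullet> w \<in> gauss_products"
proof -
  obtain u m v g where w: "w = u \<bullet> m \<bullet> v \<bullet> \<delta> g" and
    *: "u \<in> U positive" "m \<in> U negative" "v \<in> U positive" and g: "g \<in> Diag"
    using assms(2) by (auto simp: gauss_products_def)
  obtain u' where u': "u' \<in> U positive" "\<delta> h \<bullet> u = u' \<bullet> \<delta> h"
    using normalizesE[OF \<delta>_normalizes[OF positive_roots h] *(1)] .
  obtain m' where m': "m' \<in> U negative" "\<delta> h \<bullet> m = m' \<bullet> \<delta> h"
    using normalizesE[OF \<delta>_normalizes[OF negative_roots h] *(2)] .
  obtain v' where v': "v' \<in> U positive" "\<delta> h \<bullet> v = v' \<bullet> \<delta> h"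
    using normalizesE[OF \<delta>_normalizes[OF positive_roots h] *(3)] .
  note c = U_closed[OF positive_roots *(1)] U_closed[OF negative_roots *(2)] U_closed[OF positive_roots *(3)]
    U_closed[OF positive_roots u'(1)] U_closed[OF negative_roots m'(1)] U_closed[OF positive_roots v'(1)]
    \<delta>_closed[OF h] \<delta>_closed[OF g]
  have "\<delta> h \<bullet> w = (\<delta> h \<bullet> u) \<bullet> m \<bullet> v \<bullet> \<delta> g" using c by (simp add: w W.m_assoc)
  also have "\<dots> = u' \<bullet> (\<delta> h \<bullet> m) \<bullet> v \<bullet> \<delta> g" unfolding u'(2) using c by (simp add: W.m_assoc)
  also have "\<dots> = u' \<bullet> m' \<bullet> (\<delta> h \<bullet> v) \<bullet> \<delta> g" unfolding m'(2) using c by (simp add: W.m_assoc)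
  also have "\<dots> = u' \<bullet> m' \<bullet> v' \<bullet> \<delta> (h \<otimes> g)" unfolding v'(2) \<delta>_mult[OF h g] using c by (simp add: W.m_assoc)
  finally show ?thesis using gauss_productsI u' m' v' diagonal_mult_closed[OF h g] by simp
qed

lemma mult_U_positive_gauss_products:
  assumes u: "u \<in> U positive" and w: "w \<in> gauss_products"
  shows "u \<bullet> w \<in> gauss_products"
proof -
  obtain u' m v g where w: "w = u' \<bullet> m \<bullet> v \<bullet> \<delta> g" and
    *: "u' \<in> U positive" "m \<in> U negative" "v \<in> U positive" and g: "g \<in> Diag"
    using assms(2) by (auto simp: gauss_products_def)
  note c = U_closed[OF positive_roots *(1)] U_closed[OF negative_roots *(2)] U_closed[OF positive_roots *(3)]
    U_closed[OF positive_roots u] \<delta>_closed[OF g]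
  have "u \<bullet> w = (u \<bullet> u') \<bullet> m \<bullet> v \<bullet> \<delta> g" using c by (simp add: w W.m_assoc)
  then show ?thesis using gauss_productsI U_mult[OF u] * g by simp
qed

end

text \<open>The centralizer condition is the reason for working over the automorphism group. For
  St(R) itself, with \<open>\<pi>\<close> the map \<open>st\<close>, it would amount to injectivity
  of \<open>st\<close>, since the kernel of a crossed module is central.\<close>

locale faithful_steinberg_family = steinberg_family R n e W x \<delta> \<pi>
  for R (structure) and n and e :: "nat \<Rightarrow> 'a" and W :: "('w, 'k) monoid_scheme" and x \<delta> \<pi> +
  assumes n_ge_3: "n \<ge> 3"
    and centralizer_faithful: "\<lbrakk>w \<in> carrier W; \<pi> w = \<one>;
      \<And>i j a. \<lbrakk>i \<in> {1..n}; j \<in> {1..n}; i \<noteq> j; a \<in> peirce R e i j\<rbrakk> \<Longrightarrow>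
        w \<otimes>\<^bsub>W\<^esub> x i j a = x i j a \<otimes>\<^bsub>W\<^esub> w\<rbrakk> \<Longrightarrow> w = \<one>\<^bsub>W\<^esub>"
begin

lemma normalizes_mult:
  assumes "\<Phi> \<subseteq> root_pairs" "g \<in> carrier W" "h \<in> carrier W" "normalizes g \<Phi>" "normalizes h \<Phi>"
  shows "normalizes (g \<bullet> h) \<Phi>"
  unfolding normalizes_def
proof
  fix w assume w: "w \<in> U \<Phi>"
  obtain w' where w': "w' \<in> U \<Phi>" "h \<bullet> w = w' \<bullet> h" using normalizesE[OF assms(5) w] .
  obtain w'' where w'': "w'' \<in> U \<Phi>" "g \<bullet> w' = w'' \<bullet> g" using normalizesE[OF assms(4) w'(1)] .
  note c = assms(2,3) w[THEN U_closed[OF assms(1)]] w'(1)[THEN U_closed[OF assms(1)]] w''(1)[THEN U_closed[OF assms(1)]]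
  have "g \<bullet> h \<bullet> w = g \<bullet> w' \<bullet> h" using c w'(2) by (simp add: W.m_assoc)
  also have "\<dots> = w'' \<bullet> (g \<bullet> h)" unfolding w''(2) using c by (simp add: W.m_assoc)
  finally show "\<exists>w'\<in>U \<Phi>. g \<bullet> h \<bullet> w = w' \<bullet> (g \<bullet> h)" using w'' by blast
qed

text \<open>In \<open>g w = w' g\<close> the element \<open>g\<close> has trivial image, so
  \<open>w\<close> and \<open>w'\<close> have the same image and faithfulness identifies
  them.\<close>

lemma commutes_if_normalizes:
  assumes \<Phi>: "\<Phi> \<subseteq> root_pairs" "faithful \<Phi>" and g: "g \<in> carrier W" "\<pi> g = \<one>" "normalizes g \<Phi>"
    and w: "w \<in> U \<Phi>"
  shows "g \<bullet> w = w \<bullet> g"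
proof -
  obtain w' where w': "w' \<in> U \<Phi>" "g \<bullet> w = w' \<bullet> g" using normalizesE[OF g(3) w] .
  note c = g(1) w[THEN U_closed[OF \<Phi>(1)]] w'(1)[THEN U_closed[OF \<Phi>(1)]]
  have "\<pi> w = \<pi> w'" using arg_cong[OF w'(2), of \<pi>] c g(2) \<pi>_closed' by (simp add: \<pi>_mult)
  then have "\<pi> (w \<bullet> inv\<^bsub>W\<^esub> w') = \<pi> (w' \<bullet> inv\<^bsub>W\<^esub> w')" using c W.inv_closed[OF c(3)] by (simp only: \<pi>_mult)
  then have "\<pi> (w \<bullet> inv\<^bsub>W\<^esub> w') = \<one>" using c \<pi>_one by simp
  moreover have "w \<bullet> inv\<^bsub>W\<^esub> w' \<in> U \<Phi>" using U_mult[OF w U_inv[OF \<Phi>(1) w'(1)]] .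
  ultimately have "w \<bullet> inv\<^bsub>W\<^esub> w' = \<one>\<^bsub>W\<^esub>" using \<Phi>(2) by (simp add: faithful_def)
  then have "w = w'" using c W.inv_solve_right'[of "\<one>\<^bsub>W\<^esub>" w w'] by simp
  then show ?thesis using w'(2) by simp
qed

text \<open>For \<open>k \<notin> {i, j}\<close>, the group generated by the root subgroups of \<open>\<plusminus>(i, j)\<close> and the diagonal group
  normalizes the root subgroups of \<open>(i, k), (j, k)\<close> and of \<open>(k, i), (k, j)\<close>, on which \<open>\<pi>\<close> is injective.\<close>

lemma rank_one_faithful:
  assumes ij: "i \<in> {1..n}" "j \<in> {1..n}" "i \<noteq> j"
    and w: "w \<in> generate W (x i j ` peirce R e i j \<union> x j i ` peirce R e j i \<union> \<delta> ` Diag)"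
    and w1: "\<pi> w = \<one>"
  shows "w = \<one>\<^bsub>W\<^esub>"
proof -
  let ?S = "x i j ` peirce R e i j \<union> x j i ` peirce R e j i \<union> \<delta> ` Diag"
  have S: "?S \<subseteq> carrier W" using ij x_closed \<delta>_closed by auto
  have wc: "w \<in> carrier W" using W.generate_in_carrier[OF S w] .
  have S_inv: "inv\<^bsub>W\<^esub> s \<in> ?S" if "s \<in> ?S" for s
    using that x_inv[OF ij] x_inv[OF ij(2,1)] ij \<delta>_inv peirce_uminus diagonal_group_simps(4) by auto
  have norm: "normalizes w \<Phi>" if adj: "adjoinable i j \<Phi>" "adjoinable j i \<Phi>" for \<Phi>
  proof (rule W.generate_left_induct[OF S w S_inv])
    note \<Phi> = adjoinableD(1)[OF adj(1)]
    show "normalizes \<one>\<^bsub>W\<^esub> \<Phi>" using U_closed[OF \<Phi>] by (auto simp: normalizes_def)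
    fix s w assume s: "s \<in> ?S" and w: "w \<in> generate W ?S" "normalizes w \<Phi>"
    have "normalizes s \<Phi>"
      using s adjoinableD(5)[OF adj(1)] adjoinableD(5)[OF adj(2)] \<delta>_normalizes[OF \<Phi>] by blast
    then show "normalizes (s \<bullet> w) \<Phi>"
      using normalizes_mult[OF \<Phi> _ W.generate_in_carrier[OF S w(1)]] s S w(2) by blast
  qed
  have comm: "w \<bullet> x p q a = x p q a \<bullet> w"
    if pq: "(p, q) \<in> \<Phi>" "a \<in> peirce R e p q" and \<Phi>: "adjoinable i j \<Phi>" "adjoinable j i \<Phi>" "faithful \<Phi>" for p q a \<Phi>
    by (rule commutes_if_normalizes[OF adjoinableD(1)[OF \<Phi>(1)] \<Phi>(3) wc w1 norm[OF \<Phi>(1,2)] x_in_U[OF pq]])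
  have single: "faithful {(p, q)}" if "p \<in> {1..n}" "q \<in> {1..n}" "p \<noteq> q" for p q
    using faithful_insert[of p q "{}"] faithful_empty that
    by (simp add: adjoinable_def closed_roots_def root_pairs_def)
  have other: "w \<bullet> x p q a = x p q a \<bullet> w"
    if pq: "p \<in> {1..n}" "q \<in> {1..n}" "p \<noteq> q" "a \<in> peirce R e p q" "{p, q} \<noteq> {i, j}" for p q a
  proof -
    consider "p \<in> {i, j}" "q \<notin> {i, j}" | "p \<notin> {i, j}" "q \<in> {i, j}" | "p \<notin> {i, j}" "q \<notin> {i, j}"
      using pq by blast
    then show ?thesis
    proof cases
      case 1
      have "faithful (insert (i, q) {(j, q)})"
        by (rule faithful_insert)
          (use 1 pq ij single[of j q] in \<open>auto simp: adjoinable_def closed_roots_def root_pairs_def\<close>)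
      then show ?thesis
        using 1 pq ij by (intro comm[of _ _ "{(i, q), (j, q)}"]) (auto simp: adjoinable_def root_pairs_def)
    next
      case 2
      have "faithful (insert (p, i) {(p, j)})"
        by (rule faithful_insert)
          (use 2 pq ij single[of p j] in \<open>auto simp: adjoinable_def closed_roots_def root_pairs_def\<close>)
      then show ?thesis
        using 2 pq ij by (intro comm[of _ _ "{(p, i), (p, j)}"]) (auto simp: adjoinable_def root_pairs_def)
    next
      \<comment> \<open>Away from \<open>i\<close> and \<open>j\<close>, a single root already forms
        a set normalized by both root subgroups of the pair.\<close>
      case 3
      then show ?thesis
        using pq ij single[of p q] by (intro comm[of _ _ "{(p, q)}"]) (auto simp: adjoinable_def root_pairs_def)
    qed
  qed
  let ?C = "{v \<in> carrier W. w \<bullet> v = v \<bullet> w}"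
  have C: "subgroup ?C W"
  proof (rule W.subgroupI)
    fix v assume "v \<in> ?C"
    then have v: "v \<in> carrier W" "w \<bullet> v = v \<bullet> w" by auto
    have "inv\<^bsub>W\<^esub> v \<bullet> (w \<bullet> v) \<bullet> inv\<^bsub>W\<^esub> v = inv\<^bsub>W\<^esub> v \<bullet> (v \<bullet> w) \<bullet> inv\<^bsub>W\<^esub> v" using v by simp
    moreover have "inv\<^bsub>W\<^esub> v \<bullet> (w \<bullet> v) \<bullet> inv\<^bsub>W\<^esub> v = inv\<^bsub>W\<^esub> v \<bullet> w" using v(1) wc by (simp add: W.m_assoc)
    moreover have "inv\<^bsub>W\<^esub> v \<bullet> (v \<bullet> w) \<bullet> inv\<^bsub>W\<^esub> v = w \<bullet> inv\<^bsub>W\<^esub> v" using v(1) wc by (simp add: W.m_assoc[symmetric])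
    ultimately show "inv\<^bsub>W\<^esub> v \<in> ?C" using v by simp
  next
    fix u v assume "u \<in> ?C" "v \<in> ?C"
    then have uv: "u \<in> carrier W" "w \<bullet> u = u \<bullet> w" "v \<in> carrier W" "w \<bullet> v = v \<bullet> w" by auto
    have "w \<bullet> (u \<bullet> v) = (w \<bullet> u) \<bullet> v" using uv(1,3) wc by (simp add: W.m_assoc)
    also have "\<dots> = u \<bullet> (w \<bullet> v)" unfolding uv(2) using uv(1,3) wc by (simp add: W.m_assoc)
    also have "\<dots> = u \<bullet> v \<bullet> w" unfolding uv(4) using uv(1,3) wc by (simp add: W.m_assoc)
    finally show "u \<bullet> v \<in> ?C" using uv by simp
  qed (use wc in auto)
  obtain k where k: "k \<in> {1..n}" "k \<noteq> i" "k \<noteq> j" using third_index[OF n_ge_3] by blast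
  \<comment> \<open>The root subgroups of the pair itself are reached as commutators through
    \<open>k\<close>, whose factors belong to the roots treated in \<open>other\<close>.\<close>
  have self: "w \<bullet> x p q a = x p q a \<bullet> w"
    if pq: "p \<in> {1..n}" "q \<in> {1..n}" "p \<noteq> q" "a \<in> peirce R e p q" "{p, q} = {i, j}" for p q a
  proof -
    have kpq: "k \<noteq> p" "k \<noteq> q" using pq(5) k by auto
    have "x p q a \<in> ?C"
    proof (rule x_in_subgroup_if_commutators[OF C pq(1,2) k(1) pq(3) _ _ pq(4)])
      fix b assume b: "b \<in> peirce R e p k"
      have "{p, k} \<noteq> {i, j}" using k by blast
      then show "x p k b \<in> ?C" using other[of p k b] x_closed[of p k b] b pq k kpq by auto
    next
      fix b assume b: "b \<in> peirce R e k q"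
      have "{k, q} \<noteq> {i, j}" using k by blast
      then show "x k q b \<in> ?C" using other[of k q b] x_closed[of k q b] b pq k kpq by auto
    qed (use kpq in auto)
    then show ?thesis by simp
  qed
  show ?thesis
    by (rule centralizer_faithful[OF wc w1]) (use self other in blast)
qed

text \<open>Both sides lie in the rank-one group and have the same image in GL(R) by
  \<open>rank_one_reduction\<close>, so \<open>rank_one_faithful\<close> applies to their
  quotient.\<close>

lemma rank_one_gauss:
  assumes ik: "i \<in> {1..n}" "k \<in> {1..n}" "i \<noteq> k"
    and a: "a \<in> peirce R e k i" and b: "b \<in> peirce R e i k" and c: "c \<in> peirce R e k i"
  obtains p h q t where "p \<in> peirce R e i k" "q \<in> peirce R e k i" "t \<in> peirce R e i k"
    "h \<in> Diag"
    "x k i a \<bullet> x i k b \<bullet> x k i c = x i k p \<bullet> \<delta> h \<bullet> x k i q \<bullet> x i k t"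
proof -
  obtain p h q t where *: "p \<in> peirce R e i k" "q \<in> peirce R e k i" "t \<in> peirce R e i k"
      "h \<in> Diag"
    and eq: "(\<one> \<oplus> a) \<otimes> (\<one> \<oplus> b) \<otimes> (\<one> \<oplus> c) = (\<one> \<oplus> p) \<otimes> h \<otimes> (\<one> \<oplus> q) \<otimes> (\<one> \<oplus> t)"
    using rank_one_reduction[OF ik a b c] .
  let ?w = "x k i a \<bullet> x i k b \<bullet> x k i c" and ?w' = "x i k p \<bullet> \<delta> h \<bullet> x k i q \<bullet> x i k t"
  let ?S = "x i k ` peirce R e i k \<union> x k i ` peirce R e k i \<union> \<delta> ` Diag"
  have S: "?S \<subseteq> carrier W" using ik x_closed \<delta>_closed by auto
  have cl: "x k i a \<in> carrier W" "x i k b \<in> carrier W" "x k i c \<in> carrier W"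
      "x i k p \<in> carrier W" "x k i q \<in> carrier W" "x i k t \<in> carrier W" "\<delta> h \<in> carrier W"
    using ik a b c * x_closed \<delta>_closed by auto
  then have wc: "?w \<in> carrier W" "?w' \<in> carrier W" by auto
  have "\<pi> ?w = \<pi> ?w'" using cl ik a b c * eq by (simp add: \<pi>_mult \<pi>_x \<pi>_\<delta>)
  then have "\<pi> (?w \<bullet> inv\<^bsub>W\<^esub> ?w') = \<pi> (?w' \<bullet> inv\<^bsub>W\<^esub> ?w')"
    using wc W.inv_closed[OF wc(2)] by (simp only: \<pi>_mult)
  then have 1: "\<pi> (?w \<bullet> inv\<^bsub>W\<^esub> ?w') = \<one>" using wc \<pi>_one by simp
  have "?w \<in> generate W ?S" "?w' \<in> generate W ?S"
    by (intro generate.eng generate.incl UnI1 UnI2 imageI a b c *)+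
  then have "?w \<bullet> inv\<^bsub>W\<^esub> ?w' \<in> generate W ?S"
    using generate.eng W.generate_m_inv_closed[OF S] by metis
  then have "?w \<bullet> inv\<^bsub>W\<^esub> ?w' = \<one>\<^bsub>W\<^esub>" using rank_one_faithful[OF ik(1,2,3)] 1 by blast
  then have "?w = ?w'" using wc by (metis W.inv_solve_right' W.l_one W.one_closed)
  then show ?thesis using that * by blast
qed

text \<open>For a simple root, both unipotent groups split as a root subgroup times a part
  normalized by the whole rank-one group. The new factor therefore interacts only with the simple
  factors of \<open>u\<close> and \<open>m\<close>, and there \<open>rank_one_gauss\<close> rewrites
  the product.\<close>

lemma mult_simple_negative_gauss_products:
  assumes i: "i \<in> {1..n}" "Suc i \<in> {1..n}" and a: "a \<in> peirce R e (Suc i) i" and w: "w \<in> gauss_products"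
  shows "x (Suc i) i a \<bullet> w \<in> gauss_products"
proof -
  let ?k = "Suc i"
  obtain u m v g where w: "w = u \<bullet> m \<bullet> v \<bullet> \<delta> g" and
    *: "u \<in> U positive" "m \<in> U negative" "v \<in> U positive" and g: "g \<in> Diag"
    using assms(4) by (auto simp: gauss_products_def)
  \<comment> \<open>A root composed with a simple root or with its negative keeps its sign unless it
    belongs to that simple pair, so both root subgroups of the pair normalize these two
    sets.\<close>
  let ?P = "positive - {(i, ?k)}" and ?N = "negative - {(?k, i)}"
  have adj: "adjoinable i ?k ?P" "adjoinable ?k i ?P" "adjoinable i ?k ?N" "adjoinable ?k i ?N"
    using i by (auto simp: adjoinable_def positive_def negative_def root_pairs_def)
  have ins: "insert (i, ?k) ?P = positive" "insert (?k, i) ?N = negative"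
    using i by (auto simp: positive_def negative_def root_pairs_def)
  have sub: "U ?P \<subseteq> U positive" "U ?N \<subseteq> U negative" by (intro U_mono; blast)+
  have simple: "x i ?k d \<in> U positive" if "d \<in> peirce R e i ?k" for d
    by (rule x_in_U[OF _ that]) (use i in \<open>auto simp: positive_def root_pairs_def\<close>)
  have simple': "x ?k i d \<in> U negative" if "d \<in> peirce R e ?k i" for d
    by (rule x_in_U[OF _ that]) (use i in \<open>auto simp: negative_def root_pairs_def\<close>)
  note cl_pos = U_closed[OF positive_roots] and cl_neg = U_closed[OF negative_roots]
  have ac: "x ?k i a \<in> carrier W" using simple'[OF a] cl_neg by blast
  obtain b u1 where b: "b \<in> peirce R e i ?k" and u1: "u1 \<in> U ?P" and u_eq: "u = x i ?k b \<bullet> u1"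
    using U_insertE[OF adj(1)] *(1) unfolding ins by blast
  \<comment> \<open>The simple factor of \<open>u\<close> is moved to the right end, next to
    \<open>m\<close>.\<close>
  obtain u2 where u2: "u2 \<in> U ?P" "x i ?k b \<bullet> u1 = u2 \<bullet> x i ?k b"
    using normalizesE[OF adjoinableD(5)[OF adj(1) b] u1] .
  obtain u3 where u3: "u3 \<in> U ?P" "x ?k i a \<bullet> u2 = u3 \<bullet> x ?k i a"
    using normalizesE[OF adjoinableD(5)[OF adj(2) a] u2(1)] .
  obtain c m1 where c: "c \<in> peirce R e ?k i" and m1: "m1 \<in> U ?N" and m_eq: "m = x ?k i c \<bullet> m1"
    using U_insertE[OF adj(4)] *(2) unfolding ins by blast
  obtain p h q t where pqt: "p \<in> peirce R e i ?k" "q \<in> peirce R e ?k i" "t \<in> peirce R e i ?k"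
      and h: "h \<in> Diag"
      and eq: "x ?k i a \<bullet> x i ?k b \<bullet> x ?k i c = x i ?k p \<bullet> \<delta> h \<bullet> x ?k i q \<bullet> x i ?k t"
    by (rule rank_one_gauss[OF i n_not_Suc_n a b c]) (rule that, assumption+)
  \<comment> \<open>The rank-one identity ends in a positive factor; it is moved across the rest of
    \<open>m\<close> so that \<open>v\<close> can absorb it.\<close>
  obtain m2 where m2: "m2 \<in> U ?N" "x i ?k t \<bullet> m1 = m2 \<bullet> x i ?k t"
    using normalizesE[OF adjoinableD(5)[OF adj(3) pqt(3)] m1] .
  have cl: "u2 \<in> carrier W" "u3 \<in> carrier W" "m1 \<in> carrier W" "m2 \<in> carrier W" "v \<in> carrier W"
      "x i ?k b \<in> carrier W" "x ?k i c \<in> carrier W" "x i ?k p \<in> carrier W" "x ?k i q \<in> carrier W"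
      "x i ?k t \<in> carrier W" "\<delta> h \<in> carrier W" "\<delta> g \<in> carrier W"
    using sub u2 u3 m1 m2 *(3) b c pqt simple simple' cl_pos cl_neg \<delta>_closed h g by blast+
  have "x ?k i a \<bullet> w = (x ?k i a \<bullet> u2) \<bullet> x i ?k b \<bullet> x ?k i c \<bullet> m1 \<bullet> v \<bullet> \<delta> g"
    unfolding w u_eq m_eq u2(2) using cl ac by (simp add: W.m_assoc)
  also have "\<dots> = u3 \<bullet> (x ?k i a \<bullet> x i ?k b \<bullet> x ?k i c) \<bullet> m1 \<bullet> v \<bullet> \<delta> g"
    unfolding u3(2) using cl ac by (simp add: W.m_assoc)
  also have "\<dots> = u3 \<bullet> x i ?k p \<bullet> (\<delta> h \<bullet> (x ?k i q \<bullet> (x i ?k t \<bullet> m1) \<bullet> v \<bullet> \<delta> g))"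
    unfolding eq using cl by (simp add: W.m_assoc)
  also have "x ?k i q \<bullet> (x i ?k t \<bullet> m1) \<bullet> v \<bullet> \<delta> g =
      \<one>\<^bsub>W\<^esub> \<bullet> (x ?k i q \<bullet> m2) \<bullet> (x i ?k t \<bullet> v) \<bullet> \<delta> g"
    unfolding m2(2) using cl by (simp add: W.m_assoc)
  finally have eq': "x ?k i a \<bullet> w = u3 \<bullet> x i ?k p \<bullet> (\<delta> h \<bullet>
      (\<one>\<^bsub>W\<^esub> \<bullet> (x ?k i q \<bullet> m2) \<bullet> (x i ?k t \<bullet> v) \<bullet> \<delta> g))" .
  have "\<one>\<^bsub>W\<^esub> \<bullet> (x ?k i q \<bullet> m2) \<bullet> (x i ?k t \<bullet> v) \<bullet> \<delta> g \<in> gauss_products"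
    using U_one U_mult simple simple' pqt m2 sub *(3) g by (intro gauss_productsI) blast+
  then have "\<delta> h \<bullet> (\<one>\<^bsub>W\<^esub> \<bullet> (x ?k i q \<bullet> m2) \<bullet> (x i ?k t \<bullet> v) \<bullet> \<delta> g) \<in> gauss_products"
    by (rule mult_\<delta>_gauss_products[OF h])
  moreover have "u3 \<bullet> x i ?k p \<in> U positive" using U_mult u3(1) sub simple pqt by blast
  ultimately show ?thesis unfolding eq' using mult_U_positive_gauss_products by blast
qed

text \<open>Nothing says at this stage that Gauss products form a group. The condition on the
  inverse turns the elements preserving them into a subgroup, so that commutators may be
  formed.\<close>

definition stabilizer :: "'w set" where
  "stabilizer = {w \<in> carrier W. \<forall>g\<in>gauss_products. w \<bullet> g \<in> gauss_products \<and> inv\<^bsub>W\<^esub> w \<bullet> g \<in> gauss_products}"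

lemma stabilizer_subgroup: "subgroup stabilizer W"
proof (rule W.subgroupI)
  have "\<one>\<^bsub>W\<^esub> \<in> stabilizer" using gauss_products_closed by (auto simp: stabilizer_def)
  then show "stabilizer \<noteq> {}" by blast
  show "stabilizer \<subseteq> carrier W" by (auto simp: stabilizer_def)
  show "inv\<^bsub>W\<^esub> v \<in> stabilizer" if "v \<in> stabilizer" for v using that by (auto simp: stabilizer_def)
  show "v \<bullet> w \<in> stabilizer" if "v \<in> stabilizer" "w \<in> stabilizer" for v w
    using that gauss_products_closed by (auto simp: stabilizer_def W.inv_mult_group W.m_assoc)
qed

lemma x_stabilizer_if:
  assumes "i \<in> {1..n}" "j \<in> {1..n}" "i \<noteq> j" "a \<in> peirce R e i j"
    and "\<And>a w. a \<in> peirce R e i j \<Longrightarrow> w \<in> gauss_products \<Longrightarrow> x i j a \<bullet> w \<in> gauss_products"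
  shows "x i j a \<in> stabilizer"
  using assms x_closed peirce_uminus by (simp add: stabilizer_def x_inv)

lemma x_positive_stabilizer:
  assumes "i \<in> {1..n}" "j \<in> {1..n}" "i < j" "a \<in> peirce R e i j"
  shows "x i j a \<in> stabilizer"
  by (rule x_stabilizer_if)
    (use assms in \<open>auto intro!: mult_U_positive_gauss_products x_in_U simp: positive_def root_pairs_def\<close>)

text \<open>Induction on the height of the root: \<open>d = 0\<close> is simple, and a higher root
  is a commutator through \<open>Suc j\<close> of a root of smaller height and a simple one.\<close>

lemma x_negative_stabilizer:
  assumes "j \<in> {1..n}" "j + d + 1 \<in> {1..n}" "a \<in> peirce R e (j + d + 1) j"
  shows "x (j + d + 1) j a \<in> stabilizer"
  using assms
proof (induction d arbitrary: j a)
  case 0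
  then show ?case
    by (intro x_stabilizer_if) (auto intro!: mult_simple_negative_gauss_products)
next
  case (Suc d)
  let ?i = "j + Suc d + 1" and ?k = "Suc j"
  note S = stabilizer_subgroup
  have ij: "?i \<in> {1..n}" "j \<in> {1..n}" "?k \<in> {1..n}" using Suc.prems by auto
  have ik: "x ?i ?k b \<in> stabilizer" if "b \<in> peirce R e ?i ?k" for b
    using Suc.IH[of ?k b] ij that by simp
  have kj: "x ?k j c \<in> stabilizer" if "c \<in> peirce R e ?k j" for c
    using x_stabilizer_if[of ?k j c] mult_simple_negative_gauss_products ij that by auto
  show ?case
    by (rule x_in_subgroup_if_commutators[OF S ij _ _ _ Suc.prems(3)]) (use ik kj in auto)
qed

lemma generated_in_gauss_products: "generated \<subseteq> gauss_products"
proof -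
  have "root_elements root_pairs \<union> \<delta> ` Diag \<subseteq> stabilizer"
  proof (intro Un_least subsetI)
    fix s assume "s \<in> root_elements root_pairs"
    then obtain i j a where s: "s = x i j a" "a \<in> peirce R e i j" "i \<in> {1..n}" "j \<in> {1..n}" "i \<noteq> j"
      by (auto simp: root_elements_def root_pairs_def)
    show "s \<in> stabilizer"
    proof (cases "i < j")
      case True
      then show ?thesis using x_positive_stabilizer s by blast
    next
      case False
      then show ?thesis using x_negative_stabilizer[of j "i - j - 1" a] s by auto
    qed
  next
    fix s assume "s \<in> \<delta> ` Diag"
    then obtain h where h: "s = \<delta> h" "h \<in> Diag" by blast
    have "inv\<^bsub>W\<^esub> \<delta> h = \<delta> (inv h)" using \<delta>_inv[OF h(2)] .
    then show "s \<in> stabilizer"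
      using h mult_\<delta>_gauss_products diagonal_group_simps(4)[OF h(2)] \<delta>_closed by (simp add: stabilizer_def)
  qed
  then have "generated \<subseteq> stabilizer" unfolding generated_def
    using W.generate_subgroup_incl stabilizer_subgroup by blast
  moreover have "\<one>\<^bsub>W\<^esub> \<in> gauss_products"
    using gauss_productsI[OF U_one U_one U_one one_diagonal] by (simp add: \<delta>_one)
  \<comment> \<open>Each element of the stabilizer is applied to the trivial Gauss product.\<close>
  ultimately show ?thesis by (force simp: stabilizer_def)
qed

lemma generated_subgroup: "subgroup generated W"
  unfolding generated_def
  using root_elements_closed[OF order_refl] \<delta>_closed by (intro W.generate_is_subgroup) auto

lemma x_generated: "\<lbrakk>i \<in> {1..n}; j \<in> {1..n}; i \<noteq> j; a \<in> peirce R e i j\<rbrakk> \<Longrightarrow> x i j a \<in> generated"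
  unfolding generated_def by (rule generate.incl) (auto simp: root_elements_def root_pairs_def)

lemma \<delta>_generated: "h \<in> Diag \<Longrightarrow> \<delta> h \<in> generated"
  unfolding generated_def by (rule generate.incl) auto

theorem \<pi>_inj_on_generated: "inj_on \<pi> generated"
proof (rule inj_onI)
  fix v w assume v: "v \<in> generated" and w: "w \<in> generated" and eq: "\<pi> v = \<pi> w"
  note S = generated_subgroup
  have c: "v \<in> carrier W" "w \<in> carrier W" "inv\<^bsub>W\<^esub> w \<in> carrier W" using subgroup.mem_carrier[OF S] v w by auto
  have "v \<bullet> inv\<^bsub>W\<^esub> w \<in> gauss_products"
    using generated_in_gauss_products subgroup.m_closed[OF S v subgroup.m_inv_closed[OF S w]] by blast
  moreover have "\<pi> (v \<bullet> inv\<^bsub>W\<^esub> w) = \<pi> (w \<bullet> inv\<^bsub>W\<^esub> w)" using c eq by (simp only: \<pi>_mult)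
  ultimately have "v \<bullet> inv\<^bsub>W\<^esub> w = \<one>\<^bsub>W\<^esub>" using gauss_products_faithful c \<pi>_one by simp
  then show "v = w" using c W.inv_solve_right'[of "\<one>\<^bsub>W\<^esub>" v w] by simp
qed

theorem \<pi>_image_generated: "\<pi> ` generated = Units R"
proof
  note S = generated_subgroup
  show "\<pi> ` generated \<subseteq> Units R" using \<pi>_closed subgroup.mem_carrier[OF S] by blast
  show "Units R \<subseteq> \<pi> ` generated"
  proof
    fix g assume "g \<in> Units R"
    then show "g \<in> \<pi> ` generated"
    proof (rule GL_elementary_diagonal[rotated 4])
      show "\<one> \<in> \<pi> ` generated" using subgroup.one_closed[OF S] \<pi>_one by force
      show "g \<otimes> h \<in> \<pi> ` generated" if gh: "g \<in> \<pi> ` generated" "h \<in> \<pi> ` generated" for g h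
      proof -
        obtain v w where "v \<in> generated" "w \<in> generated" "g = \<pi> v" "h = \<pi> w" using gh by blast
        moreover from this have "\<pi> (v \<bullet> w) = g \<otimes> h" using \<pi>_mult subgroup.mem_carrier[OF S] by simp
        ultimately show ?thesis using subgroup.m_closed[OF S] by (metis imageI)
      qed
      show "\<one> \<oplus> a \<in> \<pi> ` generated" if "i \<in> {1..n}" "j \<in> {1..n}" "i \<noteq> j" "a \<in> peirce R e i j" for i j a
        using \<pi>_x[OF that] x_generated[OF that] by force
      show "h \<in> \<pi> ` generated" if "h \<in> Diag" for h
        using \<pi>_\<delta>[OF that] \<delta>_generated[OF that] by force
    qed
  qed
qed

end

section \<open>The crossed module\<close>

text \<open>The equation \<open>u v = y (v u)\<close> makes \<open>y\<close> the commutator of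
  \<open>u\<close> and \<open>v\<close>, and central factors do not change a commutator.\<close>

lemma (in group) eq_if_central_commutator:
  assumes c: "z \<in> carrier G" "z' \<in> carrier G" "u \<in> carrier G" "v \<in> carrier G" "x \<in> carrier G" "y \<in> carrier G"
    and central: "\<And>g. g \<in> carrier G \<Longrightarrow> z \<otimes> g = g \<otimes> z" "\<And>g. g \<in> carrier G \<Longrightarrow> z' \<otimes> g = g \<otimes> z'"
    and y: "u \<otimes> v = y \<otimes> (v \<otimes> u)"
    and x: "(z \<otimes> u) \<otimes> (z' \<otimes> v) = x \<otimes> ((z' \<otimes> v) \<otimes> (z \<otimes> u))"
  shows "x = y"
proof -
  have zz: "(z \<otimes> u) \<otimes> (z' \<otimes> v) = (z \<otimes> z') \<otimes> (u \<otimes> v)"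
    if "u \<in> carrier G" "v \<in> carrier G" for u v
  proof -
    have "(z \<otimes> u) \<otimes> (z' \<otimes> v) = z \<otimes> (u \<otimes> z') \<otimes> v" using c that by (simp add: m_assoc)
    also have "\<dots> = (z \<otimes> z') \<otimes> (u \<otimes> v)" unfolding central(2)[OF that(1), symmetric] using c that by (simp add: m_assoc)
    finally show ?thesis .
  qed
  have zz': "(z' \<otimes> v) \<otimes> (z \<otimes> u) = (z \<otimes> z') \<otimes> (v \<otimes> u)"
  proof -
    have "(z' \<otimes> v) \<otimes> (z \<otimes> u) = (z' \<otimes> (v \<otimes> z)) \<otimes> u" using c by (simp add: m_assoc)
    also have "\<dots> = ((z' \<otimes> z) \<otimes> v) \<otimes> u" unfolding central(1)[OF c(4), symmetric] using c by (simp add: m_assoc)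
    also have "z' \<otimes> z = z \<otimes> z'" using central(2)[OF c(1)] .
    finally show ?thesis using c by (simp add: m_assoc)
  qed
  have "(z \<otimes> z') \<otimes> (y \<otimes> (v \<otimes> u)) = x \<otimes> ((z \<otimes> z') \<otimes> (v \<otimes> u))"
    using x unfolding zz[OF c(3,4)] zz' y .
  also have "\<dots> = (x \<otimes> z) \<otimes> (z' \<otimes> (v \<otimes> u))" using c by (simp add: m_assoc)
  also have "\<dots> = z \<otimes> (x \<otimes> z') \<otimes> (v \<otimes> u)" unfolding central(1)[OF c(5), symmetric] using c by (simp add: m_assoc)
  also have "\<dots> = (z \<otimes> z') \<otimes> (x \<otimes> (v \<otimes> u))" unfolding central(2)[OF c(5), symmetric] using c by (simp add: m_assoc)
  finally show ?thesis using c by simp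
qed

lemma (in group) AutoGroup_simps:
  "carrier (AutoGroup G) = auto G"
  "\<phi> \<in> auto G \<Longrightarrow> \<psi> \<in> auto G \<Longrightarrow> \<phi> \<otimes>\<^bsub>AutoGroup G\<^esub> \<psi> = compose (carrier G) \<phi> \<psi>"
  "\<one>\<^bsub>AutoGroup G\<^esub> = (\<lambda>x\<in>carrier G. x)"
  by (auto simp: AutoGroup_def BijGroup_def auto_def)

lemma autoI:
  assumes "\<phi> \<in> hom G G" "\<phi> \<in> extensional (carrier G)" "\<psi> \<in> carrier G \<rightarrow> carrier G"
    and "\<And>x. x \<in> carrier G \<Longrightarrow> \<psi> (\<phi> x) = x" "\<And>x. x \<in> carrier G \<Longrightarrow> \<phi> (\<psi> x) = x"
  shows "\<phi> \<in> auto G"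
proof -
  have "bij_betw \<phi> (carrier G) (carrier G)"
    by (rule bij_betw_byWitness[where f' = \<psi>]) (use assms in \<open>auto simp: hom_def\<close>)
  then show ?thesis using assms by (simp add: auto_def Bij_def)
qed

definition conj_auto :: "('a, 'm) monoid_scheme \<Rightarrow> 'a \<Rightarrow> 'a \<Rightarrow> 'a" where
  "conj_auto G g = (\<lambda>x\<in>carrier G. g \<otimes>\<^bsub>G\<^esub> x \<otimes>\<^bsub>G\<^esub> inv\<^bsub>G\<^esub> g)"

context group
begin

lemma conj_auto_apply: "x \<in> carrier G \<Longrightarrow> conj_auto G g x = g \<otimes> x \<otimes> inv g"
  by (simp add: conj_auto_def)

lemma conj_auto_in_auto:
  assumes "g \<in> carrier G" shows "conj_auto G g \<in> auto G"
proof (rule autoI)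
  show "conj_auto G g \<in> hom G G"
    using assms by (intro homI) (simp_all add: conj_auto_def m_assoc inv_solve_left)
  show "conj_auto G g \<in> extensional (carrier G)" by (simp add: conj_auto_def)
  show "conj_auto G (inv g) \<in> carrier G \<rightarrow> carrier G" using assms by (auto simp: conj_auto_def)
  show "conj_auto G (inv g) (conj_auto G g x) = x" "conj_auto G g (conj_auto G (inv g) x) = x"
    if "x \<in> carrier G" for x
    using that assms by (simp_all add: conj_auto_def m_assoc) (simp_all add: m_assoc[symmetric])
qed

lemma auto_apply:
  assumes "\<phi> \<in> auto G"
  shows "x \<in> carrier G \<Longrightarrow> \<phi> x \<in> carrier G"
    "x \<in> carrier G \<Longrightarrow> y \<in> carrier G \<Longrightarrow> \<phi> (x \<otimes> y) = \<phi> x \<otimes> \<phi> y"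
    "\<phi> \<in> hom G G" "\<phi> \<in> extensional (carrier G)"
  using assms by (auto simp: auto_def hom_def Bij_def)

lemma auto_inv: "\<phi> \<in> auto G \<Longrightarrow> x \<in> carrier G \<Longrightarrow> \<phi> (inv x) = inv (\<phi> x)"
  using group_hom.hom_inv[OF group_hom.intro[OF is_group is_group group_hom_axioms.intro]] auto_apply(3)
  by blast

lemma auto_surj:
  assumes "\<phi> \<in> auto G" "y \<in> carrier G"
  obtains x where "x \<in> carrier G" "y = \<phi> x"
  using assms by (auto simp: auto_def Bij_def bij_betw_def)

lemma auto_eqI:
  assumes "\<phi> \<in> auto G" "\<psi> \<in> auto G" "\<And>x. x \<in> carrier G \<Longrightarrow> \<phi> x = \<psi> x"
  shows "\<phi> = \<psi>"
  using assms auto_apply(4) by (intro extensionalityI[of \<phi> "carrier G" \<psi>]) auto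

lemma conj_auto_hom: "conj_auto G \<in> hom G (AutoGroup G)"
proof (rule homI)
  fix g h assume gh: "g \<in> carrier G" "h \<in> carrier G"
  show "conj_auto G (g \<otimes> h) = conj_auto G g \<otimes>\<^bsub>AutoGroup G\<^esub> conj_auto G h"
    unfolding AutoGroup_simps(2)[OF conj_auto_in_auto[OF gh(1)] conj_auto_in_auto[OF gh(2)]]
    using gh by (auto simp: compose_def conj_auto_def fun_eq_iff m_assoc inv_mult_group)
qed (simp add: AutoGroup_simps conj_auto_in_auto)

end

section \<open>The Steinberg group of a Morita equivalent family\<close>

locale steinberg_setting = idempotent_family R n e
  for R (structure) and n and e :: "nat \<Rightarrow> 'a" +
  assumes n_ge_3: "n \<ge> 3"
    and morita: "\<lbrakk>i \<in> {1..n}; j \<in> {1..n}\<rbrakk> \<Longrightarrow> morita_dominates R (e i) (e j)"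
begin

text \<open>As \<open>e i\<close> is a signed sum of elements \<open>r e_k s\<close>, the element
  \<open>a = e_i a\<close> is one of products \<open>(e_i r e_k)(e_k s a)\<close>.\<close>

lemma morita_peirce_generated:
  assumes ijk: "i \<in> {1..n}" "j \<in> {1..n}" "k \<in> {1..n}"
  shows "peirce R e i j \<subseteq> generate (add_monoid R) {a \<otimes> b | a b. a \<in> peirce R e i k \<and> b \<in> peirce R e k j}"
    (is "_ \<subseteq> generate _ ?S")
proof
  fix a assume a: "a \<in> peirce R e i j"
  note aD = peirceD[OF ijk(1,2) a]
  have prod: "e i \<otimes> (r \<otimes> e k \<otimes> s) \<otimes> a \<in> ?S" if "r \<in> carrier R" "s \<in> carrier R" for r s
  proof -
    have "e i \<otimes> (r \<otimes> e k \<otimes> s) \<otimes> a = (e i \<otimes> r \<otimes> e k) \<otimes> (e k \<otimes> (s \<otimes> a) \<otimes> e j)"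
      using that ijk aD by (simp add: m_assoc)
    moreover have "e i \<otimes> r \<otimes> e k \<in> peirce R e i k" "e k \<otimes> (s \<otimes> a) \<otimes> e j \<in> peirce R e k j"
      using that aD by (auto simp: peirce_def)
    ultimately show ?thesis by blast
  qed
  \<comment> \<open>The claim is proved for all \<open>y\<close> in the span of the
    \<open>r e_k s\<close> and then used at \<open>y = e i\<close>.\<close>
  have "y \<in> carrier R \<and> e i \<otimes> y \<otimes> a \<in> generate (add_monoid R) ?S"
    if "y \<in> generate (add_monoid R) {r \<otimes> e k \<otimes> s | r s. r \<in> carrier R \<and> s \<in> carrier R}" for y
    using that
  proof (induction rule: generate.induct)
    case one
    then show ?case using aD ijk generate.one[of "add_monoid R" ?S] by simp
  next
    case (incl h)
    then show ?case using prod ijk by (auto intro: generate.incl)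
  next
    case (inv h)
    then obtain r s where h: "h = r \<otimes> e k \<otimes> s" "r \<in> carrier R" "s \<in> carrier R" by blast
    have "inv\<^bsub>add_monoid R\<^esub> h = (\<ominus> r) \<otimes> e k \<otimes> s" using h ijk by (simp add: a_inv_def[symmetric] l_minus)
    then show ?case using prod[of "\<ominus> r" s] h ijk by (auto intro: generate.incl)
  next
    case (eng g h)
    then have "e i \<otimes> (g \<oplus> h) \<otimes> a = e i \<otimes> g \<otimes> a \<oplus> e i \<otimes> h \<otimes> a" using aD ijk by (simp add: l_distr r_distr)
    then show ?case using eng generate.eng[of _ "add_monoid R" ?S] by simp
  qed
  then have "e i \<otimes> e i \<otimes> a \<in> generate (add_monoid R) ?S"
    using morita[OF ijk(3,1)] unfolding morita_dominates_def by blast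
  then show "a \<in> generate (add_monoid R) ?S" using aD ijk by simp
qed

abbreviation "S \<equiv> St R n e"
abbreviation "xs \<equiv> st_x R n e"

sublocale S: group "St R n e" by (rule St_group[OF ring_axioms complete])
sublocale GL: group "GL R" by (rule units_group)
sublocale A: group "AutoGroup (St R n e)" by (rule S.AutoGroup)
sublocale D: group "diagonal_group R n e" by (rule diagonal_group_is_group)

lemma gens_iff: "(i, j, a) \<in> steinberg_gens R n e \<longleftrightarrow> i \<in> {1..n} \<and> j \<in> {1..n} \<and> i \<noteq> j \<and> a \<in> peirce R e i j"
  by (auto simp: steinberg_gens_def)

lemma rels_eval:
  assumes "(u, v) \<in> steinberg_rels R n e" "u \<in> words (steinberg_gens R n e)" "v \<in> words (steinberg_gens R n e)"
  shows "word_eval S (\<lambda>(i, j, a). xs i j a) u = word_eval S (\<lambda>(i, j, a). xs i j a) v"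
  using assms word_eval_st_x[OF ring_axioms complete]
  by (simp add: word_class_eq_iff word_eq.relation)

lemma xs_closed: "\<lbrakk>i \<in> {1..n}; j \<in> {1..n}; i \<noteq> j; a \<in> peirce R e i j\<rbrakk> \<Longrightarrow> xs i j a \<in> carrier S"
  by (rule st_x_closed[OF ring_axioms complete]) (simp add: gens_iff)

sublocale SR: steinberg_relations R n e "St R n e" "st_x R n e"
proof unfold_locales
  show "xs i j a \<in> carrier S" if "i \<in> {1..n}" "j \<in> {1..n}" "i \<noteq> j" "a \<in> peirce R e i j" for i j a
    using xs_closed that .
  \<comment> \<open>Rewrites the value of a commutator word in the form without inverses that the
    locale asks for.\<close>
  have comm: "g \<otimes>\<^bsub>S\<^esub> h = z \<otimes>\<^bsub>S\<^esub> (h \<otimes>\<^bsub>S\<^esub> g)"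
    if "g \<otimes>\<^bsub>S\<^esub> (h \<otimes>\<^bsub>S\<^esub> (inv\<^bsub>S\<^esub> g \<otimes>\<^bsub>S\<^esub> inv\<^bsub>S\<^esub> h)) = z" "g \<in> carrier S" "h \<in> carrier S" for g h z
  proof -
    have "z \<otimes>\<^bsub>S\<^esub> (h \<otimes>\<^bsub>S\<^esub> g) = g \<otimes>\<^bsub>S\<^esub> h \<otimes>\<^bsub>S\<^esub> (inv\<^bsub>S\<^esub> (h \<otimes>\<^bsub>S\<^esub> g) \<otimes>\<^bsub>S\<^esub> (h \<otimes>\<^bsub>S\<^esub> g))"
      unfolding that(1)[symmetric] using that(2,3) by (simp add: S.m_assoc S.inv_mult_group del: S.l_inv)
    then show ?thesis using that(2,3) by simp
  qed
  show "xs i j a \<otimes>\<^bsub>S\<^esub> xs i j b = xs i j (a \<oplus> b)"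
    if "i \<in> {1..n}" "j \<in> {1..n}" "i \<noteq> j" "a \<in> peirce R e i j" "b \<in> peirce R e i j" for i j a b
  proof -
    have g: "(i, j, a) \<in> steinberg_gens R n e" "(i, j, b) \<in> steinberg_gens R n e"
      "(i, j, a \<oplus> b) \<in> steinberg_gens R n e"
      using that peirce_add[OF ring_axioms complete that(1,2,4,5)] by (simp_all add: gens_iff)
    have "([(True, i, j, a)] @ [(True, i, j, b)], [(True, i, j, a \<oplus> b)]) \<in> steinberg_rels R n e"
      using g unfolding steinberg_rels_def Let_def by blast
    from rels_eval[OF this] show ?thesis using g xs_closed that by (simp add: gens_iff)
  qed
  show "xs i j a \<otimes>\<^bsub>S\<^esub> xs k l b = xs k l b \<otimes>\<^bsub>S\<^esub> xs i j a"
    if "i \<in> {1..n}" "j \<in> {1..n}" "i \<noteq> j" "k \<in> {1..n}" "l \<in> {1..n}" "k \<noteq> l" "j \<noteq> k" "i \<noteq> l"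
      "a \<in> peirce R e i j" "b \<in> peirce R e k l" for i j k l a b
  proof -
    have g: "(i, j, a) \<in> steinberg_gens R n e" "(k, l, b) \<in> steinberg_gens R n e"
      using that by (simp_all add: gens_iff)
    have rel: "(comm_word [(True, i, j, a)] [(True, k, l, b)], []) \<in> steinberg_rels R n e"
      using g that unfolding steinberg_rels_def Let_def by blast
    have cl: "xs i j a \<in> carrier S" "xs k l b \<in> carrier S" using xs_closed that by blast+
    have "word_eval S (\<lambda>(i, j, a). xs i j a) (comm_word [(True, i, j, a)] [(True, k, l, b)]) = \<one>\<^bsub>S\<^esub>"
      using rels_eval[OF rel] g by (simp add: comm_word_def)
    then show ?thesis
      using word_eval_comm_word[OF S.is_group cl, of "\<lambda>(i, j, a). xs i j a" "(i, j, a)" "(k, l, b)"]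
        comm[of "xs i j a" "xs k l b" "\<one>\<^bsub>S\<^esub>"] cl by simp
  qed
  show "xs i j a \<otimes>\<^bsub>S\<^esub> xs j k b = xs i k (a \<otimes> b) \<otimes>\<^bsub>S\<^esub> (xs j k b \<otimes>\<^bsub>S\<^esub> xs i j a)"
    if "i \<in> {1..n}" "j \<in> {1..n}" "i \<noteq> j" "k \<in> {1..n}" "j \<noteq> k" "i \<noteq> k"
      "a \<in> peirce R e i j" "b \<in> peirce R e j k" for i j k a b
  proof -
    have ab: "a \<otimes> b \<in> peirce R e i k" using peirce_mult[OF ring_axioms complete] that by blast
    have g: "(i, j, a) \<in> steinberg_gens R n e" "(j, k, b) \<in> steinberg_gens R n e"
      "(i, k, a \<otimes> b) \<in> steinberg_gens R n e"
      using that ab by (simp_all add: gens_iff)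
    have rel: "(comm_word [(True, i, j, a)] [(True, j, k, b)], [(True, i, k, a \<otimes> b)]) \<in> steinberg_rels R n e"
      using g that unfolding steinberg_rels_def Let_def by blast
    have cl: "xs i j a \<in> carrier S" "xs j k b \<in> carrier S" "xs i k (a \<otimes> b) \<in> carrier S"
      using xs_closed that ab by blast+
    have "word_eval S (\<lambda>(i, j, a). xs i j a) (comm_word [(True, i, j, a)] [(True, j, k, b)]) = xs i k (a \<otimes> b)"
      using rels_eval[OF rel] g cl(3) by (simp add: comm_word_def)
    then show ?thesis
      using word_eval_comm_word[OF S.is_group cl(1,2), of "\<lambda>(i, j, a). xs i j a" "(i, j, a)" "(j, k, b)"]
        comm[of "xs i j a" "xs j k b" "xs i k (a \<otimes> b)"] cl by simp
  qed
qed (rule morita_peirce_generated)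

lemma carrier_S_subset:
  assumes H: "subgroup H S"
    and x: "\<And>i j a. \<lbrakk>i \<in> {1..n}; j \<in> {1..n}; i \<noteq> j; a \<in> peirce R e i j\<rbrakk> \<Longrightarrow> xs i j a \<in> H"
  shows "carrier S \<subseteq> H"
proof
  fix g assume "g \<in> carrier S"
  then obtain w where w: "w \<in> words (steinberg_gens R n e)"
      and g: "g = word_rel (steinberg_gens R n e) (steinberg_rels R n e) `` {w}"
    unfolding St_def by (rule presented_group_carrierE)
  have "word_eval S (\<lambda>(i, j, a). xs i j a) w \<in> H" using w
  proof (induction w)
    case Nil
    then show ?case using subgroup.one_closed[OF H] by simp
  next
    case (Cons l w)
    obtain b i j a where l: "l = (b, i, j, a)" by (metis surj_pair)
    have "xs i j a \<in> H" using Cons.prems x by (auto simp: l gens_iff)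
    then show ?case
      using Cons subgroup.m_closed[OF H] subgroup.m_inv_closed[OF H] by (auto simp: l)
  qed
  then show "g \<in> H" using g word_eval_st_x[OF ring_axioms complete w] by simp
qed

lemma equalizer_subgroup:
  assumes \<phi>: "\<phi> \<in> auto S" and \<psi>: "\<psi> \<in> auto S"
  shows "subgroup {y \<in> carrier S. \<phi> y = \<psi> y} S"
proof (rule S.subgroupI)
  have "\<one>\<^bsub>S\<^esub> \<in> {y \<in> carrier S. \<phi> y = \<psi> y}"
    using hom_one[OF S.auto_apply(3)[OF \<phi>] S.is_group S.is_group]
      hom_one[OF S.auto_apply(3)[OF \<psi>] S.is_group S.is_group] by simp
  then show "{y \<in> carrier S. \<phi> y = \<psi> y} \<noteq> {}" by blast
qed (use S.auto_apply(2)[OF \<phi>] S.auto_apply(2)[OF \<psi>] S.auto_inv[OF \<phi>] S.auto_inv[OF \<psi>] in simp_all)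

lemma S_hom_eqI:
  assumes \<phi>: "\<phi> \<in> auto S" and \<psi>: "\<psi> \<in> auto S"
    and eq: "\<And>i j a. \<lbrakk>i \<in> {1..n}; j \<in> {1..n}; i \<noteq> j; a \<in> peirce R e i j\<rbrakk> \<Longrightarrow> \<phi> (xs i j a) = \<psi> (xs i j a)"
  shows "\<phi> = \<psi>"
proof -
  let ?H = "{y \<in> carrier S. \<phi> y = \<psi> y}"
  have "subgroup ?H S" by (rule equalizer_subgroup[OF \<phi> \<psi>])
  then have "carrier S \<subseteq> ?H" by (rule carrier_S_subset) (use eq xs_closed in auto)
  then show ?thesis by (intro S.auto_eqI[OF \<phi> \<psi>]) auto
qed

text \<open>Automorphisms that agree up to central elements agree on commutators.\<close>

lemma S_auto_eqI_central:
  assumes \<phi>: "\<phi> \<in> auto S" and \<psi>: "\<psi> \<in> auto S"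
    and central: "\<And>i j a y. \<lbrakk>i \<in> {1..n}; j \<in> {1..n}; i \<noteq> j; a \<in> peirce R e i j; y \<in> carrier S\<rbrakk> \<Longrightarrow>
      (\<phi> (xs i j a) \<otimes>\<^bsub>S\<^esub> inv\<^bsub>S\<^esub> \<psi> (xs i j a)) \<otimes>\<^bsub>S\<^esub> y = y \<otimes>\<^bsub>S\<^esub> (\<phi> (xs i j a) \<otimes>\<^bsub>S\<^esub> inv\<^bsub>S\<^esub> \<psi> (xs i j a))"
  shows "\<phi> = \<psi>"
proof (rule S_hom_eqI[OF \<phi> \<psi>])
  fix i j a assume ij: "i \<in> {1..n}" "j \<in> {1..n}" "i \<noteq> j" "a \<in> peirce R e i j"
  obtain k where k: "k \<in> {1..n}" "k \<noteq> i" "k \<noteq> j" using third_index[OF n_ge_3] by blast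
  let ?H = "{y \<in> carrier S. \<phi> y = \<psi> y}"
  note ap = S.auto_apply[OF \<phi>] and aq = S.auto_apply[OF \<psi>]
  have H: "subgroup ?H S" by (rule equalizer_subgroup[OF \<phi> \<psi>])
  have "xs i j a \<in> ?H"
  proof (rule SR.x_in_subgroup_if_products[OF H ij(1,2) k(1) ij(3,4)])
    fix b c assume b: "b \<in> peirce R e i k" and c: "c \<in> peirce R e k j"
    let ?u = "xs i k b" and ?v = "xs k j c" and ?w = "xs i j (b \<otimes> c)"
    have bc: "b \<otimes> c \<in> peirce R e i j" using peirce_mult[OF ring_axioms complete] ij k b c by blast
    have cl: "?u \<in> carrier S" "?v \<in> carrier S" "?w \<in> carrier S" using xs_closed ij k b c bc by auto
    have rel: "?u \<otimes>\<^bsub>S\<^esub> ?v = ?w \<otimes>\<^bsub>S\<^esub> (?v \<otimes>\<^bsub>S\<^esub> ?u)" using SR.x_mult[of i k j b c] ij k b c by auto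
    \<comment> \<open>The discrepancy of the two automorphisms. It is central at the factors
      \<open>?u\<close> and \<open>?v\<close>, whose commutator is \<open>?w\<close>.\<close>
    let ?z = "\<lambda>y. \<phi> y \<otimes>\<^bsub>S\<^esub> inv\<^bsub>S\<^esub> \<psi> y"
    have zc: "?z y \<in> carrier S" "?z y \<otimes>\<^bsub>S\<^esub> \<psi> y = \<phi> y" if "y \<in> carrier S" for y
      using ap(1)[OF that] aq(1)[OF that] by (simp_all add: S.m_assoc)
    have zu: "?z ?u \<otimes>\<^bsub>S\<^esub> y = y \<otimes>\<^bsub>S\<^esub> ?z ?u" and zv: "?z ?v \<otimes>\<^bsub>S\<^esub> y = y \<otimes>\<^bsub>S\<^esub> ?z ?v" if "y \<in> carrier S" for y
      using central[of i k b y] central[of k j c y] ij k b c that by auto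
    have "\<phi> ?w = \<psi> ?w"
    proof (rule S.eq_if_central_commutator[OF zc(1)[OF cl(1)] zc(1)[OF cl(2)] aq(1)[OF cl(1)] aq(1)[OF cl(2)]
          ap(1)[OF cl(3)] aq(1)[OF cl(3)] zu zv])
      show "\<psi> ?u \<otimes>\<^bsub>S\<^esub> \<psi> ?v = \<psi> ?w \<otimes>\<^bsub>S\<^esub> (\<psi> ?v \<otimes>\<^bsub>S\<^esub> \<psi> ?u)"
        using arg_cong[OF rel, of \<psi>] cl by (simp add: aq)
      show "?z ?u \<otimes>\<^bsub>S\<^esub> \<psi> ?u \<otimes>\<^bsub>S\<^esub> (?z ?v \<otimes>\<^bsub>S\<^esub> \<psi> ?v) =
          \<phi> ?w \<otimes>\<^bsub>S\<^esub> (?z ?v \<otimes>\<^bsub>S\<^esub> \<psi> ?v \<otimes>\<^bsub>S\<^esub> (?z ?u \<otimes>\<^bsub>S\<^esub> \<psi> ?u))"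
        unfolding zc(2)[OF cl(1)] zc(2)[OF cl(2)] using arg_cong[OF rel, of \<phi>] cl by (simp add: ap)
    qed
    then show "?w \<in> ?H" using cl by simp
  qed
  then show "\<phi> (xs i j a) = \<psi> (xs i j a)" by simp
qed

lemma st_mult: "g \<in> carrier S \<Longrightarrow> h \<in> carrier S \<Longrightarrow> st R n e (g \<otimes>\<^bsub>S\<^esub> h) = st R n e g \<otimes> st R n e h"
  using st_hom[OF ring_axioms complete] by (auto simp: hom_def units_of_mult)

lemma st_Units: "g \<in> carrier S \<Longrightarrow> st R n e g \<in> Units R"
  using st_hom[OF ring_axioms complete] by (auto simp: hom_def units_of_carrier)

lemma st_one: "st R n e \<one>\<^bsub>S\<^esub> = \<one>"
  using hom_one[OF st_hom[OF ring_axioms complete] S.is_group GL.is_group] by (simp add: units_of_one)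

lemma st_inv: "g \<in> carrier S \<Longrightarrow> st R n e (inv\<^bsub>S\<^esub> g) = inv (st R n e g)"
  using group_hom.hom_inv[OF group_hom.intro[OF S.is_group GL.is_group
      group_hom_axioms.intro[OF st_hom[OF ring_axioms complete]]], of g] st_Units[of g]
  by (simp add: units_of_inv)

section \<open>The diagonal group acts by automorphisms\<close>

lemma diagonal_action_extensional: "diagonal_action R n e h \<in> extensional (carrier S)"
  by (simp add: diagonal_action_def presented_lift_def St_def)

lemma diagonal_action_closed:
  "h \<in> Diag \<Longrightarrow> y \<in> carrier S \<Longrightarrow> diagonal_action R n e h y \<in> carrier S"
  using diagonal_action_hom[OF ring_axioms complete] by (auto simp: hom_def)

lemma diagonal_action_xs:
  "\<lbrakk>h \<in> Diag; i \<in> {1..n}; j \<in> {1..n}; i \<noteq> j; a \<in> peirce R e i j\<rbrakk> \<Longrightarrow>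
    diagonal_action R n e h (xs i j a) = xs i j (h \<otimes> a \<otimes> inv h)"
  by (rule diagonal_action_st_x[OF ring_axioms complete])

lemma diagonal_action_mult:
  assumes g: "g \<in> Diag" and h: "h \<in> Diag"
    and gh: "g \<otimes> h \<in> Diag" and y: "y \<in> carrier S"
  shows "diagonal_action R n e (g \<otimes> h) y = diagonal_action R n e g (diagonal_action R n e h y)"
proof -
  note hom = diagonal_action_hom[OF ring_axioms complete]
  let ?\<phi> = "diagonal_action R n e (g \<otimes> h)" and ?\<psi> = "\<lambda>y. diagonal_action R n e g (diagonal_action R n e h y)"
  let ?H = "{y \<in> carrier S. ?\<phi> y = ?\<psi> y}"
  interpret \<phi>: group_hom S S ?\<phi> by unfold_locales (rule hom[OF gh])
  have "?\<psi> \<in> hom S S"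
    using hom_compose[OF hom[OF h] hom[OF g]] by (simp add: comp_def)
  then interpret \<psi>: group_hom S S ?\<psi> by unfold_locales
  have "subgroup ?H S"
    by (rule S.subgroupI) (use \<phi>.hom_one \<psi>.hom_one in auto)
  then have "carrier S \<subseteq> ?H"
  proof (rule carrier_S_subset)
    fix i j a assume ij: "i \<in> {1..n}" "j \<in> {1..n}" "i \<noteq> j" "a \<in> peirce R e i j"
    have gU: "g \<in> Units R" "h \<in> Units R" using g h diagonal_groupD by auto
    have "(g \<otimes> h) \<otimes> a \<otimes> inv (g \<otimes> h) = g \<otimes> (h \<otimes> a \<otimes> inv h) \<otimes> inv g"
      using gU ij peirceD(1)[OF ij(1,2,4)] by (simp add: inv_mult_Units m_assoc Units_closed)
    moreover have "h \<otimes> a \<otimes> inv h \<in> peirce R e i j"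
      by (rule diagonal_conj[OF ring_axioms complete h ij(1,2,4)])
    ultimately show "xs i j a \<in> ?H" using ij g h gh by (simp add: diagonal_action_xs xs_closed)
  qed
  then show ?thesis using y by blast
qed

lemma diagonal_action_one:
  assumes "y \<in> carrier S" shows "diagonal_action R n e \<one> y = y"
proof -
  have 1: "\<one> \<in> Diag" by (rule diagonal_groupI) auto
  interpret \<phi>: group_hom S S "diagonal_action R n e \<one>"
    by unfold_locales (rule diagonal_action_hom[OF ring_axioms complete 1])
  let ?H = "{y \<in> carrier S. diagonal_action R n e \<one> y = y}"
  have "subgroup ?H S"
    by (rule S.subgroupI) (use \<phi>.hom_one in auto)
  then have "carrier S \<subseteq> ?H"
  proof (rule carrier_S_subset)
    fix i j a assume ij: "i \<in> {1..n}" "j \<in> {1..n}" "i \<noteq> j" "a \<in> peirce R e i j"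
    then show "xs i j a \<in> ?H" using 1 peirceD(1)[OF ij(1,2,4)] by (simp add: diagonal_action_xs xs_closed)
  qed
  then show ?thesis using assms by blast
qed

lemma diagonal_action_auto:
  assumes h: "h \<in> Diag" shows "diagonal_action R n e h \<in> auto S"
proof (rule autoI)
  note h' = diagonal_group_simps(4)[OF h]
  have hU: "h \<in> Units R" using diagonal_groupD(1)[OF h] .
  have one: "\<one> \<in> Diag" by (rule diagonal_groupI) auto
  show "diagonal_action R n e h \<in> hom S S" by (rule diagonal_action_hom[OF ring_axioms complete h])
  show "diagonal_action R n e (inv h) \<in> carrier S \<rightarrow> carrier S" using diagonal_action_closed[OF h'] by blast
  fix y assume y: "y \<in> carrier S"
  show "diagonal_action R n e (inv h) (diagonal_action R n e h y) = y"
    using diagonal_action_mult[OF h' h _ y] diagonal_action_one[OF y] one hU by simp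
  show "diagonal_action R n e h (diagonal_action R n e (inv h) y) = y"
    using diagonal_action_mult[OF h h' _ y] diagonal_action_one[OF y] one hU by simp
qed (rule diagonal_action_extensional)

section \<open>The product of the automorphism group of St(R) with GL(R)\<close>

definition "W = AutoGroup S \<times>\<times> GL R"

text \<open>The first components of \<open>\<kappa>\<close> and \<open>\<delta>\<close> are dictated
  by the goal: a graph containing both images yields the Peiffer identity from the inner
  automorphisms and consistency from the diagonal action.\<close>

definition \<kappa> where "\<kappa> g = (conj_auto S g, st R n e g)"

definition \<delta> where "\<delta> h = (diagonal_action R n e h, h)"

lemma carrier_W: "w \<in> carrier W \<longleftrightarrow> fst w \<in> auto S \<and> snd w \<in> Units R"
  by (cases w) (simp add: W_def S.AutoGroup_simps(1) units_of_carrier)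

lemma W_mult: "fst (v \<otimes>\<^bsub>W\<^esub> w) = fst v \<otimes>\<^bsub>AutoGroup S\<^esub> fst w" "snd (v \<otimes>\<^bsub>W\<^esub> w) = snd v \<otimes> snd w"
  by (simp_all add: W_def mult_DirProd' units_of_mult)

lemma W_one: "\<one>\<^bsub>W\<^esub> = (\<lambda>y\<in>carrier S. y, \<one>)"
  by (simp add: W_def S.AutoGroup_simps units_of_one)

lemma W_mult_apply:
  "v \<in> carrier W \<Longrightarrow> w \<in> carrier W \<Longrightarrow> y \<in> carrier S \<Longrightarrow> fst (v \<otimes>\<^bsub>W\<^esub> w) y = fst v (fst w y)"
  by (simp add: W_mult carrier_W S.AutoGroup_simps compose_eq)

lemma W_group: "group W"
  unfolding W_def by (rule DirProd_group[OF A.is_group GL.is_group])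

lemma W_eqI:
  assumes "v \<in> carrier W" "w \<in> carrier W" "snd v = snd w" "\<And>y. y \<in> carrier S \<Longrightarrow> fst v y = fst w y"
  shows "v = w"
  using assms S.auto_eqI[of "fst v" "fst w"] by (auto simp: carrier_W prod_eq_iff)

lemma \<kappa>_closed: "g \<in> carrier S \<Longrightarrow> \<kappa> g \<in> carrier W"
  by (simp add: carrier_W \<kappa>_def S.conj_auto_in_auto st_Units)

lemma \<delta>_closed': "h \<in> Diag \<Longrightarrow> \<delta> h \<in> carrier W"
  using diagonal_groupD(1) diagonal_action_auto by (simp add: carrier_W \<delta>_def)

lemma \<kappa>_mult: "g \<in> carrier S \<Longrightarrow> h \<in> carrier S \<Longrightarrow> \<kappa> (g \<otimes>\<^bsub>S\<^esub> h) = \<kappa> g \<otimes>\<^bsub>W\<^esub> \<kappa> h"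
  using S.conj_auto_hom by (simp add: prod_eq_iff W_mult \<kappa>_def hom_def st_mult)

lemma \<kappa>_hom: "\<kappa> \<in> hom S W"
  by (rule homI) (simp_all only: \<kappa>_closed \<kappa>_mult)

lemma \<delta>_xs:
  assumes h: "h \<in> Diag"
    and ij: "i \<in> {1..n}" "j \<in> {1..n}" "i \<noteq> j" "a \<in> peirce R e i j"
  shows "\<delta> h \<otimes>\<^bsub>W\<^esub> \<kappa> (xs i j a) = \<kappa> (xs i j (h \<otimes> a \<otimes> inv h)) \<otimes>\<^bsub>W\<^esub> \<delta> h"
proof -
  let ?b = "h \<otimes> a \<otimes> inv h"
  have b: "?b \<in> peirce R e i j" by (rule diagonal_conj[OF ring_axioms complete h ij(1,2,4)])
  have xc: "xs i j a \<in> carrier S" "xs i j ?b \<in> carrier S" using xs_closed ij b by blast+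
  have hU: "h \<in> Units R" and ac: "a \<in> carrier R" using diagonal_groupD(1)[OF h] peirceD(1)[OF ij(1,2,4)] by auto
  note \<kappa>c = \<kappa>_closed[OF xc(1)] \<kappa>_closed[OF xc(2)] \<delta>_closed'[OF h]
  interpret Wg: group W by (rule W_group)
  show ?thesis
  proof (rule W_eqI)
    have "h \<otimes> (\<one> \<oplus> a) = (\<one> \<oplus> ?b) \<otimes> h" using hU ac by (simp add: Units_closed l_distr r_distr m_assoc)
    then show "snd (\<delta> h \<otimes>\<^bsub>W\<^esub> \<kappa> (xs i j a)) = snd (\<kappa> (xs i j ?b) \<otimes>\<^bsub>W\<^esub> \<delta> h)"
      using st_st_x[OF ring_axioms complete ij] st_st_x[OF ring_axioms complete ij(1-3) b]
      by (simp add: W_mult \<delta>_def \<kappa>_def)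
    fix y assume y: "y \<in> carrier S"
    show "fst (\<delta> h \<otimes>\<^bsub>W\<^esub> \<kappa> (xs i j a)) y = fst (\<kappa> (xs i j ?b) \<otimes>\<^bsub>W\<^esub> \<delta> h) y"
      unfolding W_mult_apply[OF \<kappa>c(3,1) y] W_mult_apply[OF \<kappa>c(2,3) y]
      using y xc S.auto_inv[OF diagonal_action_auto[OF h]] S.auto_apply[OF diagonal_action_auto[OF h]]
      by (simp add: \<delta>_def \<kappa>_def S.conj_auto_apply diagonal_action_xs[OF h ij, symmetric])
  qed (use \<kappa>c in \<open>simp_all only: Wg.m_closed\<close>)
qed

text \<open>Commuting with \<open>\<kappa>\<close> of a root element \<open>x\<close> means that
  \<open>x\<close> and its image under the automorphism \<open>fst w\<close> induce the same
  conjugation, since that automorphism is surjective. They differ by a central factor, and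
  \<open>S_auto_eqI_central\<close> compares the automorphism with the identity.\<close>

lemma W_centralizer_faithful:
  assumes w: "w \<in> carrier W" "snd w = \<one>"
    and comm: "\<And>i j a. \<lbrakk>i \<in> {1..n}; j \<in> {1..n}; i \<noteq> j; a \<in> peirce R e i j\<rbrakk> \<Longrightarrow>
        w \<otimes>\<^bsub>W\<^esub> \<kappa> (xs i j a) = \<kappa> (xs i j a) \<otimes>\<^bsub>W\<^esub> w"
  shows "w = \<one>\<^bsub>W\<^esub>"
proof -
  interpret Wg: group W by (rule W_group)
  let ?\<phi> = "fst w"
  have \<phi>: "?\<phi> \<in> auto S" using w by (simp add: carrier_W)
  note ap = S.auto_apply[OF \<phi>]
  have one: "(\<lambda>y\<in>carrier S. y) \<in> auto S" by (rule S.id_in_auto)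
  have "?\<phi> = (\<lambda>y\<in>carrier S. y)"
  proof (rule S_auto_eqI_central[OF \<phi> one])
    fix i j a y assume ij: "i \<in> {1..n}" "j \<in> {1..n}" "i \<noteq> j" "a \<in> peirce R e i j" and y: "y \<in> carrier S"
    let ?x = "xs i j a"
    have xc: "?x \<in> carrier S" using xs_closed ij by blast
    have \<phi>x: "?\<phi> ?x \<in> carrier S" using ap xc by blast
    \<comment> \<open>Conjugation by \<open>?x\<close> takes \<open>y'\<close> to \<open>y\<close>.
      Surjectivity writes \<open>y'\<close> as the image of some \<open>v\<close>, and the
      commutation is evaluated at \<open>v\<close>.\<close>
    define y' where "y' = inv\<^bsub>S\<^esub> ?x \<otimes>\<^bsub>S\<^esub> y \<otimes>\<^bsub>S\<^esub> ?x"
    have y': "y' \<in> carrier S" using xc y by (simp add: y'_def)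
    obtain v where v: "v \<in> carrier S" "y' = ?\<phi> v" using S.auto_surj[OF \<phi> y'] .
    have "fst (w \<otimes>\<^bsub>W\<^esub> \<kappa> ?x) v = fst (\<kappa> ?x \<otimes>\<^bsub>W\<^esub> w) v" using comm[OF ij] by simp
    then have "?\<phi> ?x \<otimes>\<^bsub>S\<^esub> y' \<otimes>\<^bsub>S\<^esub> inv\<^bsub>S\<^esub> ?\<phi> ?x = ?x \<otimes>\<^bsub>S\<^esub> y' \<otimes>\<^bsub>S\<^esub> inv\<^bsub>S\<^esub> ?x"
      unfolding W_mult_apply[OF w(1) \<kappa>_closed[OF xc] v(1)] W_mult_apply[OF \<kappa>_closed[OF xc] w(1) v(1)]
      using v xc ap S.auto_inv[OF \<phi>] by (simp add: \<kappa>_def S.conj_auto_apply)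
    also have "\<dots> = y" using xc y by (simp add: y'_def S.m_assoc) (simp add: S.m_assoc[symmetric])
    finally have "?\<phi> ?x \<otimes>\<^bsub>S\<^esub> inv\<^bsub>S\<^esub> ?x \<otimes>\<^bsub>S\<^esub> y \<otimes>\<^bsub>S\<^esub> (?x \<otimes>\<^bsub>S\<^esub> inv\<^bsub>S\<^esub> ?\<phi> ?x) = y"
      using xc y \<phi>x by (simp add: y'_def S.m_assoc)
    then have "?\<phi> ?x \<otimes>\<^bsub>S\<^esub> inv\<^bsub>S\<^esub> ?x \<otimes>\<^bsub>S\<^esub> y \<otimes>\<^bsub>S\<^esub> inv\<^bsub>S\<^esub> (?\<phi> ?x \<otimes>\<^bsub>S\<^esub> inv\<^bsub>S\<^esub> ?x) = y"
      using xc \<phi>x by (simp add: S.inv_mult_group)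
    then have "?\<phi> ?x \<otimes>\<^bsub>S\<^esub> inv\<^bsub>S\<^esub> ?x \<otimes>\<^bsub>S\<^esub> y = y \<otimes>\<^bsub>S\<^esub> (?\<phi> ?x \<otimes>\<^bsub>S\<^esub> inv\<^bsub>S\<^esub> ?x)"
      using xc y \<phi>x S.inv_solve_right'[of y "?\<phi> ?x \<otimes>\<^bsub>S\<^esub> inv\<^bsub>S\<^esub> ?x \<otimes>\<^bsub>S\<^esub> y" "?\<phi> ?x \<otimes>\<^bsub>S\<^esub> inv\<^bsub>S\<^esub> ?x"] by simp
    then show "?\<phi> ?x \<otimes>\<^bsub>S\<^esub> inv\<^bsub>S\<^esub> (\<lambda>y\<in>carrier S. y) ?x \<otimes>\<^bsub>S\<^esub> y =
        y \<otimes>\<^bsub>S\<^esub> (?\<phi> ?x \<otimes>\<^bsub>S\<^esub> inv\<^bsub>S\<^esub> (\<lambda>y\<in>carrier S. y) ?x)" using xc by simp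
  qed
  then show ?thesis using w by (simp add: prod_eq_iff W_one)
qed

sublocale F: faithful_steinberg_family R n e W "\<lambda>i j a. \<kappa> (xs i j a)" \<delta> snd
proof -
  interpret Wg: group W by (rule W_group)
  have x: "\<kappa> (xs i j a) \<otimes>\<^bsub>W\<^esub> \<kappa> (xs k l b) = \<kappa> (xs i j a \<otimes>\<^bsub>S\<^esub> xs k l b)"
    if "i \<in> {1..n}" "j \<in> {1..n}" "i \<noteq> j" "k \<in> {1..n}" "l \<in> {1..n}" "k \<noteq> l"
      "a \<in> peirce R e i j" "b \<in> peirce R e k l" for i j k l a b
    using \<kappa>_mult[of "xs i j a" "xs k l b"] xs_closed that by simp
  show "faithful_steinberg_family R n e W (\<lambda>i j a. \<kappa> (xs i j a)) \<delta> snd"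
  proof unfold_locales
    fix i j a b
    assume "i \<in> {1..n}" "j \<in> {1..n}" "i \<noteq> j" "a \<in> peirce R e i j" "b \<in> peirce R e i j"
    then show "\<kappa> (xs i j a) \<otimes>\<^bsub>W\<^esub> \<kappa> (xs i j b) = \<kappa> (xs i j (a \<oplus> b))" by (simp add: x SR.x_add)
  next
    fix i j k l a b
    assume *: "i \<in> {1..n}" "j \<in> {1..n}" "i \<noteq> j" "k \<in> {1..n}" "l \<in> {1..n}" "k \<noteq> l" "j \<noteq> k" "i \<noteq> l"
      "a \<in> peirce R e i j" "b \<in> peirce R e k l"
    show "\<kappa> (xs i j a) \<otimes>\<^bsub>W\<^esub> \<kappa> (xs k l b) = \<kappa> (xs k l b) \<otimes>\<^bsub>W\<^esub> \<kappa> (xs i j a)"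
      using x[of i j k l a b] x[of k l i j b a] SR.x_comm[OF *] * by simp
  next
    fix i j k a b
    assume *: "i \<in> {1..n}" "j \<in> {1..n}" "i \<noteq> j" "k \<in> {1..n}" "j \<noteq> k" "i \<noteq> k"
      "a \<in> peirce R e i j" "b \<in> peirce R e j k"
    have ab: "a \<otimes> b \<in> peirce R e i k" using peirce_mult[OF ring_axioms complete] * by blast
    show "\<kappa> (xs i j a) \<otimes>\<^bsub>W\<^esub> \<kappa> (xs j k b) = \<kappa> (xs i k (a \<otimes> b)) \<otimes>\<^bsub>W\<^esub> (\<kappa> (xs j k b) \<otimes>\<^bsub>W\<^esub> \<kappa> (xs i j a))"
      using x[of i j j k a b] x[of j k i j b a] SR.x_mult[OF *] * ab
        \<kappa>_mult[of "xs i k (a \<otimes> b)" "xs j k b \<otimes>\<^bsub>S\<^esub> xs i j a"] xs_closed by simp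
  next
    show "\<delta> \<in> hom (diagonal_group R n e) W"
    proof (rule homI)
      fix g h assume gh: "g \<in> Diag" "h \<in> Diag"
      have m: "g \<otimes> h \<in> Diag"
        using D.m_closed[OF gh] by (simp add: diagonal_group_simps(2)[OF gh(2)])
      have "\<delta> (g \<otimes> h) = \<delta> g \<otimes>\<^bsub>W\<^esub> \<delta> h"
      proof (rule W_eqI)
        fix y assume "y \<in> carrier S"
        then show "fst (\<delta> (g \<otimes> h)) y = fst (\<delta> g \<otimes>\<^bsub>W\<^esub> \<delta> h) y"
          using W_mult_apply[OF \<delta>_closed'[OF gh(1)] \<delta>_closed'[OF gh(2)]] diagonal_action_mult[OF gh m]
          by (simp add: \<delta>_def)
      qed (use \<delta>_closed'[OF m] Wg.m_closed[OF \<delta>_closed'[OF gh(1)] \<delta>_closed'[OF gh(2)]]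
          in \<open>simp_all only: W_mult\<close>, simp add: \<delta>_def)
      then show "\<delta> (g \<otimes>\<^bsub>diagonal_group R n e\<^esub> h) = \<delta> g \<otimes>\<^bsub>W\<^esub> \<delta> h"
        by (simp only: diagonal_group_simps(2)[OF gh(2)])
    qed (rule \<delta>_closed')
  next
    fix h i j a
    assume "h \<in> Diag" "i \<in> {1..n}" "j \<in> {1..n}" "i \<noteq> j" "a \<in> peirce R e i j"
    then show "\<delta> h \<otimes>\<^bsub>W\<^esub> \<kappa> (xs i j a) = \<kappa> (xs i j (h \<otimes> a \<otimes> inv h)) \<otimes>\<^bsub>W\<^esub> \<delta> h" by (rule \<delta>_xs)
  next
    show "snd \<in> hom W (GL R)" by (auto simp: hom_def carrier_W W_mult units_of_mult units_of_carrier)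
  next
    fix i j a assume "i \<in> {1..n}" "j \<in> {1..n}" "i \<noteq> j" "a \<in> peirce R e i j"
    then show "\<kappa> (xs i j a) \<in> carrier W" "snd (\<kappa> (xs i j a)) = \<one> \<oplus> a"
      using \<kappa>_closed xs_closed st_st_x[OF ring_axioms complete] by (blast, simp add: \<kappa>_def)
  next
    fix w assume "w \<in> carrier W" "snd w = \<one>"
      "\<And>i j a. \<lbrakk>i \<in> {1..n}; j \<in> {1..n}; i \<noteq> j; a \<in> peirce R e i j\<rbrakk> \<Longrightarrow>
        w \<otimes>\<^bsub>W\<^esub> \<kappa> (xs i j a) = \<kappa> (xs i j a) \<otimes>\<^bsub>W\<^esub> w"
    then show "w = \<one>\<^bsub>W\<^esub>" by (rule W_centralizer_faithful)
  qed (use morita_peirce_generated n_ge_3 in \<open>auto simp: \<delta>_def\<close>)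
qed

lemma \<kappa>_generated: "g \<in> carrier S \<Longrightarrow> \<kappa> g \<in> F.generated"
proof -
  have "subgroup {g \<in> carrier S. \<kappa> g \<in> F.generated} S"
  proof -
    interpret \<kappa>: group_hom S W \<kappa>
      by (intro group_hom.intro S.is_group W_group group_hom_axioms.intro \<kappa>_hom)
    note G = F.generated_subgroup
    show ?thesis
      by (rule S.subgroupI)
        (use subgroup.one_closed[OF G] subgroup.m_closed[OF G] subgroup.m_inv_closed[OF G] \<kappa>.hom_one
          in \<open>auto simp: \<kappa>_mult\<close>)
  qed
  then have "carrier S \<subseteq> {g \<in> carrier S. \<kappa> g \<in> F.generated}"
    by (rule carrier_S_subset) (use xs_closed F.x_generated in auto)
  then show "g \<in> carrier S \<Longrightarrow> \<kappa> g \<in> F.generated" by blast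
qed

text \<open>The identity is multiplicative in \<open>w\<close>, so generators suffice: for
  \<open>\<kappa> g\<close> it holds because \<open>st\<close> is a homomorphism, and for
  \<open>\<delta> h\<close> it is checked on root elements.\<close>

lemma generated_equivariant:
  assumes w: "w \<in> F.generated"
  shows "\<forall>y\<in>carrier S. st R n e (fst w y) = snd w \<otimes> st R n e y \<otimes> inv (snd w)"
proof -
  let ?P = "\<lambda>w. \<forall>y\<in>carrier S. st R n e (fst w y) = snd w \<otimes> st R n e y \<otimes> inv (snd w)"
  note ro = F.root_elements_closed[OF order_refl]
  have gens: "F.root_elements F.root_pairs \<union> \<delta> ` Diag \<subseteq> carrier W"
    using ro \<delta>_closed' by blast
  have \<kappa>P: "?P (\<kappa> g)" if "g \<in> carrier S" for g
    using that st_Units[OF that] by (auto simp: \<kappa>_def S.conj_auto_apply st_mult st_inv)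
  have \<delta>P: "?P (\<delta> h)" if h: "h \<in> Diag" for h
  proof -
    have hU: "h \<in> Units R" using diagonal_groupD(1)[OF h] .
    have hc: "h \<in> carrier R" "inv h \<in> carrier R" using hU by auto
    note ap = S.auto_apply[OF diagonal_action_auto[OF h]] S.auto_inv[OF diagonal_action_auto[OF h]]
    let ?d = "diagonal_action R n e h"
    \<comment> \<open>With \<open>inv h\<close> moved to the other side, closure under products only
      exchanges neighbouring factors.\<close>
    let ?H = "{y \<in> carrier S. st R n e (?d y) \<otimes> h = h \<otimes> st R n e y}"
    have "subgroup ?H S"
    proof (rule S.subgroupI)
      show "?H \<noteq> {}"
        using hom_one[OF ap(3) S.is_group S.is_group] hc S.one_closed by (auto simp: st_one)
    next
      fix y assume "y \<in> ?H"
      then have y: "y \<in> carrier S" "st R n e (?d y) \<otimes> h = h \<otimes> st R n e y" by auto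
      note dU = st_Units[OF y(1)] st_Units[OF ap(1)[OF y(1)]]
      have "inv (st R n e (?d y)) \<otimes> h = h \<otimes> inv (st R n e y)"
        by (rule intertwine_inv[OF dU(2,1) hc(1) y(2)])
      then show "inv\<^bsub>S\<^esub> y \<in> ?H" using y ap by (simp add: st_inv)
    next
      fix y z assume "y \<in> ?H" "z \<in> ?H"
      then have y: "y \<in> carrier S" "st R n e (?d y) \<otimes> h = h \<otimes> st R n e y"
        and z: "z \<in> carrier S" "st R n e (?d z) \<otimes> h = h \<otimes> st R n e z" by auto
      note dc = st_Units[OF y(1), THEN Units_closed] st_Units[OF ap(1)[OF y(1)], THEN Units_closed]
        st_Units[OF z(1), THEN Units_closed] st_Units[OF ap(1)[OF z(1)], THEN Units_closed]
      have "st R n e (?d y) \<otimes> st R n e (?d z) \<otimes> h = st R n e (?d y) \<otimes> (st R n e (?d z) \<otimes> h)"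
        using dc hc by (simp add: m_assoc)
      also have "\<dots> = (st R n e (?d y) \<otimes> h) \<otimes> st R n e z" unfolding z(2) using dc hc by (simp add: m_assoc)
      also have "\<dots> = h \<otimes> (st R n e y \<otimes> st R n e z)" unfolding y(2) using dc hc by (simp add: m_assoc)
      finally show "y \<otimes>\<^bsub>S\<^esub> z \<in> ?H" using y(1) z(1) ap by (simp add: st_mult)
    qed auto
    then have "carrier S \<subseteq> ?H"
    proof (rule carrier_S_subset)
      fix i j a assume ij: "i \<in> {1..n}" "j \<in> {1..n}" "i \<noteq> j" "a \<in> peirce R e i j"
      have b: "h \<otimes> a \<otimes> inv h \<in> peirce R e i j" by (rule diagonal_conj[OF ring_axioms complete h ij(1,2,4)])
      have "(\<one> \<oplus> h \<otimes> a \<otimes> inv h) \<otimes> h = h \<otimes> (\<one> \<oplus> a)"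
        using hU hc peirceD(1)[OF ij(1,2,4)] by (simp add: l_distr r_distr m_assoc)
      then show "xs i j a \<in> ?H"
        using ij b h by (simp add: diagonal_action_xs xs_closed st_st_x[OF ring_axioms complete])
    qed
    have "st R n e (?d y) = h \<otimes> st R n e y \<otimes> inv h" if y: "y \<in> carrier S" for y
    proof -
      have "h \<otimes> st R n e y \<otimes> inv h = st R n e (?d y) \<otimes> h \<otimes> inv h" using subsetD[OF \<open>carrier S \<subseteq> ?H\<close> y] by simp
      also have "\<dots> = st R n e (?d y) \<otimes> (h \<otimes> inv h)"
        using hc st_Units[OF ap(1)[OF y], THEN Units_closed] by (simp only: m_assoc)
      finally show ?thesis using hU st_Units[OF ap(1)[OF y], THEN Units_closed] by simp
    qed
    then show ?thesis by (simp add: \<delta>_def)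
  qed
  show ?thesis using w unfolding F.generated_def
  proof (rule F.W.generate_left_induct[OF gens])
    fix s assume "s \<in> F.root_elements F.root_pairs \<union> \<delta> ` Diag"
    then show "inv\<^bsub>W\<^esub> s \<in> F.root_elements F.root_pairs \<union> \<delta> ` Diag"
      using F.root_elements_inv[OF order_refl, of s] F.\<delta>_inv diagonal_group_simps(4) by auto
  next
    show "?P \<one>\<^bsub>W\<^esub>" using st_Units Units_closed by (auto simp: W_one)
  next
    fix s w assume s: "s \<in> F.root_elements F.root_pairs \<union> \<delta> ` Diag"
      and w: "w \<in> generate W (F.root_elements F.root_pairs \<union> \<delta> ` Diag)" "?P w"
    have c: "s \<in> carrier W" "w \<in> carrier W" using s gens F.W.generate_in_carrier[OF gens w(1)] by auto
    then have U: "snd s \<in> Units R" "snd w \<in> Units R" "fst w \<in> auto S" by (auto simp: carrier_W)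
    have "?P s" using s \<kappa>P \<delta>P xs_closed by (auto simp: F.root_elements_def F.root_pairs_def)
    then show "?P (s \<otimes>\<^bsub>W\<^esub> w)"
      using w(2) U S.auto_apply(1)[OF U(3)] st_Units Units_closed
      by (auto simp: W_mult_apply[OF c] W_mult(2) inv_mult_Units m_assoc)
  qed
qed

section \<open>The action read off from the graph, its uniqueness and its consistency\<close>

definition GL_action where
  "GL_action = (\<lambda>m\<in>carrier (GL R). fst (the_inv_into F.generated snd m))"

lemma GL_action_eq:
  assumes "w \<in> F.generated" shows "GL_action (snd w) = fst w"
proof -
  have "snd w \<in> Units R" using assms F.\<pi>_image_generated by blast
  then show ?thesis
    using the_inv_into_f_f[OF F.\<pi>_inj_on_generated assms] by (simp add: GL_action_def units_of_carrier)
qed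

lemma GL_actionE:
  assumes "m \<in> Units R"
  obtains w where "w \<in> F.generated" "w \<in> carrier W" "snd w = m" "GL_action m = fst w"
proof -
  have "m \<in> snd ` F.generated" unfolding F.\<pi>_image_generated by (rule assms)
  then obtain w where w: "w \<in> F.generated" "snd w = m" by (elim imageE) simp
  show ?thesis
    by (rule that[OF w(1) subgroup.mem_carrier[OF F.generated_subgroup w(1)] w(2)])
      (use GL_action_eq[OF w(1)] w(2) in simp)
qed

text \<open>Multiplicativity reflects that the graph is a subgroup, the Peiffer identity that it
  contains each \<open>\<kappa> g\<close>, and equivariance is
  \<open>generated_equivariant\<close>.\<close>

lemma crossed_module_GL_action: "crossed_module S (GL R) (st R n e) GL_action"
proof unfold_locales
  show "st R n e \<in> hom S (GL R)" by (rule st_hom[OF ring_axioms complete])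
  show "GL_action \<in> hom (GL R) (AutoGroup S)"
  proof (rule homI)
    fix l m assume "l \<in> carrier (GL R)" "m \<in> carrier (GL R)"
    then have lm: "l \<in> Units R" "m \<in> Units R" by (simp_all add: units_of_carrier)
    obtain v where v: "v \<in> F.generated" "v \<in> carrier W" "snd v = l" "GL_action l = fst v" using GL_actionE[OF lm(1)] .
    obtain w where w: "w \<in> F.generated" "w \<in> carrier W" "snd w = m" "GL_action m = fst w" using GL_actionE[OF lm(2)] .
    show "GL_action (l \<otimes>\<^bsub>GL R\<^esub> m) = GL_action l \<otimes>\<^bsub>AutoGroup S\<^esub> GL_action m"
      using GL_action_eq[OF subgroup.m_closed[OF F.generated_subgroup v(1) w(1)]] v w
      by (simp add: W_mult units_of_mult)
  next
    fix m assume "m \<in> carrier (GL R)"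
    then have "m \<in> Units R" by (simp add: units_of_carrier)
    then obtain w where "w \<in> carrier W" "GL_action m = fst w" by (rule GL_actionE) blast
    then show "GL_action m \<in> carrier (AutoGroup S)" by (simp add: carrier_W S.AutoGroup_simps)
  qed
next
  fix m y assume "m \<in> carrier (GL R)" and y: "y \<in> carrier S"
  then have m: "m \<in> Units R" by (simp add: units_of_carrier)
  obtain w where w: "w \<in> F.generated" "w \<in> carrier W" "snd w = m" "GL_action m = fst w" using GL_actionE[OF m] .
  show "st R n e (GL_action m y) = m \<otimes>\<^bsub>GL R\<^esub> st R n e y \<otimes>\<^bsub>GL R\<^esub> inv\<^bsub>GL R\<^esub> m"
    using generated_equivariant[OF w(1)] y m by (simp add: w units_of_mult units_of_inv)
next
  fix g y assume g: "g \<in> carrier S" and y: "y \<in> carrier S"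
  show "GL_action (st R n e g) y = g \<otimes>\<^bsub>S\<^esub> y \<otimes>\<^bsub>S\<^esub> inv\<^bsub>S\<^esub> g"
    using GL_action_eq[OF \<kappa>_generated[OF g]] y by (simp add: \<kappa>_def S.conj_auto_apply)
qed

lemma crossed_module_unique:
  assumes cm: "crossed_module S (GL R) (st R n e) act" "crossed_module S (GL R) (st R n e) act'"
    and m: "m \<in> carrier (GL R)"
  shows "act m = act' m"
proof -
  interpret C: crossed_module S "GL R" "st R n e" act by (rule cm(1))
  interpret C': crossed_module S "GL R" "st R n e" act' by (rule cm(2))
  have auto: "act m \<in> auto S" "act' m \<in> auto S"
    using C.act_hom C'.act_hom m by (auto simp: hom_def S.AutoGroup_simps)
  note ap = S.auto_apply[OF auto(1)] and ap' = S.auto_apply[OF auto(2)]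
  have act_one: "act \<one>\<^bsub>GL R\<^esub> = (\<lambda>x\<in>carrier S. x)"
    using hom_one[OF C.act_hom GL.is_group A.is_group] by (simp add: S.AutoGroup_simps)
  show ?thesis
  proof (rule S_auto_eqI_central[OF auto])
    fix i j a y assume ij: "i \<in> {1..n}" "j \<in> {1..n}" "i \<noteq> j" "a \<in> peirce R e i j" and y: "y \<in> carrier S"
    let ?x = "xs i j a"
    let ?z = "act m ?x \<otimes>\<^bsub>S\<^esub> inv\<^bsub>S\<^esub> act' m ?x"
    have xc: "?x \<in> carrier S" using xs_closed ij by blast
    have c: "act m ?x \<in> carrier S" "act' m ?x \<in> carrier S" using ap ap' xc by auto
    have "st R n e (act m ?x) = st R n e (act' m ?x)"
      using C.equivariant[OF m xc] C'.equivariant[OF m xc] by simp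
    then have "st R n e ?z = \<one>\<^bsub>GL R\<^esub>" using c st_Units[OF c(2)] by (simp add: st_mult st_inv units_of_one)
    \<comment> \<open>\<open>?z\<close> lies over the identity, which acts trivially; the Peiffer
      identity turns this into the centrality that \<open>S_auto_eqI_central\<close> asks
      for.\<close>
    then have "?z \<otimes>\<^bsub>S\<^esub> y \<otimes>\<^bsub>S\<^esub> inv\<^bsub>S\<^esub> ?z = y" using C.peiffer[of ?z y] c y act_one by simp
    then show "?z \<otimes>\<^bsub>S\<^esub> y = y \<otimes>\<^bsub>S\<^esub> ?z"
      using c y S.inv_solve_right'[of y "?z \<otimes>\<^bsub>S\<^esub> y" ?z] by simp
  qed
qed

text \<open>The element \<open>\<kappa> g\<close> times \<open>\<delta> h\<close> belongs to the
  graph, lies over the product of \<open>st R n e g\<close> and \<open>h\<close>, and has the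
  semidirect action as its first component. Uniqueness transfers this from \<open>GL_action\<close>
  to any \<open>act\<close>.\<close>

lemma semidirect_action_eq:
  assumes cm: "crossed_module S (GL R) (st R n e) act"
    and g: "g \<in> carrier S" and h: "h \<in> Diag"
  shows "semidirect_action S (diagonal_action R n e) (g, h) = act (st R n e g \<otimes>\<^bsub>GL R\<^esub> h)"
proof -
  let ?w = "\<kappa> g \<otimes>\<^bsub>W\<^esub> \<delta> h"
  have w: "?w \<in> F.generated"
    using subgroup.m_closed[OF F.generated_subgroup \<kappa>_generated[OF g] F.\<delta>_generated[OF h]] .
  have wc: "?w \<in> carrier W" using subgroup.mem_carrier[OF F.generated_subgroup w] .
  have snd_w: "snd ?w = st R n e g \<otimes>\<^bsub>GL R\<^esub> h" by (simp add: \<kappa>_def \<delta>_def W_mult units_of_mult)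
  have "semidirect_action S (diagonal_action R n e) (g, h) = fst ?w"
  proof
    fix y show "semidirect_action S (diagonal_action R n e) (g, h) y = fst ?w y"
    proof (cases "y \<in> carrier S")
      case True
      then show ?thesis using diagonal_action_closed[OF h True]
        by (simp only: W_mult_apply[OF \<kappa>_closed[OF g] \<delta>_closed'[OF h] True])
          (simp add: semidirect_action_def \<kappa>_def \<delta>_def S.conj_auto_apply)
    next
      \<comment> \<open>Both functions are extensional, so they agree outside the carrier as
        well.\<close>
      case False
      have "fst ?w \<in> extensional (carrier S)" using wc S.auto_apply(4) by (simp add: carrier_W)
      then show ?thesis using False by (simp add: semidirect_action_def extensional_def)
    qed
  qed
  also have "\<dots> = GL_action (st R n e g \<otimes>\<^bsub>GL R\<^esub> h)" using GL_action_eq[OF w] snd_w by simp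
  also have "\<dots> = act (st R n e g \<otimes>\<^bsub>GL R\<^esub> h)"
  proof (rule crossed_module_unique[OF crossed_module_GL_action cm])
    show "st R n e g \<otimes>\<^bsub>GL R\<^esub> h \<in> carrier (GL R)"
      using st_Units[OF g] diagonal_groupD(1)[OF h] by (simp add: units_of_carrier units_of_mult)
  qed
  finally show ?thesis .
qed

end

text \<open>The values of \<open>act\<close> outside \<open>GL R\<close> are arbitrary;
  \<open>extensional\<close> normalizes them so that uniqueness is an equality of functions.
  Consistency is stated for every crossed module structure, without this normalization.\<close>

theorem theorem1:
  fixes R :: "('a, 'm) ring_scheme" and n :: nat and e :: "nat \<Rightarrow> 'a"
  assumes "ring R"
    and "semilocal TYPE('d) R"
    and "complete_orthogonal_idempotents R n e"
    and "\<forall>i\<in>{1..n}. \<forall>j\<in>{1..n}. morita_equivalent R (e i) (e j)"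
    and "n \<ge> 3"
  shows "(\<exists>!act. act \<in> extensional (carrier (GL R)) \<and>
            crossed_module (St R n e) (GL R) (st R n e) act) \<and>
         (\<forall>act. crossed_module (St R n e) (GL R) (st R n e) act \<longrightarrow>
            (\<forall>(g, h)\<in>carrier (semidirect_product (St R n e) (diagonal_group R n e)
                                (diagonal_action R n e)).
               semidirect_action (St R n e) (diagonal_action R n e) (g, h) =
               act (st R n e g \<otimes>\<^bsub>GL R\<^esub> h)))"
proof -
  interpret steinberg_setting R n e
    using assms ring.semilocal_stable_range_one[OF assms(1,2)]
    by (intro steinberg_setting.intro idempotent_family.intro idempotent_family_axioms.intro
        steinberg_setting_axioms.intro) (auto simp: morita_equivalent_def)
  have ext: "GL_action \<in> extensional (carrier (GL R))" by (simp add: GL_action_def)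
  show ?thesis
  proof (intro conjI allI impI ballI)
    show "\<exists>!act. act \<in> extensional (carrier (GL R)) \<and> crossed_module S (GL R) (st R n e) act"
    proof (rule ex1I[of _ GL_action])
      fix act assume act: "act \<in> extensional (carrier (GL R)) \<and> crossed_module S (GL R) (st R n e) act"
      then show "act = GL_action"
        using ext crossed_module_unique[OF _ crossed_module_GL_action]
        by (intro extensionalityI[of act "carrier (GL R)" GL_action]) auto
    qed (use ext crossed_module_GL_action in simp)
  next
    fix act p assume "crossed_module S (GL R) (st R n e) act"
      and "p \<in> carrier (semidirect_product S (diagonal_group R n e) (diagonal_action R n e))"
    then show "case p of (g, h) \<Rightarrow> semidirect_action S (diagonal_action R n e) (g, h) =
        act (st R n e g \<otimes>\<^bsub>GL R\<^esub> h)"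
      using semidirect_action_eq by (auto simp: semidirect_product_def)
  qed
qed

end
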